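(* Let $E$ be a complex elliptic curve, let $\varphi$ be an endomorphism of $E$, let $\mathcal{P}$ be the Poincaré torsor on $E\times E$, viewed as a group variety over $E$ via the first projection $\mathrm{pr}_1$, and let $t_\varphi\colon E\to\mathcal{P}$ be the Ribet section attached to $\varphi$. Then for every torsion point $x$ in $E$, $t_\varphi(x)$ is a torsion point of the group $\mathcal{P}_x$.
   Context: Notation. Let $\mathcal{M}=\mathcal{O}(0)$ be the invertible $\mathcal{O}$-module on $E$ attached to the divisor $0$ (the origin). Let $\lambda\colon E\to E^\vee$ be the principal polarisation sending a point $P$ to the class of $(\mathrm{tr}_P^*\mathcal{M})\otimes\mathcal{M}^{-1}$, that is, the class of $\mathcal{O}((-P)-0)\cong\mathcal{O}(0-P)$, where $\mathrm{tr}_P$ is translation by $P$. For $\varphi\in\mathrm{End}(E)$ put $\overline{\varphi}:=\lambda^{-1}\circ\varphi^\vee\circ\lambda$ and $\alpha:=\varphi-\overline{\varphi}$. The Poincaré bundle on $E\times E$ is $\mathcal{L}=\mathrm{add}^*\mathcal{M}\otimes\mathrm{pr}_1^*\mathcal{M}^{-1}\otimes\mathrm{pr}_2^*\mathcal{M}^{-1}\otimes 0^*\mathcal{M}$, where $\mathrm{add}$, $\mathrm{pr}_1$, $\mathrm{pr}_2$, $0$ are the addition map, the projections and the constant map $0$ from $E\times E$ to $E$; its fibre is $\mathcal{L}(x,y)=\mathcal{M}(x+y)\otimes\mathcal{M}(x)^{-1}\otimes\mathcal{M}(y)^{-1}\otimes\mathcal{M}(0)$. It is canonically trivial on $E\times\{0\}$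 and $\{0\}\times E$. The Poincaré torsor is the $\mathbb{G}_{\mathrm m}$-torsor $\mathcal{P}=\mathrm{Isom}(\mathcal{O},\mathcal{L})$ on $E\times E$, with fibres $\mathcal{P}(x,y)=\mathrm{Isom}(\mathbb{C},\mathcal{L}(x,y))$. The theorem of the cube gives canonical isomorphisms $\mathcal{L}(x,y+z)=\mathcal{L}(x,y)\otimes\mathcal{L}(x,z)$; via the resulting maps $\mathcal{P}(x,y)\times\mathcal{P}(x,z)\to\mathcal{P}(x,y+z)$, $(a,b)\mapsto a\otimes b$, $\mathcal{P}$ is a commutative group variety over $E$ via $\mathrm{pr}_1$, whose fibre $\mathcal{P}_x$ at $x\in E$ is an extension of $E$ by $\mathbb{G}_{\mathrm m}$. Let $\gamma=(\mathrm{id},\alpha)\colon E\to E\times E$, $P\mapsto(P,\alpha(P))$. The invertible $\mathcal{O}$-module $\gamma^*\mathcal{L}$ on $E$ is canonically trivial: it has a unique trivialisation $t_\varphi\colon\mathcal{O}\to\gamma^*\mathcal{L}$ whose value at $0$ is $1\in\mathbb{C}=\mathcal{L}(0,0)$. For each $x\in E$ it gives an element $t_\varphi(x)\in\mathcal{P}(x,\alpha(x))\subset\mathcal{P}_x$; the resulting section $t_\varphi$ of $\mathcal{P}$ over $E$ (via $\mathrm{pr}_1$) is the Ribet section attached to $\varphi$. *)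

theory Defs
  imports "HOL-Complex_Analysis.Complex_Analysis" "HOL-Algebra.Coset"
begin

section \<open>One-dimensional complex vector spaces\<close>

text \<open>
  Addition on a one-dimensional complex vector space is determined by scalar multiplication
  (\<open>a e + b e = (a + b) e\<close>), and a map between two such spaces is linear iff it commutes
  with scalar multiplication. A line is therefore recorded by its vectors and scalar
  multiplication only.
\<close>

record 'a cline =
  vecs :: "'a set"
  scl :: "complex \<Rightarrow> 'a \<Rightarrow> 'a"

definition line_basis :: "'a cline \<Rightarrow> 'a \<Rightarrow> bool" where
  "line_basis V e \<longleftrightarrow> e \<in> vecs V \<and> bij_betw (\<lambda>c. scl V c e) UNIV (vecs V)"

definition is_line :: "'a cline \<Rightarrow> bool" where
  "is_line V \<longleftrightarrow> (\<exists>e. line_basis V e) \<and>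
     (\<forall>c d. \<forall>v \<in> vecs V. scl V c (scl V d v) = scl V (c * d) v)"

definition c_line :: "complex cline" where
  "c_line = \<lparr> vecs = UNIV, scl = (*) \<rparr>"

definition line_isos :: "'a cline \<Rightarrow> 'b cline \<Rightarrow> ('a \<Rightarrow> 'b) set" where
  "line_isos V W = {f \<in> vecs V \<rightarrow>\<^sub>E vecs W.
     bij_betw f (vecs V) (vecs W) \<and> (\<forall>c. \<forall>v \<in> vecs V. f (scl V c v) = scl W c (f v))}"

text \<open>The dual line; functionals are extended by 0 off the line.\<close>

definition dual_line :: "'a cline \<Rightarrow> ('a \<Rightarrow> complex) cline" where
  "dual_line V =
     \<lparr> vecs = {f. (\<forall>c. \<forall>v \<in> vecs V. f (scl V c v) = c * f v) \<and> (\<forall>v. v \<notin> vecs V \<longrightarrow> f v = 0)},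
       scl = (\<lambda>c f v. c * f v) \<rparr>"

definition dual_vec :: "'a cline \<Rightarrow> 'a \<Rightarrow> ('a \<Rightarrow> complex)" where
  "dual_vec V e = (\<lambda>v. if v \<in> vecs V then (THE c. v = scl V c e) else 0)"

text \<open>
  The tensor product is realised as the dual of the space of bilinear forms:
  \<open>v \<otimes> w\<close> is evaluation at \<open>(v, w)\<close>. For lines every tensor is pure.
\<close>

definition bilin :: "'a cline \<Rightarrow> 'b cline \<Rightarrow> ('a \<Rightarrow> 'b \<Rightarrow> complex) set" where
  "bilin V W = {\<beta>. \<forall>c. \<forall>v \<in> vecs V. \<forall>w \<in> vecs W.
     \<beta> (scl V c v) w = c * \<beta> v w \<and> \<beta> v (scl W c w) = c * \<beta> v w}"

definition tens :: "'a cline \<Rightarrow> 'b cline \<Rightarrow> 'a \<Rightarrow> 'b \<Rightarrow> (('a \<Rightarrow> 'b \<Rightarrow> complex) \<Rightarrow> complex)" where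
  "tens V W v w = (\<lambda>\<beta>. if \<beta> \<in> bilin V W then \<beta> v w else 0)"

definition tensor_line ::
  "'a cline \<Rightarrow> 'b cline \<Rightarrow> (('a \<Rightarrow> 'b \<Rightarrow> complex) \<Rightarrow> complex) cline" where
  "tensor_line V W =
     \<lparr> vecs = {tens V W v w | v w. v \<in> vecs V \<and> w \<in> vecs W}, scl = (\<lambda>c T \<beta>. c * T \<beta>) \<rparr>"


section \<open>Complex spaces and invertible modules on them\<close>

text \<open>A complex manifold, given by its points, open sets and holomorphic functions on these.\<close>

record 'p cspace =
  pts :: "'p set"
  opn :: "'p set \<Rightarrow> bool"
  hol :: "'p set \<Rightarrow> ('p \<Rightarrow> complex) \<Rightarrow> bool"

definition holo_map :: "'p cspace \<Rightarrow> 'q cspace \<Rightarrow> ('p \<Rightarrow> 'q) \<Rightarrow> bool" where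
  "holo_map X Y f \<longleftrightarrow> f \<in> pts X \<rightarrow> pts Y \<and>
     (\<forall>U. opn Y U \<longrightarrow> opn X (f -` U \<inter> pts X) \<and>
        (\<forall>h. hol Y U h \<longrightarrow> hol X (f -` U \<inter> pts X) (h \<circ> f)))"

text \<open>
  An invertible module is given by its fibres together with an atlas of holomorphic local
  frames \<open>(U, e)\<close>. The holomorphic sections over an open \<open>V\<close> are the \<open>s\<close> such that, for every
  frame, \<open>s = h \<cdot> e\<close> on \<open>U \<inter> V\<close> with \<open>h\<close> holomorphic.
\<close>

record ('p, 'a) lbundle =
  base :: "'p cspace"
  fib :: "'p \<Rightarrow> 'a cline"
  frames :: "('p set \<times> ('p \<Rightarrow> 'a)) set"

definition line_bundle :: "('p, 'a) lbundle \<Rightarrow> bool" where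
  "line_bundle L \<longleftrightarrow>
     (\<forall>p \<in> pts (base L). is_line (fib L p)) \<and>
     (\<forall>(U, e) \<in> frames L. opn (base L) U \<and> (\<forall>p \<in> U. line_basis (fib L p) (e p))) \<and>
     (\<Union>(U, e) \<in> frames L. U) = pts (base L) \<and>
     (\<forall>(U, e) \<in> frames L. \<forall>(V, e') \<in> frames L.
        \<exists>h. hol (base L) (U \<inter> V) h \<and> (\<forall>p \<in> U \<inter> V. e p = scl (fib L p) (h p) (e' p)))"

text \<open>
  Isomorphisms of invertible modules over the common base: fibrewise linear isomorphisms
  whose matrix in local frames is holomorphic.
\<close>

definition bundle_isos :: "('p, 'a) lbundle \<Rightarrow> ('p, 'b) lbundle \<Rightarrow> ('p \<Rightarrow> 'a \<Rightarrow> 'b) set" where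
  "bundle_isos L L' = {k \<in> (\<Pi>\<^sub>E p \<in> pts (base L). line_isos (fib L p) (fib L' p)).
     \<forall>(U, e) \<in> frames L. \<forall>(V, e') \<in> frames L'.
       \<exists>h. hol (base L) (U \<inter> V) h \<and>
           (\<forall>p \<in> U \<inter> V. k p (e p) = scl (fib L' p) (h p) (e' p))}"

definition triv_bundle :: "'p cspace \<Rightarrow> ('p, complex) lbundle" where
  "triv_bundle X = \<lparr> base = X, fib = (\<lambda>p. c_line), frames = {(pts X, \<lambda>p. 1)} \<rparr>"

definition pull :: "'p cspace \<Rightarrow> ('p \<Rightarrow> 'q) \<Rightarrow> ('q, 'a) lbundle \<Rightarrow> ('p, 'a) lbundle" where
  "pull X f L = \<lparr> base = X, fib = (\<lambda>p. fib L (f p)),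
     frames = {(f -` U \<inter> pts X, e \<circ> f) | U e. (U, e) \<in> frames L} \<rparr>"

definition dual_bundle :: "('p, 'a) lbundle \<Rightarrow> ('p, 'a \<Rightarrow> complex) lbundle" where
  "dual_bundle L = \<lparr> base = base L, fib = (\<lambda>p. dual_line (fib L p)),
     frames = {(U, \<lambda>p. dual_vec (fib L p) (e p)) | U e. (U, e) \<in> frames L} \<rparr>"

definition tensor_bundle ::
  "('p, 'a) lbundle \<Rightarrow> ('p, 'b) lbundle \<Rightarrow> ('p, ('a \<Rightarrow> 'b \<Rightarrow> complex) \<Rightarrow> complex) lbundle" where
  "tensor_bundle L L' = \<lparr> base = base L, fib = (\<lambda>p. tensor_line (fib L p) (fib L' p)),
     frames = {(U \<inter> V, \<lambda>p. tens (fib L p) (fib L' p) (e p) (e' p)) | U e V e'.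
                 (U, e) \<in> frames L \<and> (V, e') \<in> frames L'} \<rparr>"

text \<open>
  The class ranges over modules with fibres in a fixed type; every isomorphism class of
  invertible modules is represented in any type into which \<open>\<complex>\<close> embeds.
\<close>

definition pic_class :: "('p, 'a) lbundle \<Rightarrow> ('p, 'a) lbundle set" where
  "pic_class L = {L'. base L' = base L \<and> line_bundle L' \<and> bundle_isos L' L \<noteq> {}}"


section \<open>Complex elliptic curves\<close>

definition is_lattice :: "complex set \<Rightarrow> bool" where
  "is_lattice \<Lambda> \<longleftrightarrow> (\<exists>\<omega>1 \<omega>2. \<omega>1 \<noteq> \<omega>2 \<and> independent {\<omega>1, \<omega>2} \<and>
     \<Lambda> = {of_int m * \<omega>1 + of_int n * \<omega>2 | m n. True})"

definition c_add :: "complex monoid" where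
  "c_add = \<lparr> carrier = UNIV, mult = (+), one = 0 \<rparr>"

text \<open>The elliptic curve \<open>\<complex>/\<Lambda>\<close> as a group; a point is a coset of \<open>\<Lambda>\<close>.\<close>

definition ell :: "complex set \<Rightarrow> complex set monoid" where
  "ell \<Lambda> = c_add Mod \<Lambda>"

definition ell_pr :: "complex set \<Rightarrow> complex \<Rightarrow> complex set" where
  "ell_pr \<Lambda> z = \<Lambda> #>\<^bsub>c_add\<^esub> z"

definition quot_space ::
  "('c::topological_space \<Rightarrow> 'p) \<Rightarrow> ('c set \<Rightarrow> ('c \<Rightarrow> complex) \<Rightarrow> bool) \<Rightarrow> 'p cspace" where
  "quot_space q H = \<lparr> pts = range q,
     opn = (\<lambda>U. U \<subseteq> range q \<and> open (q -` U)),
     hol = (\<lambda>U h. H (q -` U) (h \<circ> q)) \<rparr>"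

text \<open>Holomorphy in several variables on an open set: the total derivative is complex linear.\<close>

definition holo2 :: "(complex \<times> complex) set \<Rightarrow> (complex \<times> complex \<Rightarrow> complex) \<Rightarrow> bool" where
  "holo2 U h \<longleftrightarrow> (\<forall>p \<in> U. \<exists>a b. (h has_derivative (\<lambda>(u, v). a * u + b * v)) (at p))"

definition holo3 ::
  "(complex \<times> complex \<times> complex) set \<Rightarrow> (complex \<times> complex \<times> complex \<Rightarrow> complex) \<Rightarrow> bool" where
  "holo3 U h \<longleftrightarrow>
     (\<forall>p \<in> U. \<exists>a b c. (h has_derivative (\<lambda>(u, v, w). a * u + b * v + c * w)) (at p))"

definition ell1 :: "complex set \<Rightarrow> complex set cspace" where
  "ell1 \<Lambda> = quot_space (ell_pr \<Lambda>) (\<lambda>U h. h holomorphic_on U)"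

definition ell2 :: "complex set \<Rightarrow> (complex set \<times> complex set) cspace" where
  "ell2 \<Lambda> = quot_space (map_prod (ell_pr \<Lambda>) (ell_pr \<Lambda>)) holo2"

definition ell3 :: "complex set \<Rightarrow> (complex set \<times> complex set \<times> complex set) cspace" where
  "ell3 \<Lambda> = quot_space (map_prod (ell_pr \<Lambda>) (map_prod (ell_pr \<Lambda>) (ell_pr \<Lambda>))) holo3"

definition ell_End :: "complex set \<Rightarrow> (complex set \<Rightarrow> complex set) set" where
  "ell_End \<Lambda> = {\<phi> \<in> hom (ell \<Lambda>) (ell \<Lambda>). holo_map (ell1 \<Lambda>) (ell1 \<Lambda>) \<phi>}"


section \<open>The invertible module of a divisor\<close>

text \<open>
  Meromorphic functions on \<open>E\<close> are functions on points whose values at poles are irrelevant.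
  \<open>od_germ \<Lambda> D f z g\<close>: near \<open>z\<close>, the function \<open>f\<close> is \<open>g\<close> times the local generator
  \<open>(w - z)\<^bsup>- D(z)\<^esup>\<close> of \<open>\<O>(D)\<close>.
\<close>

definition od_germ ::
  "complex set \<Rightarrow> (complex set \<Rightarrow> int) \<Rightarrow> (complex set \<Rightarrow> complex) \<Rightarrow> complex \<Rightarrow>
   (complex \<Rightarrow> complex) \<Rightarrow> bool" where
  "od_germ \<Lambda> D f z g \<longleftrightarrow> g analytic_on {z} \<and>
     (\<forall>\<^sub>F w in at z. f (ell_pr \<Lambda> w) = g w * (w - z) powi (- D (ell_pr \<Lambda> z)))"

definition od_stalk ::
  "complex set \<Rightarrow> (complex set \<Rightarrow> int) \<Rightarrow> complex set \<Rightarrow> (complex set \<Rightarrow> complex) set" where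
  "od_stalk \<Lambda> D x = {f. \<forall>z \<in> x. \<exists>g. od_germ \<Lambda> D f z g}"

text \<open>The residue class of \<open>f\<close> in the fibre \<open>\<O>(D)\<^sub>x / m\<^sub>x \<O>(D)\<^sub>x\<close>.\<close>

definition od_val ::
  "complex set \<Rightarrow> (complex set \<Rightarrow> int) \<Rightarrow> complex set \<Rightarrow> (complex set \<Rightarrow> complex) \<Rightarrow>
   (complex set \<Rightarrow> complex) set" where
  "od_val \<Lambda> D x f = {f' \<in> od_stalk \<Lambda> D x.
     \<forall>z \<in> x. \<exists>g. od_germ \<Lambda> D (\<lambda>y. f y - f' y) z g \<and> g z = 0}"

definition od_fib ::
  "complex set \<Rightarrow> (complex set \<Rightarrow> int) \<Rightarrow> complex set \<Rightarrow> (complex set \<Rightarrow> complex) set cline" where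
  "od_fib \<Lambda> D x = \<lparr> vecs = od_val \<Lambda> D x ` od_stalk \<Lambda> D x,
     scl = (\<lambda>c A. \<Union>f \<in> A. od_val \<Lambda> D x (\<lambda>y. c * f y)) \<rparr>"

text \<open>\<open>\<O>(D)\<close>; its frames are the local generators of the sheaf.\<close>

definition od_bundle ::
  "complex set \<Rightarrow> (complex set \<Rightarrow> int) \<Rightarrow>
   (complex set, (complex set \<Rightarrow> complex) set) lbundle" where
  "od_bundle \<Lambda> D = \<lparr> base = ell1 \<Lambda>, fib = od_fib \<Lambda> D,
     frames = {(U, \<lambda>x. od_val \<Lambda> D x f) | U f. opn (ell1 \<Lambda>) U \<and>
                 (\<forall>x \<in> U. \<forall>z \<in> x. \<exists>g. od_germ \<Lambda> D f z g \<and> g z \<noteq> 0)} \<rparr>"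

type_synonym mfib = "(complex set \<Rightarrow> complex) set"

definition M_bundle :: "complex set \<Rightarrow> (complex set, mfib) lbundle" where
  "M_bundle \<Lambda> = od_bundle \<Lambda> (\<lambda>x. if x = \<one>\<^bsub>ell \<Lambda>\<^esub> then 1 else 0)"


section \<open>The principal polarisation and the Rosati involution\<close>

type_synonym pfib = "(mfib \<Rightarrow> (mfib \<Rightarrow> complex) \<Rightarrow> complex) \<Rightarrow> complex"

text \<open>Points of \<open>E\<^sup>\<or>\<close> are isomorphism classes of invertible modules on \<open>E\<close>.\<close>

definition polarisation :: "complex set \<Rightarrow> complex set \<Rightarrow> (complex set, pfib) lbundle set" where
  "polarisation \<Lambda> P = pic_class (tensor_bundle
     (pull (ell1 \<Lambda>) (\<lambda>x. x \<otimes>\<^bsub>ell \<Lambda>\<^esub> P) (M_bundle \<Lambda>)) (dual_bundle (M_bundle \<Lambda>)))"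

definition dual_endo ::
  "complex set \<Rightarrow> (complex set \<Rightarrow> complex set) \<Rightarrow>
   (complex set, 'a) lbundle set \<Rightarrow> (complex set, 'a) lbundle set" where
  "dual_endo \<Lambda> \<phi> C = (\<Union>N \<in> C. pic_class (pull (ell1 \<Lambda>) \<phi> N))"

definition rosati ::
  "complex set \<Rightarrow> (complex set \<Rightarrow> complex set) \<Rightarrow> (complex set \<Rightarrow> complex set)" where
  "rosati \<Lambda> \<phi> =
     inv_into (carrier (ell \<Lambda>)) (polarisation \<Lambda>) \<circ> dual_endo \<Lambda> \<phi> \<circ> polarisation \<Lambda>"

definition ribet_alpha ::
  "complex set \<Rightarrow> (complex set \<Rightarrow> complex set) \<Rightarrow> (complex set \<Rightarrow> complex set)" where
  "ribet_alpha \<Lambda> \<phi> = (\<lambda>x. \<phi> x \<otimes>\<^bsub>ell \<Lambda>\<^esub> inv\<^bsub>ell \<Lambda>\<^esub> (rosati \<Lambda> \<phi> x))"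


section \<open>The Poincare bundle and torsor\<close>

type_synonym lfib =
  "(((pfib \<Rightarrow> (mfib \<Rightarrow> complex) \<Rightarrow> complex) \<Rightarrow> complex) \<Rightarrow> mfib \<Rightarrow> complex) \<Rightarrow> complex"

definition poincare_bundle :: "complex set \<Rightarrow> (complex set \<times> complex set, lfib) lbundle" where
  "poincare_bundle \<Lambda> =
     tensor_bundle (tensor_bundle (tensor_bundle
       (pull (ell2 \<Lambda>) (\<lambda>(x, y). x \<otimes>\<^bsub>ell \<Lambda>\<^esub> y) (M_bundle \<Lambda>))
       (pull (ell2 \<Lambda>) fst (dual_bundle (M_bundle \<Lambda>))))
       (pull (ell2 \<Lambda>) snd (dual_bundle (M_bundle \<Lambda>))))
       (pull (ell2 \<Lambda>) (\<lambda>_. \<one>\<^bsub>ell \<Lambda>\<^esub>) (M_bundle \<Lambda>))"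

text \<open>
  The canonical basis \<open>1\<close> of
  \<open>L(x,0) = M(x) \<otimes> M(x)\<^sup>-\<^sup>1 \<otimes> M(0)\<^sup>-\<^sup>1 \<otimes> M(0) = \<complex>\<close>, namely
  \<open>m \<otimes> m\<^sup>\<or> \<otimes> n\<^sup>\<or> \<otimes> n\<close> for any bases \<open>m\<close> of \<open>M(x)\<close> and \<open>n\<close> of \<open>M(0)\<close>.
\<close>

definition poincare_unit :: "complex set \<Rightarrow> complex set \<Rightarrow> lfib" where
  "poincare_unit \<Lambda> x =
     (let A = fib (M_bundle \<Lambda>) x; B = fib (M_bundle \<Lambda>) \<one>\<^bsub>ell \<Lambda>\<^esub>;
          AA = tensor_line A (dual_line A); AAB = tensor_line AA (dual_line B)
      in THE u. \<exists>m n. line_basis A m \<and> line_basis B n \<and>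
           u = tens AAB B
                 (tens AA (dual_line B) (tens A (dual_line A) m (dual_vec A m)) (dual_vec B n)) n)"

definition poincare_torsor ::
  "complex set \<Rightarrow> complex set \<Rightarrow> complex set \<Rightarrow> (complex \<Rightarrow> lfib) set" where
  "poincare_torsor \<Lambda> x y = line_isos c_line (fib (poincare_bundle \<Lambda>) (x, y))"

text \<open>
  The canonical isomorphism \<open>L(x,y) \<otimes> L(x,z) \<rightarrow> L(x,y+z)\<close> of the theorem of the cube. An
  isomorphism of invertible modules on \<open>E \<times> E \<times> E\<close> is unique up to a constant; the canonical
  one is the obvious isomorphism \<open>\<complex> \<otimes> \<complex> \<rightarrow> \<complex>\<close> on fibres at the origin.
\<close>

definition cube_iso ::
  "complex set \<Rightarrow> complex set \<times> complex set \<times> complex set \<Rightarrow>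
   ((lfib \<Rightarrow> lfib \<Rightarrow> complex) \<Rightarrow> complex) \<Rightarrow> lfib" where
  "cube_iso \<Lambda> =
     (let L = poincare_bundle \<Lambda>; o0 = \<one>\<^bsub>ell \<Lambda>\<^esub>; L00 = fib L (o0, o0); u = poincare_unit \<Lambda> o0
      in THE k. k \<in> bundle_isos
             (tensor_bundle (pull (ell3 \<Lambda>) (\<lambda>(x, y, z). (x, y)) L)
                            (pull (ell3 \<Lambda>) (\<lambda>(x, y, z). (x, z)) L))
             (pull (ell3 \<Lambda>) (\<lambda>(x, y, z). (x, y \<otimes>\<^bsub>ell \<Lambda>\<^esub> z)) L) \<and>
           k (o0, o0, o0) (tens L00 L00 u u) = u)"

text \<open>
  The fibre \<open>P\<^sub>x\<close> over \<open>x\<close> of the torsor under the first projection; the element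
  \<open>(y, a)\<close> is \<open>a \<in> P(x,y)\<close>. In the product, \<open>\<lambda>c. a c \<otimes> b 1\<close> is
  \<open>a \<otimes> b : \<complex> = \<complex> \<otimes> \<complex> \<rightarrow> L(x,y) \<otimes> L(x,z)\<close>.
\<close>

definition poincare_group ::
  "complex set \<Rightarrow> complex set \<Rightarrow> (complex set \<times> (complex \<Rightarrow> lfib)) monoid" where
  "poincare_group \<Lambda> x = \<lparr>
     carrier = (SIGMA y : carrier (ell \<Lambda>). poincare_torsor \<Lambda> x y),
     mult = (\<lambda>(y, a) (z, b). (y \<otimes>\<^bsub>ell \<Lambda>\<^esub> z,
        \<lambda>c. cube_iso \<Lambda> (x, y, z)
              (tens (fib (poincare_bundle \<Lambda>) (x, y)) (fib (poincare_bundle \<Lambda>) (x, z)) (a c) (b 1)))),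
     one = (\<one>\<^bsub>ell \<Lambda>\<^esub>,
        \<lambda>c. scl (fib (poincare_bundle \<Lambda>) (x, \<one>\<^bsub>ell \<Lambda>\<^esub>)) c (poincare_unit \<Lambda> x)) \<rparr>"


section \<open>The Ribet section\<close>

definition ribet_triv ::
  "complex set \<Rightarrow> (complex set \<Rightarrow> complex set) \<Rightarrow> complex set \<Rightarrow> complex \<Rightarrow> lfib" where
  "ribet_triv \<Lambda> \<phi> = (THE t.
     t \<in> bundle_isos (triv_bundle (ell1 \<Lambda>))
           (pull (ell1 \<Lambda>) (\<lambda>x. (x, ribet_alpha \<Lambda> \<phi> x)) (poincare_bundle \<Lambda>)) \<and>
     t \<one>\<^bsub>ell \<Lambda>\<^esub> 1 = poincare_unit \<Lambda> \<one>\<^bsub>ell \<Lambda>\<^esub>)"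

definition ribet_section ::
  "complex set \<Rightarrow> (complex set \<Rightarrow> complex set) \<Rightarrow> complex set \<Rightarrow>
   complex set \<times> (complex \<Rightarrow> lfib)" where
  "ribet_section \<Lambda> \<phi> x = (ribet_alpha \<Lambda> \<phi> x, ribet_triv \<Lambda> \<phi> x)"

definition torsion_point :: "('a, 'b) monoid_scheme \<Rightarrow> 'a \<Rightarrow> bool" where
  "torsion_point G g \<longleftrightarrow> g \<in> carrier G \<and> (\<exists>n::nat. n > 0 \<and> g [^]\<^bsub>G\<^esub> n = \<one>\<^bsub>G\<^esub>)"

end

theory Submission
  imports Defs
begin

text \<open>
  Everything is computed on the universal cover. A theta function with simple zeros on \<open>\<Lambda>\<close>
  and \<open>\<theta>(z + l) = k(l) exp(B cnj(l) z) \<theta>(z)\<close>, where \<open>B = \<pi> / covol\<close>, gives a frame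
  \<open>m(z)\<close> of \<open>M\<close> at every \<open>z\<close> in the plane, hence frames of all bundles built from \<open>M\<close>;
  such a bundle is known up to isomorphism from the multipliers of its frame, and normalised
  isomorphisms are unique by Liouville's theorem. The Poincare bundle has a frame \<open>u(z, w)\<close> with
  \<open>u(z + k, w + l) = exp(- B (cnj(l) z + cnj(k) w + cnj(l) k)) u(z, w)\<close>, and the isomorphism of
  the theorem of the cube is \<open>u(z, w) \<otimes> u(z, v) \<mapsto> u(z, w + v)\<close>. If \<open>\<phi>\<close> is multiplication by
  \<open>c\<close> then its Rosati conjugate is multiplication by \<open>cnj c\<close>, because the exponents are
  antilinear in the lattice vector, and with \<open>d = c - cnj c\<close> the multipliers of \<open>u(z, d z)\<close> are
  trivial, so the Ribet section at \<open>z\<close> is \<open>u(z, d z)\<close>. Its \<open>n\<close>-th power is \<open>u(z, n d z)\<close>; if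
  \<open>N z\<close> lies in \<open>\<Lambda>\<close>, then for \<open>n = N\<^sup>2\<close> this is \<open>u(z, 0)\<close>, the neutral element.
\<close>

section \<open>The Jacobi product\<close>

text \<open>The bundles, the group law and the Ribet section are picked by \<open>THE\<close> or by
  inverse images among iterated function types, so they are not evaluated directly; frames on the
  plane turn each of them into a scalar function of the lifts. The one analytic input is a function
  that removes the pole allowed at the origin. The module of the origin is not trivial on the curve,
  so this is possible only upstairs, and Jacobi's product supplies the function. The constant B is
  the one for which Legendre's relation B (cnj(\<omega>1) \<omega>2 - \<omega>1 cnj(\<omega>2)) = 2
  pi i holds. The arithmetic is concentrated in \<open>exp_symmetric\<close>: B (cnj(l) k - cnj(k)
  l) lies in 2 pi i Z for lattice vectors k and l, which is the commutativity of k + l seen through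
  the multipliers of the theta function. Applied to c l and l it makes the multipliers of u(z, d z)
  trivial, and the same instance removes the scalar left over at a torsion point. The Rosati
  conjugate is an inverse image under the polarisation, hence determined only by injectivity; that
  is where Legendre's relation enters a second time.\<close>

definition qprod :: "complex \<Rightarrow> complex \<Rightarrow> complex" where
  "qprod q u = (\<Prod>n. 1 - q ^ n * u)"

lemma qprod_has_prod:
  assumes "norm q < 1"
  shows "(\<lambda>n. 1 - q ^ n * u) has_prod qprod q u"
proof -
  have "summable (\<lambda>n. norm q ^ n * norm u)"
    using assms by (intro summable_mult2 summable_geometric) auto
  hence "abs_convergent_prod (\<lambda>n. 1 - q ^ n * u)"
    by (intro summable_imp_abs_convergent_prod) (simp add: norm_mult norm_power)
  thus ?thesis
    unfolding qprod_def using abs_convergent_prod_imp_convergent_prod convergent_prod_has_prod by blast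
qed

lemma qprod_eq_0_iff:
  assumes "norm q < 1"
  shows "qprod q u = 0 \<longleftrightarrow> (\<exists>n. q ^ n * u = 1)"
proof -
  have "qprod q u = 0 \<longleftrightarrow> 0 \<in> range (\<lambda>n. 1 - q ^ n * u)"
    by (rule has_prod_eq_0_iff[OF qprod_has_prod[OF assms]])
  also have "\<dots> \<longleftrightarrow> (\<exists>n. q ^ n * u = 1)"
    by (metis (no_types, lifting) image_iff eq_iff_diff_eq_0 UNIV_I)
  finally show ?thesis .
qed

text \<open>\<open>qprod q u\<close> is the q-Pochhammer symbol of \<open>u\<close>. Splitting off
  its factor at \<open>n = 0\<close> gives the functional equation behind both the quasi-periodicity
  in \<tau> and the simple zero at 0.\<close>

lemma qprod_rec:
  assumes "norm q < 1"
  shows "qprod q u = (1 - u) * qprod q (q * u)"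
proof -
  have "(\<lambda>N. \<Prod>n\<le>N. 1 - q ^ n * (q * u)) \<longlonglongrightarrow> qprod q (q * u)"
    by (rule has_prod_imp_tendsto[OF qprod_has_prod[OF assms]])
  hence "(\<lambda>N. (1 - u) * (\<Prod>n\<le>N. 1 - q ^ n * (q * u))) \<longlonglongrightarrow> (1 - u) * qprod q (q * u)"
    by (intro tendsto_intros)
  also have "(\<lambda>N. (1 - u) * (\<Prod>n\<le>N. 1 - q ^ n * (q * u))) = (\<lambda>N. \<Prod>n\<le>Suc N. 1 - q ^ n * u)"
    unfolding prod.atMost_Suc_shift by (simp add: power_commutes mult.assoc mult.left_commute)
  finally show ?thesis
    using LIMSEQ_unique LIMSEQ_Suc[OF has_prod_imp_tendsto[OF qprod_has_prod[OF assms, of u]]] by blast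
qed

text \<open>The partial products are polynomials in \<open>u\<close>; the Weierstrass test on each
  disc, with bound \<open>norm q ^ n * R\<close>, makes the convergence locally uniform, and
  holomorphy passes to the limit.\<close>

lemma qprod_holomorphic:
  assumes "norm q < 1"
  shows "qprod q holomorphic_on UNIV"
proof -
  let ?P = "\<lambda>N u. \<Prod>n<N. 1 + - (q ^ n * u)"
  have unif: "uniform_limit (cball 0 R) ?P (qprod q) sequentially" for R
  proof -
    have "uniformly_convergent_on (cball 0 R) ?P"
    proof (rule uniformly_convergent_on_prod)
      show "uniformly_convergent_on (cball 0 R) (\<lambda>N u. \<Sum>n<N. norm (- (q ^ n * u)))"
      proof (rule Weierstrass_m_test'[where M = "\<lambda>n. norm q ^ n * R"])
        show "summable (\<lambda>n. norm q ^ n * R)"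
          using assms by (intro summable_mult2 summable_geometric) auto
      qed (auto simp: norm_mult norm_power intro!: mult_left_mono)
    qed (auto intro!: continuous_intros)
    then obtain l where l: "uniform_limit (cball 0 R) ?P l sequentially"
      by (auto simp: uniformly_convergent_on_def)
    have "l u = qprod q u" if "u \<in> cball 0 R" for u
    proof (rule LIMSEQ_unique)
      show "(\<lambda>N. ?P N u) \<longlonglongrightarrow> l u" using tendsto_uniform_limitI[OF l that] .
      show "(\<lambda>N. ?P N u) \<longlonglongrightarrow> qprod q u"
        using has_prod_imp_tendsto'[OF qprod_has_prod[OF assms, of u]] by simp
    qed
    thus ?thesis using l by (metis (mono_tags, lifting) uniform_limit_cong')
  qed
  have "qprod q holomorphic_on ball 0 R" for R
  proof (rule holomorphic_uniform_limit[where F = sequentially and f = ?P and g = "qprod q", THEN conjunct2])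
    show "\<forall>\<^sub>F N in sequentially. continuous_on (cball 0 R) (?P N) \<and> ?P N holomorphic_on ball 0 R"
      by (auto intro!: always_eventually continuous_intros holomorphic_intros)
  qed (use unif in auto)
  hence "qprod q holomorphic_on (\<Union>R. ball 0 R)"
    by (intro holomorphic_on_UN_open) auto
  also have "(\<Union>R. ball 0 R) = (UNIV :: complex set)"
    by (auto intro: gt_ex)
  finally show ?thesis .
qed

text \<open>Jacobi's triple product without its constant factor, with
  \<open>exp (2 * pi * \<i> * \<tau>)\<close> as the base of both products.\<close>

definition theta_prod :: "complex \<Rightarrow> complex \<Rightarrow> complex" where
  "theta_prod \<tau> z = qprod (exp (2 * pi * \<i> * \<tau>)) (exp (2 * pi * \<i> * z)) *
     qprod (exp (2 * pi * \<i> * \<tau>)) (exp (2 * pi * \<i> * \<tau>) / exp (2 * pi * \<i> * z))"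

lemma norm_nome: "Im \<tau> > 0 \<Longrightarrow> norm (exp (2 * pi * \<i> * \<tau>)) < 1"
  by (simp add: mult_pos_pos)

lemma theta_prod_holomorphic:
  assumes "Im \<tau> > 0"
  shows "theta_prod \<tau> holomorphic_on UNIV"
proof -
  note h = holomorphic_on_compose_gen[OF _ qprod_holomorphic[OF norm_nome[OF assms]], unfolded o_def]
  show ?thesis unfolding theta_prod_def
    by (intro holomorphic_on_mult h) (auto intro!: holomorphic_intros)
qed

lemma theta_prod_plus_one: "theta_prod \<tau> (z + 1) = theta_prod \<tau> z"
  unfolding theta_prod_def by (simp add: ring_distribs exp_add)

text \<open>The shift replaces \<open>u\<close> by \<open>q * u\<close>: the first product loses the
  factor \<open>1 - u\<close>, the second gains \<open>1 - 1 / u\<close>, and the quotient of these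
  two is \<open>- (1 / u)\<close>.\<close>

lemma theta_prod_plus_tau:
  assumes "Im \<tau> > 0"
  shows "theta_prod \<tau> (z + \<tau>) = - exp (- 2 * pi * \<i> * z) * theta_prod \<tau> z"
proof -
  define q where "q = exp (2 * pi * \<i> * \<tau>)"
  define u where "u = exp (2 * pi * \<i> * z)"
  have nz: "u \<noteq> 0" "q \<noteq> 0" by (auto simp: u_def q_def)
  have q: "norm q < 1" unfolding q_def by (rule norm_nome[OF assms])
  have "theta_prod \<tau> (z + \<tau>) = qprod q (q * u) * qprod q (1 / u)"
    using nz by (simp add: theta_prod_def ring_distribs exp_add u_def q_def mult.commute)
  also have "\<dots> = qprod q (q * u) * ((1 - 1 / u) * qprod q (q * (1 / u)))"
    by (subst qprod_rec[OF q, of "1 / u"]) simp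
  also have "\<dots> = - (1 / u) * (((1 - u) * qprod q (q * u)) * qprod q (q / u))"
    using nz by (simp add: field_simps)
  also have "(1 - u) * qprod q (q * u) = qprod q u"
    by (rule qprod_rec[OF q, symmetric])
  also have "1 / u = exp (- 2 * pi * \<i> * z)" unfolding u_def by (simp add: exp_minus field_simps)
  finally show ?thesis by (simp add: theta_prod_def u_def q_def)
qed

text \<open>The first product vanishes iff \<open>q ^ n * u = 1\<close>, the second iff
  \<open>q ^ Suc n = u\<close>, for some natural \<open>n\<close>. Together these exponents run
  through all integers and become the coefficients of \<tau>.\<close>

lemma theta_prod_eq_0_iff:
  assumes "Im \<tau> > 0"
  shows "theta_prod \<tau> z = 0 \<longleftrightarrow> (\<exists>m n. z = of_int m + of_int n * \<tau>)"
proof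
  define q where "q = exp (2 * pi * \<i> * \<tau>)"
  define u where "u = exp (2 * pi * \<i> * z)"
  have nz: "u \<noteq> 0" "q \<noteq> 0" by (auto simp: u_def q_def)
  have q: "norm q < 1" unfolding q_def by (rule norm_nome[OF assms])
  have exp1: "\<exists>m n. z = of_int m + of_int n * \<tau>"
    if e: "exp (2 * pi * \<i> * (z + of_int k * \<tau>)) = 1" for k
  proof -
    obtain j :: int where "Im (2 * pi * \<i> * (z + of_int k * \<tau>)) = of_int (2 * j) * pi"
       and re: "Re (2 * pi * \<i> * (z + of_int k * \<tau>)) = 0"
      using e unfolding exp_eq_1 by auto
    hence "2 * pi * \<i> * (z + of_int k * \<tau>) = 2 * pi * \<i> * of_int j"
      by (auto simp: complex_eq_iff)
    hence "z + of_int k * \<tau> = of_int j" by simp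
    hence "z = of_int j + of_int (- k) * \<tau>" by (simp add: algebra_simps)
    thus ?thesis by blast
  qed
  have ex: "exp (2 * pi * \<i> * (of_nat n * \<tau>)) = q ^ n" for n
    unfolding q_def by (simp add: exp_of_nat_mult[symmetric] mult_ac)
  {
    assume "theta_prod \<tau> z = 0"
    hence "qprod q u = 0 \<or> qprod q (q / u) = 0" by (auto simp: theta_prod_def u_def q_def)
    then obtain n where "q ^ n * u = 1 \<or> q ^ n * (q / u) = 1" using qprod_eq_0_iff[OF q] by blast
    hence "exp (2 * pi * \<i> * (z + of_int (int n) * \<tau>)) = 1 \<or>
        exp (2 * pi * \<i> * (z + of_int (- int (Suc n)) * \<tau>)) = 1"
    proof
      assume "q ^ n * u = 1"
      hence "exp (2 * pi * \<i> * (z + of_int (int n) * \<tau>)) = 1"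
        by (simp only: ring_distribs exp_add of_int_of_nat_eq ex) (simp add: u_def mult.commute)
      thus ?thesis ..
    next
      assume "q ^ n * (q / u) = 1"
      hence e: "q ^ Suc n = u" using nz by (simp add: field_simps)
      have "exp (2 * pi * \<i> * (z + of_int (- int (Suc n)) * \<tau>)) =
             u / exp (2 * pi * \<i> * (of_nat (Suc n) * \<tau>))"
        unfolding u_def exp_diff[symmetric] by (rule arg_cong[of _ _ exp]) (simp add: algebra_simps)
      also have "\<dots> = 1" unfolding ex e using nz by simp
      finally show ?thesis ..
    qed
    thus "\<exists>m n. z = of_int m + of_int n * \<tau>" using exp1 by blast
  }
  {
    assume "\<exists>m n. z = of_int m + of_int n * \<tau>"
    then obtain m n where z: "z = of_int m + of_int n * \<tau>" by blast
    have m: "exp (2 * pi * \<i> * of_int m) = 1"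
      by (subst exp_eq_1) (auto intro!: exI[of _ m])
    show "theta_prod \<tau> z = 0"
    \<comment> \<open>Non-positive multiples of \<tau> are zeros of the first product, positive ones
      of the second; its factors start at \<open>q / u\<close>, hence the exponent
      \<open>nat (n - 1)\<close>.\<close>
    proof (cases "n \<le> 0")
      case True
      hence "of_int n = - (of_nat (nat (- n)) :: complex)" by simp
      hence "u = 1 / q ^ nat (- n)"
        unfolding u_def z ring_distribs exp_add m ex[symmetric]
        by (simp add: exp_minus field_simps)
      hence "q ^ nat (- n) * u = 1" using nz by simp
      hence "qprod q u = 0" using qprod_eq_0_iff[OF q] by blast
      thus ?thesis by (simp add: theta_prod_def u_def q_def)
    next
      case False
      hence "of_int n = (of_nat (Suc (nat (n - 1))) :: complex)" by simp
      hence "u = q ^ Suc (nat (n - 1))"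
        unfolding u_def z ring_distribs exp_add m ex[symmetric] by simp
      hence "q ^ nat (n - 1) * (q / u) = 1" using nz by (simp add: field_simps)
      hence "qprod q (q / u) = 0" using qprod_eq_0_iff[OF q] by blast
      thus ?thesis by (simp add: theta_prod_def u_def q_def)
    qed
  }
qed

text \<open>Once the factor \<open>1 - u\<close> is split off, the rest is nonzero at 0, since
  \<open>q ^ Suc n = 1\<close> contradicts \<open>norm q < 1\<close>. The derivative at 0 is
  therefore a nonzero multiple of 2 pi i.\<close>

lemma theta_prod_simple_zero:
  assumes "Im \<tau> > 0"
  obtains g where "g holomorphic_on UNIV" "g 0 \<noteq> 0" "\<And>z. theta_prod \<tau> z = z * g z"
proof -
  define u where "u z = exp (2 * pi * \<i> * z)" for z :: complex
  define q where "q = exp (2 * pi * \<i> * \<tau>)"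
  have nz: "u z \<noteq> 0" "q \<noteq> 0" for z by (auto simp: u_def q_def)
  have q: "norm q < 1" unfolding q_def by (rule norm_nome[OF assms])
  have "qprod q q \<noteq> 0"
  proof
    assume "qprod q q = 0"
    then obtain n where "q ^ Suc n = 1" using qprod_eq_0_iff[OF q, of q] by (auto simp: mult.commute)
    hence "norm q ^ Suc n = 1" by (metis norm_one norm_power)
    thus False using q nz(2) power_Suc_less_one[of "norm q" n] by simp
  qed
  note h = holomorphic_on_compose_gen[OF _ qprod_holomorphic[OF q], unfolded o_def]
  define f where "f z = (1 - u z) * (qprod q (q * u z) * qprod q (q / u z))" for z
  have eq: "theta_prod \<tau> z = f z" for z
    using qprod_rec[OF q, of "u z"] by (simp add: theta_prod_def q_def f_def u_def)
  have "f holomorphic_on UNIV" using theta_prod_holomorphic[OF assms] eq by (simp cong: holomorphic_cong)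
  hence fd: "(f has_field_derivative deriv f 0) (at 0)"
    using holomorphic_derivI by blast
  \<comment> \<open>The removable singularity of the quotient is filled with the derivative.\<close>
  define g where "g z = (if z = 0 then deriv f 0 else f z / z)" for z
  have f0: "f 0 = 0" by (simp add: f_def u_def)
  have "g holomorphic_on UNIV"
  proof -
    have "(\<lambda>z. if z = 0 then deriv f 0 else (f z - f 0) / (z - 0)) holomorphic_on UNIV"
      by (rule pole_lemma_open) (use \<open>f holomorphic_on UNIV\<close> in auto)
    moreover have "(\<lambda>z. if z = 0 then deriv f 0 else (f z - f 0) / (z - 0)) = g"
      by (rule ext) (simp add: g_def f0)
    ultimately show ?thesis by simp
  qed
  moreover have "g 0 \<noteq> 0"
  proof -
    define k where "k z = qprod q (q * u z) * qprod q (q / u z)" for z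
    have "k holomorphic_on UNIV" unfolding k_def
      by (intro holomorphic_on_mult h) (auto intro!: holomorphic_intros simp: u_def)
    hence "(k has_field_derivative deriv k 0) (at 0)" using holomorphic_derivI by blast
    hence "((\<lambda>z. (1 - u z) * k z) has_field_derivative - (2 * pi * \<i>) * k 0) (at 0)"
      unfolding u_def by (auto intro!: derivative_eq_intros)
    hence "deriv f 0 = - (2 * pi * \<i>) * k 0"
      using DERIV_imp_deriv by (auto simp: f_def[abs_def] k_def)
    thus ?thesis using \<open>qprod q q \<noteq> 0\<close> by (simp add: g_def k_def u_def)
  qed
  moreover have "theta_prod \<tau> z = z * g z" for z using f0 by (simp add: eq g_def)
  ultimately show thesis using that by blast
qed

section \<open>Lines and holomorphic frames on a quotient\<close>

lemma line_basis_mem: "line_basis V e \<Longrightarrow> e \<in> vecs V"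
  by (simp add: line_basis_def)

lemma line_basis_scl_mem: "line_basis V e \<Longrightarrow> scl V c e \<in> vecs V"
  unfolding line_basis_def using bij_betwE by blast

lemma line_basis_inj: "line_basis V e \<Longrightarrow> scl V c e = scl V d e \<longleftrightarrow> c = d"
  unfolding line_basis_def bij_betw_def by (auto dest: injD)

lemma line_basis_obtain:
  assumes "line_basis V e" "v \<in> vecs V"
  obtains c where "v = scl V c e"
  using assms unfolding line_basis_def bij_betw_def by blast

lemma is_line_scl_scl:
  "is_line V \<Longrightarrow> v \<in> vecs V \<Longrightarrow> scl V c (scl V d v) = scl V (c * d) v"
  unfolding is_line_def by blast

lemma is_line_scl_mem:
  assumes "is_line V" "v \<in> vecs V"
  shows "scl V c v \<in> vecs V"
proof -
  obtain e where e: "line_basis V e" using assms(1) by (auto simp: is_line_def)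
  obtain d where "v = scl V d e" using line_basis_obtain[OF e assms(2)] .
  thus ?thesis
    using is_line_scl_scl[OF assms(1) line_basis_mem[OF e]] line_basis_scl_mem[OF e] by simp
qed

text \<open>The unit law is not among the conditions of \<open>is_line\<close>. It follows by
  writing \<open>e = scl V c e\<close> and computing
  \<open>scl V 1 (scl V c e) = scl V c e\<close>.\<close>

lemma line_basis_scl_one:
  assumes "is_line V" "line_basis V e"
  shows "scl V 1 e = e"
proof -
  obtain c where c: "e = scl V c e"
    using line_basis_obtain[OF assms(2) line_basis_mem[OF assms(2)]] .
  have s: "scl V a (scl V b e) = scl V (a * b) e" for a b
    using is_line_scl_scl[OF assms(1) line_basis_mem[OF assms(2)]] .
  have "scl V 1 e = scl V c e" using s[of 1 c] c by simp
  thus ?thesis using c by simp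
qed

lemma is_line_scl_one:
  assumes "is_line V" "v \<in> vecs V"
  shows "scl V 1 v = v"
proof -
  obtain e where e: "line_basis V e" using assms(1) by (auto simp: is_line_def)
  obtain d where "v = scl V d e" using line_basis_obtain[OF e assms(2)] .
  thus ?thesis using is_line_scl_scl[OF assms(1) line_basis_mem[OF e]] by simp
qed

lemma line_basis_scl_iff:
  assumes "is_line V" "line_basis V e"
  shows "line_basis V (scl V c e) \<longleftrightarrow> c \<noteq> 0"
proof
  note s = is_line_scl_scl[OF assms(1) line_basis_mem[OF assms(2)]]
  {
    assume "line_basis V (scl V c e)"
    hence "scl V 0 (scl V c e) \<noteq> scl V 1 (scl V c e)" using line_basis_inj by fastforce
    thus "c \<noteq> 0" by (auto simp: s)
  }
  {
    assume "c \<noteq> 0"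
    have "bij_betw (\<lambda>a. scl V a (scl V c e)) UNIV (vecs V)"
      unfolding s
    proof (rule bij_betw_trans[of "\<lambda>a. a * c" UNIV UNIV "\<lambda>a. scl V a e", unfolded o_def])
      show "bij_betw (\<lambda>a. a * c) UNIV UNIV"
        using \<open>c \<noteq> 0\<close> by (intro bij_betw_byWitness[of _ "\<lambda>a. a / c"]) auto
    qed (use assms(2) in \<open>auto simp: line_basis_def\<close>)
    thus "line_basis V (scl V c e)"
      using line_basis_scl_mem[OF assms(2)] by (simp add: line_basis_def)
  }
qed

lemma dual_vec_scl: "line_basis V e \<Longrightarrow> dual_vec V e (scl V c e) = c"
  unfolding dual_vec_def using line_basis_inj line_basis_scl_mem by (metis (mono_tags, lifting) the_equality)

lemma scl_dual_vec: "line_basis V e \<Longrightarrow> v \<in> vecs V \<Longrightarrow> scl V (dual_vec V e v) e = v"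
  by (metis line_basis_obtain dual_vec_scl)

lemma dual_vec_linear:
  assumes "is_line V" "line_basis V e" "v \<in> vecs V"
  shows "dual_vec V e (scl V c v) = c * dual_vec V e v"
  by (metis assms dual_vec_scl is_line_scl_scl line_basis_mem line_basis_obtain)

lemma is_line_c_line: "is_line c_line" and line_basis_c_line: "line_basis c_line 1"
proof -
  have b: "line_basis c_line 1"
    by (auto simp: line_basis_def c_line_def bij_betw_def)
  thus "line_basis c_line 1" .
  show "is_line c_line" using b by (auto simp: is_line_def c_line_def)
qed

lemma dual_line_basis:
  assumes "is_line V" "line_basis V e"
  shows "is_line (dual_line V)" and "line_basis (dual_line V) (dual_vec V e)"
proof -
  let ?f = "dual_vec V e"
  have f: "?f \<in> vecs (dual_line V)"
    using dual_vec_linear[OF assms] by (auto simp: dual_line_def dual_vec_def)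
  have fe: "?f e = 1"
    using dual_vec_scl[OF assms(2), of 1] line_basis_scl_one[OF assms] by simp
  have "bij_betw (\<lambda>c. scl (dual_line V) c ?f) UNIV (vecs (dual_line V))"
  proof (rule bij_betw_imageI)
    show "inj (\<lambda>c. scl (dual_line V) c ?f)"
    proof (rule injI)
      fix c d assume "scl (dual_line V) c ?f = scl (dual_line V) d ?f"
      hence "c * ?f e = d * ?f e" by (auto simp: dual_line_def dest: fun_cong)
      thus "c = d" by (simp add: fe)
    qed
    show "range (\<lambda>c. scl (dual_line V) c ?f) = vecs (dual_line V)"
    proof (intro equalityI subsetI)
      fix g
      {
        assume "g \<in> range (\<lambda>c. scl (dual_line V) c ?f)"
        thus "g \<in> vecs (dual_line V)"
          using f by (auto simp: dual_line_def algebra_simps)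
      }
      {
        assume g: "g \<in> vecs (dual_line V)"
        have "g v = scl (dual_line V) (g e) ?f v" for v
        proof (cases "v \<in> vecs V")
          case True
          hence "g v = g (scl V (?f v) e)" by (simp add: scl_dual_vec[OF assms(2)])
          also have "\<dots> = ?f v * g e" using g line_basis_mem[OF assms(2)] by (auto simp: dual_line_def)
          finally show ?thesis by (simp add: dual_line_def)
        next
          case False
          thus ?thesis using g f by (auto simp: dual_line_def)
        qed
        hence "g = scl (dual_line V) (g e) ?f" by (rule ext)
        thus "g \<in> range (\<lambda>c. scl (dual_line V) c ?f)" by blast
      }
    qed
  qed
  thus b: "line_basis (dual_line V) ?f" using f by (simp add: line_basis_def)
  show "is_line (dual_line V)"
    unfolding is_line_def using b by (auto simp: dual_line_def mult.assoc)
qed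

lemma dual_vec_scl_basis:
  assumes "is_line V" "line_basis V e" "c \<noteq> 0"
  shows "dual_vec V (scl V c e) = scl (dual_line V) (1 / c) (dual_vec V e)"
proof
  fix v
  have b: "line_basis V (scl V c e)" using line_basis_scl_iff[OF assms(1,2)] assms(3) by simp
  show "dual_vec V (scl V c e) v = scl (dual_line V) (1 / c) (dual_vec V e) v"
  proof (cases "v \<in> vecs V")
    case True
    obtain d where d: "v = scl V d e" using line_basis_obtain[OF assms(2) True] .
    have "v = scl V (d / c) (scl V c e)"
      using assms(3) by (simp add: is_line_scl_scl[OF assms(1) line_basis_mem[OF assms(2)]] d)
    hence "dual_vec V (scl V c e) v = d / c" using dual_vec_scl[OF b] by simp
    thus ?thesis by (simp add: d dual_vec_scl[OF assms(2)] dual_line_def)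
  qed (simp add: dual_vec_def dual_line_def)
qed

lemma tens_scl_left:
  "is_line V \<Longrightarrow> v \<in> vecs V \<Longrightarrow> w \<in> vecs W \<Longrightarrow>
     tens V W (scl V c v) w = scl (tensor_line V W) c (tens V W v w)"
  by (auto simp: tens_def tensor_line_def bilin_def)

lemma tens_scl_right:
  "is_line W \<Longrightarrow> v \<in> vecs V \<Longrightarrow> w \<in> vecs W \<Longrightarrow>
     tens V W v (scl W c w) = scl (tensor_line V W) c (tens V W v w)"
  by (auto simp: tens_def tensor_line_def bilin_def)

lemma tens_scl_scl:
  assumes "is_line V" "is_line W" "v \<in> vecs V" "w \<in> vecs W"
  shows "tens V W (scl V c v) (scl W d w) = scl (tensor_line V W) (c * d) (tens V W v w)"
  using assms is_line_scl_mem[OF assms(1,3), of c] is_line_scl_mem[OF assms(2,4), of d]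
  by (simp add: tens_scl_left tens_scl_right) (simp add: tensor_line_def mult_ac)

lemma tensor_line_basis:
  assumes V: "is_line V" "line_basis V e" and W: "is_line W" "line_basis W f"
  shows "is_line (tensor_line V W)" and "line_basis (tensor_line V W) (tens V W e f)"
proof -
  note e = line_basis_mem[OF V(2)] and f = line_basis_mem[OF W(2)]
  have mem: "scl (tensor_line V W) c (tens V W e f) \<in> vecs (tensor_line V W)" for c
  proof -
    have "tens V W (scl V c e) f \<in> vecs (tensor_line V W)"
      using f is_line_scl_mem[OF V(1) e, of c] by (auto simp: tensor_line_def)
    thus ?thesis by (simp only: tens_scl_left[OF V(1) e f])
  qed
  have b: "line_basis (tensor_line V W) (tens V W e f)"
    unfolding line_basis_def
  proof (intro conjI bij_betw_imageI)
    show "tens V W e f \<in> vecs (tensor_line V W)" using e f by (auto simp: tensor_line_def)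
    \<comment> \<open>The product of the two coordinate functionals: evaluation at it recovers the
      coefficient of a tensor with respect to \<open>tens V W e f\<close>.\<close>
    define \<beta> where "\<beta> v w = dual_vec V e v * dual_vec W f w" for v w
    have \<beta>: "\<beta> \<in> bilin V W"
      by (auto simp: bilin_def \<beta>_def dual_vec_linear[OF V] dual_vec_linear[OF W])
    have "tens V W e f \<beta> = 1"
      using \<beta> dual_vec_scl[OF V(2), of 1] dual_vec_scl[OF W(2), of 1]
      by (simp add: tens_def \<beta>_def line_basis_scl_one[OF V] line_basis_scl_one[OF W])
    thus "inj (\<lambda>c. scl (tensor_line V W) c (tens V W e f))"
      by (intro injI) (auto simp: tensor_line_def dest!: fun_cong[where x = \<beta>])
    show "range (\<lambda>c. scl (tensor_line V W) c (tens V W e f)) = vecs (tensor_line V W)"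
    proof (intro equalityI subsetI)
      fix T
      {
        assume "T \<in> range (\<lambda>c. scl (tensor_line V W) c (tens V W e f))"
        thus "T \<in> vecs (tensor_line V W)" using mem by blast
      }
      {
        assume "T \<in> vecs (tensor_line V W)"
        then obtain v w where vw: "v \<in> vecs V" "w \<in> vecs W" "T = tens V W v w"
          by (auto simp: tensor_line_def)
        obtain c d where "v = scl V c e" "w = scl W d f"
          using line_basis_obtain[OF V(2) vw(1)] line_basis_obtain[OF W(2) vw(2)] by metis
        hence "T = scl (tensor_line V W) (c * d) (tens V W e f)"
          using vw(3) tens_scl_scl[OF V(1) W(1) e f] by simp
        thus "T \<in> range (\<lambda>c. scl (tensor_line V W) c (tens V W e f))" by blast
      }
    qed
  qed
  thus "line_basis (tensor_line V W) (tens V W e f)" .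
  show "is_line (tensor_line V W)"
    unfolding is_line_def using b by (auto simp: tensor_line_def mult.assoc)
qed

definition basis_map :: "'a cline \<Rightarrow> 'a \<Rightarrow> 'b cline \<Rightarrow> 'b \<Rightarrow> 'a \<Rightarrow> 'b" where
  "basis_map V e W f = (\<lambda>v\<in>vecs V. scl W (dual_vec V e v) f)"

lemma basis_map_scl:
  "line_basis V e \<Longrightarrow> basis_map V e W f (scl V c e) = scl W c f"
  by (simp add: basis_map_def line_basis_scl_mem dual_vec_scl)

lemma basis_map_iso:
  assumes V: "is_line V" "line_basis V e" and W: "is_line W" "line_basis W f"
  shows "basis_map V e W f \<in> line_isos V W"
proof -
  have "basis_map V e W f \<in> vecs V \<rightarrow>\<^sub>E vecs W"
    by (auto simp: basis_map_def line_basis_scl_mem[OF W(2)])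
  moreover have "bij_betw (basis_map V e W f) (vecs V) (vecs W)"
  proof (rule bij_betw_byWitness[where f' = "basis_map W f V e"])
    show "\<forall>v\<in>vecs V. basis_map W f V e (basis_map V e W f v) = v"
      using line_basis_obtain[OF V(2)] basis_map_scl[OF V(2)] basis_map_scl[OF W(2)] by metis
    show "\<forall>w\<in>vecs W. basis_map V e W f (basis_map W f V e w) = w"
      using line_basis_obtain[OF W(2)] basis_map_scl[OF V(2)] basis_map_scl[OF W(2)] by metis
  qed (auto simp: basis_map_def line_basis_scl_mem[OF W(2)] line_basis_scl_mem[OF V(2)])
  moreover have "basis_map V e W f (scl V c v) = scl W c (basis_map V e W f v)"
    if "v \<in> vecs V" for c v
    using that by (simp add: basis_map_def is_line_scl_mem[OF V(1)] dual_vec_linear[OF V]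
        is_line_scl_scl[OF W(1) line_basis_mem[OF W(2)]])
  ultimately show ?thesis by (simp add: line_isos_def)
qed

lemma line_isos_basis:
  assumes "is_line V" "is_line W" "k \<in> line_isos V W" "line_basis V e"
  shows "line_basis W (k e)"
proof -
  have k: "bij_betw k (vecs V) (vecs W)" "\<And>c. k (scl V c e) = scl W c (k e)"
    using assms(3) line_basis_mem[OF assms(4)] by (auto simp: line_isos_def)
  have "bij_betw (k \<circ> (\<lambda>c. scl V c e)) UNIV (vecs W)"
    by (rule bij_betw_trans[OF _ k(1)]) (use assms(4) in \<open>auto simp: line_basis_def\<close>)
  hence "bij_betw (\<lambda>c. scl W c (k e)) UNIV (vecs W)" by (simp add: o_def k(2))
  thus ?thesis using bij_betwE[OF k(1)] line_basis_mem[OF assms(4)] by (simp add: line_basis_def)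
qed

lemma line_isos_eqI:
  assumes "k \<in> line_isos V W" "k' \<in> line_isos V W" "line_basis V e" "k e = k' e"
  shows "k = k'"
proof (rule ext)
  fix v show "k v = k' v"
  proof (cases "v \<in> vecs V")
    case True
    then obtain c where "v = scl V c e" using line_basis_obtain[OF assms(3)] by blast
    thus ?thesis using assms line_basis_mem[OF assms(3)] by (simp add: line_isos_def)
  next
    case False
    thus ?thesis using assms(1,2) by (auto simp: line_isos_def PiE_def extensional_def)
  qed
qed

section \<open>Complex differentiability on a cover; frames and multipliers\<close>

text \<open>
  \<open>K\<close> will be the set of complex linear functionals, so that \<open>chol\<close> is complex
  differentiability at a point in one, two or three variables alike.
\<close>

definition chol :: "('c::real_normed_vector \<Rightarrow> complex) set \<Rightarrow> 'c \<Rightarrow> ('c \<Rightarrow> complex) \<Rightarrow> bool" where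
  "chol K z h \<longleftrightarrow> (\<exists>T\<in>K. (h has_derivative T) (at z))"

lemma chol_cong:
  assumes "open W" "z \<in> W" "\<And>w. w \<in> W \<Longrightarrow> f w = g w" "chol K z f"
  shows "chol K z g"
  using assms has_derivative_transform_within_open unfolding chol_def by blast

lemma chol_comp:
  assumes "chol K' (F z) h" "(F has_derivative F') (at z)" "\<And>T. T \<in> K' \<Longrightarrow> T \<circ> F' \<in> K"
  shows "chol K z (h \<circ> F)"
  using assms diff_chain_at unfolding chol_def by blast

text \<open>
  A holomorphic frame of the pullback of \<open>L\<close> along a covering \<open>q\<close>, with its multipliers
  under change of the lift.
\<close>

definition lframe ::
  "('c::real_normed_vector \<Rightarrow> 'p) \<Rightarrow> ('c \<Rightarrow> complex) set \<Rightarrow> ('p, 'a) lbundle \<Rightarrow> ('c \<Rightarrow> 'a) \<Rightarrow> bool" where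
  "lframe q K L s \<longleftrightarrow>
     (\<forall>z. is_line (fib L (q z)) \<and> line_basis (fib L (q z)) (s z)) \<and>
     (\<Union>(U, e) \<in> frames L. U) = range q \<and>
     (\<forall>(U, e) \<in> frames L. open (q -` U) \<and>
        (\<exists>g. \<forall>z \<in> q -` U. chol K z g \<and> g z \<noteq> 0 \<and> e (q z) = scl (fib L (q z)) (g z) (s z)))"

text \<open>The form in which compactness of the quotient is used: functions that descend along
  \<open>q\<close> are constant. Keeping it as a predicate separates the bundle calculus from the
  lattice.\<close>

definition liouville :: "('c::real_normed_vector \<Rightarrow> 'p) \<Rightarrow> ('c \<Rightarrow> complex) set \<Rightarrow> bool" where
  "liouville q K \<longleftrightarrow> (\<forall>t. (\<forall>z. chol K z t) \<longrightarrow>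
     (\<forall>z z'. q z = q z' \<longrightarrow> t z = t z') \<longrightarrow> (\<forall>z z'. t z = t z'))"

text \<open>The multiplier depends on two lifts instead of a deck transformation, so that
  \<open>q\<close> may be any map; its values matter only where \<open>q z = q z'\<close>.\<close>

definition mults :: "('c \<Rightarrow> 'p) \<Rightarrow> ('p, 'a) lbundle \<Rightarrow> ('c \<Rightarrow> 'a) \<Rightarrow> ('c \<Rightarrow> 'c \<Rightarrow> complex) \<Rightarrow> bool" where
  "mults q L s \<mu> \<longleftrightarrow> (\<forall>z z'. q z = q z' \<longrightarrow> s z' = scl (fib L (q z)) (\<mu> z z') (s z))"

lemma lframe_line: "lframe q K L s \<Longrightarrow> is_line (fib L (q z))"
  and lframe_basis: "lframe q K L s \<Longrightarrow> line_basis (fib L (q z)) (s z)"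
  by (auto simp: lframe_def)

lemma lframe_cover:
  assumes "lframe q K L s"
  obtains U e where "(U, e) \<in> frames L" "q z \<in> U"
proof -
  have "q z \<in> (\<Union>(U, e) \<in> frames L. U)" using assms by (auto simp: lframe_def)
  thus ?thesis using that by blast
qed

lemma lframe_open: "lframe q K L s \<Longrightarrow> (U, e) \<in> frames L \<Longrightarrow> open (q -` U)"
  and lframe_sub: "lframe q K L s \<Longrightarrow> (U, e) \<in> frames L \<Longrightarrow> U \<subseteq> range q"
  by (fastforce simp: lframe_def)+

lemma lframe_coeff:
  assumes "lframe q K L s" "(U, e) \<in> frames L"
  obtains g where "\<And>z. q z \<in> U \<Longrightarrow> chol K z g" "\<And>z. q z \<in> U \<Longrightarrow> g z \<noteq> 0"
    "\<And>z. q z \<in> U \<Longrightarrow> e (q z) = scl (fib L (q z)) (g z) (s z)"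
  using assms unfolding lframe_def by fastforce

lemma multsD: "mults q L s \<mu> \<Longrightarrow> q z = q z' \<Longrightarrow> s z' = scl (fib L (q z)) (\<mu> z z') (s z)"
  unfolding mults_def by blast

lemma mults_nz:
  assumes "lframe q K L s" "mults q L s \<mu>" "q z = q z'"
  shows "\<mu> z z' \<noteq> 0"
proof -
  have "line_basis (fib L (q z)) (scl (fib L (q z)) (\<mu> z z') (s z))"
    using lframe_basis[OF assms(1), of z'] by (simp only: multsD[OF assms(2,3)] assms(3))
  thus ?thesis
    using line_basis_scl_iff[OF lframe_line[OF assms(1)] lframe_basis[OF assms(1)]] by blast
qed

lemma lframe_triv:
  fixes q :: "'c::real_normed_vector \<Rightarrow> 'p"
  assumes "(\<lambda>_. 0) \<in> K" and X: "pts X = range q"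
  shows "lframe q K (triv_bundle X) (\<lambda>z. 1)" and "mults q (triv_bundle X) (\<lambda>z. 1) (\<lambda>z z'. 1)"
proof -
  have "chol K z (\<lambda>_. 1)" for z :: 'c
    unfolding chol_def using assms(1) has_derivative_const by blast
  moreover have "q -` range q = UNIV" by auto
  ultimately show "lframe q K (triv_bundle X) (\<lambda>z. 1)"
    using is_line_scl_one[OF is_line_c_line, of 1]
    by (auto simp: lframe_def triv_bundle_def is_line_c_line line_basis_c_line X
        line_basis_mem[OF line_basis_c_line] intro!: exI[of _ "\<lambda>_. 1"])
  show "mults q (triv_bundle X) (\<lambda>z. 1) (\<lambda>z z'. 1)"
    by (simp add: mults_def triv_bundle_def c_line_def)
qed

text \<open>\<open>F\<close> lifts \<open>f\<close> to the covers. The lifts that occur are affine,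
  so one derivative \<open>F'\<close> serves at every point and the chain rule only asks that
  composition with \<open>F'\<close> sends \<open>K'\<close> into \<open>K\<close>.\<close>

lemma lframe_pull:
  assumes s: "lframe q' K' L s" and X: "pts X = range q"
    and f: "\<And>z. f (q z) = q' (F z)"
    and F: "\<And>z. (F has_derivative F') (at z)"
    and K: "\<And>T. T \<in> K' \<Longrightarrow> T \<circ> F' \<in> K"
  shows "lframe q K (pull X f L) (s \<circ> F)"
  unfolding lframe_def
proof (intro conjI allI ballI)
  show "is_line (fib (pull X f L) (q z))" for z
    using lframe_line[OF s] by (simp add: pull_def f)
  show "line_basis (fib (pull X f L) (q z)) ((s \<circ> F) z)" for z
    using lframe_basis[OF s] by (simp add: pull_def f)
  show "(\<Union>(U, e) \<in> frames (pull X f L). U) = range q"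
  proof (intro equalityI subsetI)
    fix p assume "p \<in> range q"
    then obtain z where p: "p = q z" by blast
    obtain U e where U: "(U, e) \<in> frames L" "q' (F z) \<in> U" using lframe_cover[OF s] .
    hence "(f -` U \<inter> pts X, e \<circ> f) \<in> frames (pull X f L)" by (auto simp: pull_def)
    moreover have "p \<in> f -` U \<inter> pts X" using U X by (simp add: p f)
    ultimately show "p \<in> (\<Union>(U, e) \<in> frames (pull X f L). U)" by blast
  qed (auto simp: pull_def X)
next
  fix Ue assume "Ue \<in> frames (pull X f L)"
  then obtain U e where U: "(U, e) \<in> frames L" and Ue: "Ue = (f -` U \<inter> pts X, e \<circ> f)"
    by (auto simp: pull_def)
  have pre: "q -` (f -` U \<inter> pts X) = F -` (q' -` U)" by (auto simp: X simp flip: f)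
  have "continuous_on UNIV F"
    using F by (auto intro!: continuous_at_imp_continuous_on has_derivative_continuous)
  hence op: "open (q -` (f -` U \<inter> pts X))"
    unfolding pre using lframe_open[OF s U] by (intro continuous_open_vimage) (auto simp: continuous_on_eq_continuous_at)
  obtain g where g: "\<And>z. q' z \<in> U \<Longrightarrow> chol K' z g" "\<And>z. q' z \<in> U \<Longrightarrow> g z \<noteq> 0"
    "\<And>z. q' z \<in> U \<Longrightarrow> e (q' z) = scl (fib L (q' z)) (g z) (s z)"
    using lframe_coeff[OF s U] by blast
  have "\<forall>z \<in> q -` (f -` U \<inter> pts X). chol K z (g \<circ> F) \<and> (g \<circ> F) z \<noteq> 0 \<and>
      (e \<circ> f) (q z) = scl (fib (pull X f L) (q z)) ((g \<circ> F) z) ((s \<circ> F) z)"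
    using g(2,3) chol_comp[OF g(1) F K] by (auto simp: pre f pull_def)
  thus "case Ue of (U, e) \<Rightarrow> open (q -` U) \<and>
      (\<exists>g. \<forall>z \<in> q -` U. chol K z g \<and> g z \<noteq> 0 \<and>
        e (q z) = scl (fib (pull X f L) (q z)) (g z) ((s \<circ> F) z))"
    unfolding Ue using op by blast
qed

lemma mults_pull:
  assumes "mults q' L s \<mu>" "\<And>z. f (q z) = q' (F z)"
  shows "mults q (pull X f L) (s \<circ> F) (\<lambda>z z'. \<mu> (F z) (F z'))"
  unfolding mults_def
proof (intro allI impI)
  fix z z' assume "q z = q z'"
  hence F: "q' (F z) = q' (F z')" using assms(2) by metis
  thus "(s \<circ> F) z' = scl (fib (pull X f L) (q z)) (\<mu> (F z) (F z')) ((s \<circ> F) z)"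
    using multsD[OF assms(1) F] by (simp add: pull_def assms(2))
qed

text \<open>One setting for the curve, its square and its cube. \<open>K_comb\<close> is exactly
  what the product and quotient rules require of the admissible derivatives.\<close>

locale hspace =
  fixes q :: "'c::real_normed_vector \<Rightarrow> 'p" and K :: "('c \<Rightarrow> complex) set"
    and H :: "'c set \<Rightarrow> ('c \<Rightarrow> complex) \<Rightarrow> bool"
  assumes K_zero: "(\<lambda>_. 0) \<in> K"
    and K_comb: "\<And>S T a b. S \<in> K \<Longrightarrow> T \<in> K \<Longrightarrow> (\<lambda>x. a * S x + b * T x) \<in> K"
    and H_iff: "\<And>U h. open U \<Longrightarrow> H U h \<longleftrightarrow> (\<forall>z\<in>U. chol K z h)"
begin

lemma chol_mult:
  assumes "chol K z f" "chol K z g"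
  shows "chol K z (\<lambda>w. f w * g w)"
proof -
  obtain S T where ST: "S \<in> K" "(f has_derivative S) (at z)" "T \<in> K" "(g has_derivative T) (at z)"
    using assms by (auto simp: chol_def)
  have "((\<lambda>w. f w * g w) has_derivative (\<lambda>x. f z * T x + S x * g z)) (at z)"
    by (rule has_derivative_mult[OF ST(2,4)])
  also have "(\<lambda>x. f z * T x + S x * g z) = (\<lambda>x. f z * T x + g z * S x)" by (simp add: mult.commute)
  finally show ?thesis using K_comb[OF ST(3,1)] unfolding chol_def by blast
qed

lemma chol_divide:
  assumes "chol K z f" "chol K z g" "g z \<noteq> 0"
  shows "chol K z (\<lambda>w. f w / g w)"
proof -
  obtain T where T: "T \<in> K" "(g has_derivative T) (at z)"
    using assms by (auto simp: chol_def)
  have "((\<lambda>w. inverse (g w)) has_derivative (\<lambda>x. - (inverse (g z) * T x * inverse (g z)))) (at z)"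
    by (rule Deriv.has_derivative_inverse[OF assms(3) T(2)])
  also have "(\<lambda>x. - (inverse (g z) * T x * inverse (g z))) =
      (\<lambda>x. - (inverse (g z) * inverse (g z)) * T x + 0 * T x)" by (auto simp: mult_ac)
  finally have "chol K z (\<lambda>w. inverse (g w))"
    using K_comb[OF T(1) T(1)] unfolding chol_def by blast
  thus ?thesis using chol_mult[OF assms(1)] by (simp add: divide_inverse)
qed

abbreviation "X \<equiv> quot_space q H"

lemma pts_X: "pts X = range q"
  by (simp add: quot_space_def)

lemma hol_quot:
  assumes "open (q -` U)" "\<And>z. q z \<in> U \<Longrightarrow> chol K z t" "\<And>z. q z \<in> U \<Longrightarrow> h (q z) = t z"
  shows "hol X U h"
proof -
  have "chol K z (h \<circ> q)" if "q z \<in> U" for z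
    using chol_cong[of "q -` U" z t "h \<circ> q" K] assms that by auto
  thus ?thesis using H_iff[OF assms(1)] by (simp add: quot_space_def)
qed

lemma hol_quotD:
  assumes "open (q -` U)" "hol X U h" "q z \<in> U"
  shows "chol K z (h \<circ> q)"
  using assms H_iff[OF assms(1)] by (simp add: quot_space_def)

section \<open>Frames and multipliers of tensor products and duals\<close>

lemma lframe_tensor:
  assumes s: "lframe q K L s" and s': "lframe q K L' s'"
  shows "lframe q K (tensor_bundle L L') (\<lambda>z. tens (fib L (q z)) (fib L' (q z)) (s z) (s' z))"
  unfolding lframe_def
proof (intro conjI allI ballI)
  let ?T = "tensor_bundle L L'"
  note b = lframe_line[OF s] lframe_basis[OF s] lframe_line[OF s'] lframe_basis[OF s']
  show "is_line (fib ?T (q z))"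
    and "line_basis (fib ?T (q z)) (tens (fib L (q z)) (fib L' (q z)) (s z) (s' z))" for z
    using tensor_line_basis[OF b] by (simp_all add: tensor_bundle_def)
  show "(\<Union>(U, e) \<in> frames ?T. U) = range q"
  proof (intro equalityI subsetI)
    fix p assume "p \<in> range q"
    then obtain z where p: "p = q z" by blast
    obtain U e where U: "(U, e) \<in> frames L" "p \<in> U" using lframe_cover[OF s] p by metis
    obtain V e' where V: "(V, e') \<in> frames L'" "p \<in> V" using lframe_cover[OF s'] p by metis
    have "(U \<inter> V, \<lambda>p. tens (fib L p) (fib L' p) (e p) (e' p)) \<in> frames ?T"
      using U V by (auto simp: tensor_bundle_def)
    thus "p \<in> (\<Union>(U, e) \<in> frames ?T. U)" using U V by blast
  qed (use lframe_sub[OF s] in \<open>auto simp: tensor_bundle_def\<close>)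
next
  fix Ue assume "Ue \<in> frames (tensor_bundle L L')"
  then obtain U e V e' where U: "(U, e) \<in> frames L" and V: "(V, e') \<in> frames L'"
    and Ue: "Ue = (U \<inter> V, \<lambda>p. tens (fib L p) (fib L' p) (e p) (e' p))"
    by (auto simp: tensor_bundle_def)
  obtain g where g: "\<And>z. q z \<in> U \<Longrightarrow> chol K z g" "\<And>z. q z \<in> U \<Longrightarrow> g z \<noteq> 0"
    "\<And>z. q z \<in> U \<Longrightarrow> e (q z) = scl (fib L (q z)) (g z) (s z)"
    using lframe_coeff[OF s U] by blast
  obtain g' where g': "\<And>z. q z \<in> V \<Longrightarrow> chol K z g'" "\<And>z. q z \<in> V \<Longrightarrow> g' z \<noteq> 0"
    "\<And>z. q z \<in> V \<Longrightarrow> e' (q z) = scl (fib L' (q z)) (g' z) (s' z)"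
    using lframe_coeff[OF s' V] by blast
  have "open (q -` (U \<inter> V))" using lframe_open[OF s U] lframe_open[OF s' V] by auto
  moreover have "\<forall>z \<in> q -` (U \<inter> V). chol K z (\<lambda>z. g z * g' z) \<and> g z * g' z \<noteq> 0 \<and>
      tens (fib L (q z)) (fib L' (q z)) (e (q z)) (e' (q z)) =
      scl (fib (tensor_bundle L L') (q z)) (g z * g' z) (tens (fib L (q z)) (fib L' (q z)) (s z) (s' z))"
    using g g' chol_mult tens_scl_scl[OF lframe_line[OF s] lframe_line[OF s']
        line_basis_mem[OF lframe_basis[OF s]] line_basis_mem[OF lframe_basis[OF s']]]
    by (auto simp: tensor_bundle_def)
  ultimately show "case Ue of (U, e) \<Rightarrow> open (q -` U) \<and>
      (\<exists>g. \<forall>z \<in> q -` U. chol K z g \<and> g z \<noteq> 0 \<and>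
        e (q z) = scl (fib (tensor_bundle L L') (q z)) (g z) (tens (fib L (q z)) (fib L' (q z)) (s z) (s' z)))"
    unfolding Ue prod.case by (intro conjI exI[of _ "\<lambda>z. g z * g' z"])
qed

lemma mults_tensor:
  assumes s: "lframe q K L s" "mults q L s \<mu>" and s': "lframe q K L' s'" "mults q L' s' \<mu>'"
  shows "mults q (tensor_bundle L L') (\<lambda>z. tens (fib L (q z)) (fib L' (q z)) (s z) (s' z))
     (\<lambda>z z'. \<mu> z z' * \<mu>' z z')"
  unfolding mults_def
proof (intro allI impI)
  fix z z' assume z: "q z = q z'"
  have "s z' = scl (fib L (q z)) (\<mu> z z') (s z)" "s' z' = scl (fib L' (q z)) (\<mu>' z z') (s' z)"
    by (rule multsD[OF s(2) z] multsD[OF s'(2) z])+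
  thus "tens (fib L (q z')) (fib L' (q z')) (s z') (s' z') = scl (fib (tensor_bundle L L') (q z))
      (\<mu> z z' * \<mu>' z z') (tens (fib L (q z)) (fib L' (q z)) (s z) (s' z))"
    using tens_scl_scl[OF lframe_line[OF s(1)] lframe_line[OF s'(1)]
        line_basis_mem[OF lframe_basis[OF s(1)]] line_basis_mem[OF lframe_basis[OF s'(1)]]]
    by (simp add: tensor_bundle_def z[symmetric])
qed

lemma lframe_dual:
  assumes s: "lframe q K L s"
  shows "lframe q K (dual_bundle L) (\<lambda>z. dual_vec (fib L (q z)) (s z))"
  unfolding lframe_def
proof (intro conjI allI ballI)
  let ?T = "dual_bundle L"
  note b = lframe_line[OF s] lframe_basis[OF s]
  show "is_line (fib ?T (q z))"
    and "line_basis (fib ?T (q z)) (dual_vec (fib L (q z)) (s z))" for z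
    using dual_line_basis[OF b] by (simp_all add: dual_bundle_def)
  have "(\<Union>(U, e) \<in> frames ?T. U) = (\<Union>(U, e) \<in> frames L. U)"
    by (fastforce simp: dual_bundle_def)
  thus "(\<Union>(U, e) \<in> frames ?T. U) = range q" using s by (simp add: lframe_def)
next
  fix Ue assume "Ue \<in> frames (dual_bundle L)"
  then obtain U e where U: "(U, e) \<in> frames L"
    and Ue: "Ue = (U, \<lambda>p. dual_vec (fib L p) (e p))"
    by (auto simp: dual_bundle_def)
  obtain g where g: "\<And>z. q z \<in> U \<Longrightarrow> chol K z g" "\<And>z. q z \<in> U \<Longrightarrow> g z \<noteq> 0"
    "\<And>z. q z \<in> U \<Longrightarrow> e (q z) = scl (fib L (q z)) (g z) (s z)"
    using lframe_coeff[OF s U] by blast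
  have "chol K z (\<lambda>_. 1)" for z
    unfolding chol_def using K_zero has_derivative_const by blast
  hence "\<forall>z \<in> q -` U. chol K z (\<lambda>z. 1 / g z) \<and> 1 / g z \<noteq> 0 \<and>
      dual_vec (fib L (q z)) (e (q z)) =
      scl (fib (dual_bundle L) (q z)) (1 / g z) (dual_vec (fib L (q z)) (s z))"
    using g chol_divide dual_vec_scl_basis[OF lframe_line[OF s] lframe_basis[OF s]]
    by (auto simp: dual_bundle_def)
  thus "case Ue of (U, e) \<Rightarrow> open (q -` U) \<and>
      (\<exists>g. \<forall>z \<in> q -` U. chol K z g \<and> g z \<noteq> 0 \<and>
        e (q z) = scl (fib (dual_bundle L) (q z)) (g z) (dual_vec (fib L (q z)) (s z)))"
    unfolding Ue prod.case using lframe_open[OF s U] by (intro conjI exI[of _ "\<lambda>z. 1 / g z"])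
qed

lemma mults_dual:
  assumes s: "lframe q K L s" "mults q L s \<mu>"
  shows "mults q (dual_bundle L) (\<lambda>z. dual_vec (fib L (q z)) (s z)) (\<lambda>z z'. 1 / \<mu> z z')"
  unfolding mults_def
proof (intro allI impI)
  fix z z' assume z: "q z = q z'"
  have "s z' = scl (fib L (q z)) (\<mu> z z') (s z)" by (rule multsD[OF s(2) z])
  thus "dual_vec (fib L (q z')) (s z') =
      scl (fib (dual_bundle L) (q z)) (1 / \<mu> z z') (dual_vec (fib L (q z)) (s z))"
    using dual_vec_scl_basis[OF lframe_line[OF s(1)] lframe_basis[OF s(1)] mults_nz[OF s z]]
    by (simp add: dual_bundle_def z[symmetric])
qed

section \<open>Bundles and their isomorphisms recovered from frames upstairs\<close>

lemma line_bundle_lframe: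
  assumes s: "lframe q K L s" and L: "base L = X"
  shows "line_bundle L"
proof -
  note ln = lframe_line[OF s] and bs = lframe_basis[OF s]
  have "is_line (fib L p)" if "p \<in> pts (base L)" for p
    using that ln by (auto simp: L pts_X)
  moreover have "opn (base L) U \<and> (\<forall>p \<in> U. line_basis (fib L p) (e p))"
    if U: "(U, e) \<in> frames L" for U e
  proof -
    obtain g where g: "\<And>z. q z \<in> U \<Longrightarrow> chol K z g" "\<And>z. q z \<in> U \<Longrightarrow> g z \<noteq> 0"
      "\<And>z. q z \<in> U \<Longrightarrow> e (q z) = scl (fib L (q z)) (g z) (s z)"
      using lframe_coeff[OF s U] by blast
    have "line_basis (fib L (q z)) (e (q z))" if "q z \<in> U" for z
      using g that line_basis_scl_iff[OF ln bs] by simp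
    thus ?thesis
      using lframe_open[OF s U] lframe_sub[OF s U] by (auto simp: L quot_space_def)
  qed
  moreover have "\<exists>h. hol (base L) (U \<inter> V) h \<and> (\<forall>p \<in> U \<inter> V. e p = scl (fib L p) (h p) (e' p))"
    if U: "(U, e) \<in> frames L" and V: "(V, e') \<in> frames L" for U e V e'
  proof -
    obtain g where g: "\<And>z. q z \<in> U \<Longrightarrow> chol K z g" "\<And>z. q z \<in> U \<Longrightarrow> g z \<noteq> 0"
      "\<And>z. q z \<in> U \<Longrightarrow> e (q z) = scl (fib L (q z)) (g z) (s z)"
      using lframe_coeff[OF s U] by blast
    obtain g' where g': "\<And>z. q z \<in> V \<Longrightarrow> chol K z g'" "\<And>z. q z \<in> V \<Longrightarrow> g' z \<noteq> 0"
      "\<And>z. q z \<in> V \<Longrightarrow> e' (q z) = scl (fib L (q z)) (g' z) (s z)"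
      using lframe_coeff[OF s V] by blast
    \<comment> \<open>The transition function has to live on the quotient. As a fibre coordinate it
      does not involve a lift, while its description \<open>g z / g' z\<close> upstairs shows that
      it is holomorphic.\<close>
    define h where "h p = dual_vec (fib L p) (e' p) (e p)" for p
    have eq: "e (q z) = scl (fib L (q z)) (g z / g' z) (e' (q z))" if "q z \<in> U \<inter> V" for z
      using that g g' is_line_scl_scl[OF ln line_basis_mem[OF bs]] by simp
    have h: "h (q z) = g z / g' z" if "q z \<in> U \<inter> V" for z
    proof -
      have "line_basis (fib L (q z)) (e' (q z))"
        using g' that line_basis_scl_iff[OF ln bs] by simp
      thus ?thesis unfolding h_def eq[OF that] by (rule dual_vec_scl)
    qed
    have "hol X (U \<inter> V) h"
      by (rule hol_quot[where t = "\<lambda>z. g z / g' z", OF _ _ h])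
        (use lframe_open[OF s U] lframe_open[OF s V] g g' chol_divide in auto)
    moreover have "e p = scl (fib L p) (h p) (e' p)" if "p \<in> U \<inter> V" for p
      using that eq h lframe_sub[OF s U] by auto
    ultimately show ?thesis unfolding L by blast
  qed
  ultimately show ?thesis
    using s unfolding line_bundle_def by (auto simp: lframe_def L pts_X)
qed

text \<open>Equal multipliers are precisely what makes sending \<open>s z\<close> to
  \<open>s' z\<close> independent of the lift; in local frames the matrix is the quotient of the two
  coefficient functions.\<close>

lemma bundle_iso_lframe:
  assumes s: "lframe q K L s" "mults q L s \<mu>" "base L = X"
    and s': "lframe q K L' s'" "mults q L' s' \<mu>"
  obtains k where "k \<in> bundle_isos L L'" "\<And>z. k (q z) (s z) = s' z"
proof -
  note ln = lframe_line[OF s(1)] and bs = lframe_basis[OF s(1)]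
  note ln' = lframe_line[OF s'(1)] and bs' = lframe_basis[OF s'(1)]
  \<comment> \<open>An arbitrary, possibly discontinuous choice of lifts; it enters the definition
    of \<open>k\<close> but, by \<open>ks\<close>, not its values.\<close>
  define r where "r = inv_into UNIV q"
  have r: "q (r (q z)) = q z" for z unfolding r_def by (simp add: f_inv_into_f)
  define k where "k = (\<lambda>p\<in>range q. basis_map (fib L p) (s (r p)) (fib L' p) (s' (r p)))"
  have kiso: "k (q z) \<in> line_isos (fib L (q z)) (fib L' (q z))" for z
    using basis_map_iso[OF ln bs ln' bs'] r by (metis (no_types, lifting) k_def rangeI restrict_apply')
  have ks: "k (q z) (s z) = s' z" for z
  proof -
    have "s z = scl (fib L (q z)) (\<mu> (r (q z)) z) (s (r (q z)))"
      "s' z = scl (fib L' (q z)) (\<mu> (r (q z)) z) (s' (r (q z)))"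
      by (rule multsD[OF s(2) r, unfolded r] multsD[OF s'(2) r, unfolded r])+
    moreover have "line_basis (fib L (q z)) (s (r (q z)))" using bs r by metis
    ultimately show ?thesis by (simp add: k_def basis_map_scl)
  qed
  have "\<exists>h. hol (base L) (U \<inter> V) h \<and> (\<forall>p \<in> U \<inter> V. k p (e p) = scl (fib L' p) (h p) (e' p))"
    if U: "(U, e) \<in> frames L" and V: "(V, e') \<in> frames L'" for U e V e'
  proof -
    obtain g where g: "\<And>z. q z \<in> U \<Longrightarrow> chol K z g" "\<And>z. q z \<in> U \<Longrightarrow> g z \<noteq> 0"
      "\<And>z. q z \<in> U \<Longrightarrow> e (q z) = scl (fib L (q z)) (g z) (s z)"
      using lframe_coeff[OF s(1) U] by blast
    obtain g' where g': "\<And>z. q z \<in> V \<Longrightarrow> chol K z g'" "\<And>z. q z \<in> V \<Longrightarrow> g' z \<noteq> 0"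
      "\<And>z. q z \<in> V \<Longrightarrow> e' (q z) = scl (fib L' (q z)) (g' z) (s' z)"
      using lframe_coeff[OF s'(1) V] by blast
    define h where "h p = dual_vec (fib L' p) (e' p) (k p (e p))" for p
    have eq: "k (q z) (e (q z)) = scl (fib L' (q z)) (g z / g' z) (e' (q z))" if "q z \<in> U \<inter> V" for z
    proof -
      have "k (q z) (e (q z)) = scl (fib L' (q z)) (g z) (s' z)"
        using kiso[of z] g(3) that line_basis_mem[OF bs] by (simp add: line_isos_def ks)
      thus ?thesis
        using that g' is_line_scl_scl[OF ln' line_basis_mem[OF bs']] by simp
    qed
    have h: "h (q z) = g z / g' z" if "q z \<in> U \<inter> V" for z
    proof -
      have "line_basis (fib L' (q z)) (e' (q z))"
        using g' that line_basis_scl_iff[OF ln' bs'] by simp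
      thus ?thesis unfolding h_def eq[OF that] by (rule dual_vec_scl)
    qed
    have "hol X (U \<inter> V) h"
      by (rule hol_quot[where t = "\<lambda>z. g z / g' z", OF _ _ h])
        (use lframe_open[OF s(1) U] lframe_open[OF s'(1) V] g g' chol_divide in auto)
    moreover have "k p (e p) = scl (fib L' p) (h p) (e' p)" if "p \<in> U \<inter> V" for p
      using that eq h lframe_sub[OF s(1) U] by auto
    ultimately show ?thesis unfolding s(3) by blast
  qed
  moreover have "k \<in> (\<Pi>\<^sub>E p \<in> pts (base L). line_isos (fib L p) (fib L' p))"
    unfolding s(3) pts_X using kiso by (auto simp: k_def)
  ultimately have "k \<in> bundle_isos L L'" unfolding bundle_isos_def by auto
  thus thesis using that ks by blast
qed

text \<open>In global frames upstairs an isomorphism is a single nowhere vanishing function; near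
  each point it equals \<open>h * g' / g\<close>, with \<open>h\<close> the local matrix and
  \<open>g\<close>, \<open>g'\<close> the coefficients of the local frames.\<close>

lemma bundle_iso_coeff:
  assumes s: "lframe q K L s" "base L = X" and s': "lframe q K L' s'"
    and k: "k \<in> bundle_isos L L'"
  obtains t where "\<And>z. chol K z t" "\<And>z. t z \<noteq> 0"
    "\<And>z. k (q z) (s z) = scl (fib L' (q z)) (t z) (s' z)"
proof -
  note ln = lframe_line[OF s(1)] and bs = lframe_basis[OF s(1)]
  note ln' = lframe_line[OF s'] and bs' = lframe_basis[OF s']
  define t where "t z = dual_vec (fib L' (q z)) (s' z) (k (q z) (s z))" for z
  have kiso: "k (q z) \<in> line_isos (fib L (q z)) (fib L' (q z))" for z
    using k by (auto simp: bundle_isos_def s(2) pts_X)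
  have kb: "line_basis (fib L' (q z)) (k (q z) (s z))" for z
    by (rule line_isos_basis[OF ln ln' kiso bs])
  have t: "k (q z) (s z) = scl (fib L' (q z)) (t z) (s' z)" for z
    unfolding t_def by (rule scl_dual_vec[OF bs' line_basis_mem[OF kb], symmetric])
  have "t z \<noteq> 0" for z using kb line_basis_scl_iff[OF ln' bs'] unfolding t by blast
  moreover have "chol K z t" for z
  proof -
    obtain U e where U: "(U, e) \<in> frames L" "q z \<in> U" using lframe_cover[OF s(1)] .
    obtain V e' where V: "(V, e') \<in> frames L'" "q z \<in> V" using lframe_cover[OF s'] .
    obtain g where g: "\<And>z. q z \<in> U \<Longrightarrow> chol K z g" "\<And>z. q z \<in> U \<Longrightarrow> g z \<noteq> 0"
      "\<And>z. q z \<in> U \<Longrightarrow> e (q z) = scl (fib L (q z)) (g z) (s z)"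
      using lframe_coeff[OF s(1) U(1)] by blast
    obtain g' where g': "\<And>z. q z \<in> V \<Longrightarrow> chol K z g'" "\<And>z. q z \<in> V \<Longrightarrow> g' z \<noteq> 0"
      "\<And>z. q z \<in> V \<Longrightarrow> e' (q z) = scl (fib L' (q z)) (g' z) (s' z)"
      using lframe_coeff[OF s' V(1)] by blast
    obtain h where h: "hol X (U \<inter> V) h" "\<And>p. p \<in> U \<inter> V \<Longrightarrow> k p (e p) = scl (fib L' p) (h p) (e' p)"
      using k U(1) V(1) unfolding bundle_isos_def s(2) by blast
    have op: "open (q -` (U \<inter> V))" using lframe_open[OF s(1) U(1)] lframe_open[OF s' V(1)] by auto
    have eq: "h (q w) * g' w / g w = t w" if w: "w \<in> q -` (U \<inter> V)" for w
    proof -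
      have "k (q w) (e (q w)) = scl (fib L' (q w)) (g w) (k (q w) (s w))"
        using kiso[of w] g(3)[of w] w line_basis_mem[OF bs] by (simp add: line_isos_def)
      hence "scl (fib L' (q w)) (g w * t w) (s' w) = scl (fib L' (q w)) (h (q w) * g' w) (s' w)"
        using h(2)[of "q w"] g'(3)[of w] w is_line_scl_scl[OF ln' line_basis_mem[OF bs']]
        by (simp add: t)
      hence "g w * t w = h (q w) * g' w" using line_basis_inj[OF bs'] by blast
      thus ?thesis using g(2)[of w] w by (simp add: field_simps)
    qed
    have "chol K z (\<lambda>w. h (q w) * g' w / g w)"
      using hol_quotD[OF op h(1), of z] U V g(1,2) g'(1)
      by (intro chol_divide chol_mult) (auto simp: o_def)
    thus ?thesis using chol_cong[OF op _ eq] U V by simp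
  qed
  ultimately show thesis using that t by blast
qed

text \<open>A member of a Picard class comes with its own local frames only. Pulling
  \<open>s\<close> back through the isomorphism equips it with a global frame upstairs having the
  same multipliers.\<close>

lemma lframe_transport:
  assumes L': "line_bundle L'" "base L' = X" and s: "lframe q K L s" "mults q L s \<mu>"
    and k: "k \<in> bundle_isos L' L"
  obtains s' where "lframe q K L' s'" "mults q L' s' \<mu>"
proof -
  note ln = lframe_line[OF s(1)] and bs = lframe_basis[OF s(1)]
  have ln': "is_line (fib L' (q z))" for z
    using L' by (auto simp: line_bundle_def pts_X)
  have kiso: "k (q z) \<in> line_isos (fib L' (q z)) (fib L (q z))" for z
    using k by (auto simp: bundle_isos_def L' pts_X)
  have kb: "bij_betw (k (q z)) (vecs (fib L' (q z))) (vecs (fib L (q z)))" for z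
    using kiso[of z] by (simp add: line_isos_def)
  have klin: "k (q z) (scl (fib L' (q z)) c v) = scl (fib L (q z)) c (k (q z) v)"
    if "v \<in> vecs (fib L' (q z))" for z c v
    using kiso[of z] that by (simp add: line_isos_def)
  define s' where "s' z = inv_into (vecs (fib L' (q z))) (k (q z)) (s z)" for z
  have ks: "k (q z) (s' z) = s z" and s'm: "s' z \<in> vecs (fib L' (q z))" for z
    unfolding s'_def using kb[of z] line_basis_mem[OF bs, of z]
    by (auto simp: bij_betw_def f_inv_into_f inv_into_into)
  have kinj: "v = w" if "k (q z) v = k (q z) w" "v \<in> vecs (fib L' (q z))" "w \<in> vecs (fib L' (q z))" for z v w
    using kb[of z] that by (auto simp: bij_betw_def dest: inj_onD)
  have bs': "line_basis (fib L' (q z)) (s' z)" for z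
  proof -
    obtain e where e: "line_basis (fib L' (q z)) e" using ln'[of z] by (auto simp: is_line_def)
    obtain c where c: "s' z = scl (fib L' (q z)) c e" using line_basis_obtain[OF e s'm] .
    have "scl (fib L (q z)) c (k (q z) e) = s z"
      using ks[of z] klin[OF line_basis_mem[OF e], of c] by (simp add: c)
    hence "c \<noteq> 0"
      using line_basis_scl_iff[OF ln line_isos_basis[OF ln' ln kiso e]] bs[of z] by metis
    thus ?thesis using line_basis_scl_iff[OF ln' e] by (simp add: c)
  qed
  have "lframe q K L' s'"
    unfolding lframe_def
  proof (intro conjI allI ballI)
    show "(\<Union>(U, e) \<in> frames L'. U) = range q"
      using L' by (auto simp: line_bundle_def pts_X)
  next
    fix Ue assume "Ue \<in> frames L'"
    then obtain U e where U: "(U, e) \<in> frames L'" and Ue: "Ue = (U, e)" by (cases Ue) auto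
    have op: "open (q -` U)" and eb: "\<And>z. q z \<in> U \<Longrightarrow> line_basis (fib L' (q z)) (e (q z))"
      using L' U by (auto simp: line_bundle_def quot_space_def)
    define g where "g z = dual_vec (fib L' (q z)) (s' z) (e (q z))" for z
    have g: "e (q z) = scl (fib L' (q z)) (g z) (s' z)" if "q z \<in> U" for z
      unfolding g_def by (rule scl_dual_vec[OF bs' line_basis_mem[OF eb[OF that]], symmetric])
    have "g z \<noteq> 0" if "q z \<in> U" for z
      using eb[OF that] line_basis_scl_iff[OF ln' bs'] unfolding g[OF that] by blast
    moreover have "chol K z g" if z: "q z \<in> U" for z
    proof -
      obtain V e' where V: "(V, e') \<in> frames L" "q z \<in> V" using lframe_cover[OF s(1)] .
      obtain g' where g': "\<And>z. q z \<in> V \<Longrightarrow> chol K z g'" "\<And>z. q z \<in> V \<Longrightarrow> g' z \<noteq> 0"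
        "\<And>z. q z \<in> V \<Longrightarrow> e' (q z) = scl (fib L (q z)) (g' z) (s z)"
        using lframe_coeff[OF s(1) V(1)] by blast
      obtain h where h: "hol X (U \<inter> V) h" "\<And>p. p \<in> U \<inter> V \<Longrightarrow> k p (e p) = scl (fib L p) (h p) (e' p)"
        using k U V(1) unfolding bundle_isos_def L'(2) by blast
      have op': "open (q -` (U \<inter> V))" using op lframe_open[OF s(1) V(1)] by auto
      have eq: "h (q w) * g' w = g w" if w: "w \<in> q -` (U \<inter> V)" for w
      proof -
        have "k (q w) (e (q w)) = scl (fib L (q w)) (g w) (s w)"
          using klin[OF s'm] g[of w] w ks by simp
        hence "scl (fib L (q w)) (g w) (s w) = scl (fib L (q w)) (h (q w) * g' w) (s w)"
          using h(2)[of "q w"] g'(3)[of w] w is_line_scl_scl[OF ln line_basis_mem[OF bs]] by simp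
        thus ?thesis using line_basis_inj[OF bs] by metis
      qed
      have "chol K z (\<lambda>w. h (q w) * g' w)"
        using hol_quotD[OF op' h(1), of z] z V g'(1) by (intro chol_mult) (auto simp: o_def)
      thus ?thesis using chol_cong[OF op' _ eq] z V by simp
    qed
    ultimately show "case Ue of (U, e) \<Rightarrow> open (q -` U) \<and>
      (\<exists>g. \<forall>z \<in> q -` U. chol K z g \<and> g z \<noteq> 0 \<and> e (q z) = scl (fib L' (q z)) (g z) (s' z))"
      unfolding Ue using op g by auto
  qed (use ln' bs' in auto)
  moreover have "mults q L' s' \<mu>"
    unfolding mults_def
  proof (intro allI impI)
    fix z z' assume z: "q z = q z'"
    show "s' z' = scl (fib L' (q z)) (\<mu> z z') (s' z)"
    proof (rule kinj[of z])
      show "k (q z) (s' z') = k (q z) (scl (fib L' (q z)) (\<mu> z z') (s' z))"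
        using multsD[OF s(2) z] ks[of z'] ks[of z] klin[OF s'm, of z] by (simp add: z)
    qed (use s'm[of z', folded z] line_basis_scl_mem[OF bs', of z] in auto)
  qed
  ultimately show thesis using that by blast
qed

text \<open>This evaluates the descriptions behind \<open>cube_iso\<close> and
  \<open>ribet_triv\<close>: normalised at the single point \<open>z0\<close>, the isomorphism is
  known on the whole frame.\<close>

lemma the_bundle_iso:
  fixes z0 :: 'c
  assumes liouville: "liouville q K"
    and s: "lframe q K L s" "mults q L s \<mu>" "base L = X"
    and s': "lframe q K L' s'" "mults q L' s' \<mu>"
  defines "k \<equiv> THE k. k \<in> bundle_isos L L' \<and> k (q z0) (s z0) = s' z0"
  shows "k \<in> bundle_isos L L'" and "\<And>z. k (q z) (s z) = s' z"
proof -
  note ln = lframe_line[OF s(1)] and bs = lframe_basis[OF s(1)]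
  note ln' = lframe_line[OF s'(1)] and bs' = lframe_basis[OF s'(1)]
  obtain k0 where k0: "k0 \<in> bundle_isos L L'" "\<And>z. k0 (q z) (s z) = s' z"
    using bundle_iso_lframe[OF s s'] by blast
  have kiso: "k (q z) \<in> line_isos (fib L (q z)) (fib L' (q z))" if "k \<in> bundle_isos L L'" for k z
    using that by (auto simp: bundle_isos_def s(3) pts_X)
  have uniq: "k1 = k0" if k1: "k1 \<in> bundle_isos L L'" "k1 (q z0) (s z0) = s' z0" for k1
  proof -
    obtain t where t: "\<And>z. chol K z t" "\<And>z. t z \<noteq> 0"
      "\<And>z. k1 (q z) (s z) = scl (fib L' (q z)) (t z) (s' z)"
      using bundle_iso_coeff[OF s(1,3) s'(1) k1(1)] by blast
    \<comment> \<open>Both frames change by the same nonzero multiplier, which cancels; so the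
      coefficient descends to the quotient.\<close>
    have "t z = t z'" if z: "q z = q z'" for z z'
    proof -
      have e: "s z' = scl (fib L (q z)) (\<mu> z z') (s z)" "s' z' = scl (fib L' (q z)) (\<mu> z z') (s' z)"
        by (rule multsD[OF s(2) z] multsD[OF s'(2) z])+
      note ss = is_line_scl_scl[OF ln' line_basis_mem[OF bs']]
      have "k1 (q z) (s z') = scl (fib L' (q z)) (\<mu> z z' * t z) (s' z)"
        using kiso[OF k1(1), of z] line_basis_mem[OF bs, of z]
        by (simp add: e(1) line_isos_def t(3) ss)
      moreover have "k1 (q z) (s z') = scl (fib L' (q z)) (t z' * \<mu> z z') (s' z)"
        using t(3)[of z'] by (simp add: z[symmetric] e(2) ss)
      ultimately have "\<mu> z z' * t z = t z' * \<mu> z z'" using line_basis_inj[OF bs'] by metis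
      thus ?thesis using mults_nz[OF s(1,2) z] by simp
    qed
    hence const: "t z = t z0" for z using liouville t(1) unfolding liouville_def by blast
    have "scl (fib L' (q z0)) (t z0) (s' z0) = scl (fib L' (q z0)) 1 (s' z0)"
      using t(3)[of z0] k1(2) line_basis_scl_one[OF ln' bs'] by metis
    hence "t z0 = 1" using line_basis_inj[OF bs'] by blast
    hence eq: "k1 (q z) (s z) = k0 (q z) (s z)" for z
      using t(3)[of z] const[of z] k0(2) line_basis_scl_one[OF ln' bs'] by simp
    have "k1 p = k0 p" for p
    proof (cases "p \<in> range q")
      case True
      then obtain z where p: "p = q z" by blast
      show ?thesis
        unfolding p by (rule line_isos_eqI[OF kiso[OF k1(1)] kiso[OF k0(1)] bs eq])
    next
      case False
      thus ?thesis using k1(1) k0(1)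
        by (auto simp: bundle_isos_def s(3) pts_X PiE_def extensional_def)
    qed
    thus ?thesis by blast
  qed
  have "k = k0" unfolding k_def by (rule the_equality) (use k0 uniq in blast)+
  thus "k \<in> bundle_isos L L'" "\<And>z. k (q z) (s z) = s' z" using k0 by auto
qed

text \<open>A Picard class becomes a set that depends on \<open>L\<close> through the multipliers
  alone, so equal multipliers give equal points of the dual curve.\<close>

lemma pic_class_lframe:
  fixes L :: "('p, 'a) lbundle"
  assumes s: "lframe q K L s" "mults q L s \<mu>" "base L = X"
  shows "pic_class L = {L'. base L' = X \<and> (\<exists>s'. lframe q K L' s' \<and> mults q L' s' \<mu>)}"
proof (intro Set.set_eqI iffI)
  fix L' :: "('p, 'a) lbundle" assume "L' \<in> pic_class L"
  then obtain k where L': "line_bundle L'" "base L' = X" "k \<in> bundle_isos L' L"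
    by (auto simp: pic_class_def s)
  thus "L' \<in> {L'. base L' = X \<and> (\<exists>s'. lframe q K L' s' \<and> mults q L' s' \<mu>)}"
    using lframe_transport[OF L'(1,2) s(1,2) L'(3)] by blast
next
  fix L' :: "('p, 'a) lbundle" assume "L' \<in> {L'. base L' = X \<and> (\<exists>s'. lframe q K L' s' \<and> mults q L' s' \<mu>)}"
  then obtain s' where s': "base L' = X" "lframe q K L' s'" "mults q L' s' \<mu>" by blast
  obtain k where "k \<in> bundle_isos L' L"
    using bundle_iso_lframe[OF s'(2,3,1) s(1,2)] by blast
  thus "L' \<in> pic_class L"
    using s' line_bundle_lframe[OF s'(2,1)] by (auto simp: pic_class_def s)
qed

end

section \<open>The theta function of a lattice\<close>

text \<open>The sign condition orders the basis so that \<open>Im (\<omega>2 / \<omega>1)\<close>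
  and the covolume are positive; the product defining theta converges only in this case.\<close>

locale oriented_lattice =
  fixes \<Lambda> :: "complex set" and \<omega>1 \<omega>2 :: complex
  assumes oriented: "Im (cnj \<omega>1 * \<omega>2) > 0"
    and lattice_eq: "\<Lambda> = {of_int m * \<omega>1 + of_int n * \<omega>2 | m n. True}"
begin

abbreviation proj :: "complex \<Rightarrow> complex set" ("\<pi>") where "\<pi> \<equiv> ell_pr \<Lambda>"

section \<open>The lattice: generation, real coordinates, discreteness\<close>

lemma latticeI: "of_int m * \<omega>1 + of_int n * \<omega>2 \<in> \<Lambda>"
  unfolding lattice_eq by blast

lemma latticeE:
  assumes "l \<in> \<Lambda>"
  obtains m n where "l = of_int m * \<omega>1 + of_int n * \<omega>2"
  using assms unfolding lattice_eq by blast

lemma lattice_0 [simp]: "0 \<in> \<Lambda>"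
  using latticeI[of 0 0] by simp

lemma lattice_\<omega>1: "\<omega>1 \<in> \<Lambda>" and lattice_\<omega>2: "\<omega>2 \<in> \<Lambda>"
  using latticeI[of 1 0] latticeI[of 0 1] by simp_all

lemma lattice_add:
  assumes "k \<in> \<Lambda>" "l \<in> \<Lambda>" shows "k + l \<in> \<Lambda>"
proof -
  obtain m n m' n' where "k = of_int m * \<omega>1 + of_int n * \<omega>2" "l = of_int m' * \<omega>1 + of_int n' * \<omega>2"
    using assms latticeE by metis
  thus ?thesis using latticeI[of "m + m'" "n + n'"] by (simp add: algebra_simps)
qed

lemma lattice_uminus:
  assumes "l \<in> \<Lambda>" shows "- l \<in> \<Lambda>"
proof -
  obtain m n where "l = of_int m * \<omega>1 + of_int n * \<omega>2" using latticeE[OF assms] .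
  thus ?thesis using latticeI[of "- m" "- n"] by simp
qed

lemma lattice_diff: "k \<in> \<Lambda> \<Longrightarrow> l \<in> \<Lambda> \<Longrightarrow> k - l \<in> \<Lambda>"
  using lattice_add[of k "- l"] lattice_uminus by simp

lemma lattice_of_nat_mult: "l \<in> \<Lambda> \<Longrightarrow> of_nat n * l \<in> \<Lambda>"
  by (induction n) (auto simp: algebra_simps lattice_add)

text \<open>Factors of automorphy compose under sums and negatives, so quasi-periodicity has to be
  computed for the two basis vectors only.\<close>

lemma lattice_induct [consumes 1, case_names \<omega>1 \<omega>2 add uminus]:
  assumes "l \<in> \<Lambda>" "P \<omega>1" "P \<omega>2"
    and add: "\<And>k l. k \<in> \<Lambda> \<Longrightarrow> l \<in> \<Lambda> \<Longrightarrow> P k \<Longrightarrow> P l \<Longrightarrow> P (k + l)"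
    and uminus: "\<And>k. k \<in> \<Lambda> \<Longrightarrow> P k \<Longrightarrow> P (- k)"
  shows "P l"
proof -
  have P0: "P 0"
    using add[OF lattice_\<omega>1 lattice_uminus[OF lattice_\<omega>1] assms(2) uminus[OF lattice_\<omega>1 assms(2)]] by simp
  have nat: "P (of_nat n * k)" if "k \<in> \<Lambda>" "P k" for n k
    by (induction n) (use P0 add that lattice_of_nat_mult in \<open>auto simp: algebra_simps\<close>)
  have int: "P (of_int n * k)" if "k \<in> \<Lambda>" "P k" for n k
  proof (cases "n \<ge> 0")
    case True
    thus ?thesis using nat[OF that, of "nat n"] by simp
  next
    case False
    thus ?thesis
      using uminus[OF lattice_of_nat_mult nat, OF that(1) that, of "nat (- n)"] by simp
  qed
  have mem: "of_int n * k \<in> \<Lambda>" if "k = \<omega>1 \<or> k = \<omega>2" for n k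
    using that latticeI[of n 0] latticeI[of 0 n] by auto
  obtain m n where "l = of_int m * \<omega>1 + of_int n * \<omega>2" using latticeE[OF assms(1)] .
  thus ?thesis
    using add[OF mem mem int int, of \<omega>1 \<omega>2 m n] lattice_\<omega>1 lattice_\<omega>2 assms(2,3) by simp
qed

definition covol :: real where "covol = Im (cnj \<omega>1 * \<omega>2)"

lemma covol_pos: "covol > 0"
  unfolding covol_def by (rule oriented)

lemma \<omega>1_nz: "\<omega>1 \<noteq> 0" and \<omega>2_nz: "\<omega>2 \<noteq> 0"
  using oriented by auto

text \<open>Cramer's rule: the real linear form \<open>Im (cnj \<omega> * z)\<close> vanishes on the
  real multiples of \<omega>.\<close>

lemma real_coords:
  "z = of_real (- Im (cnj \<omega>2 * z) / covol) * \<omega>1 + of_real (Im (cnj \<omega>1 * z) / covol) * \<omega>2"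
proof -
  have "of_real covol * z = of_real (- Im (cnj \<omega>2 * z)) * \<omega>1 + of_real (Im (cnj \<omega>1 * z)) * \<omega>2"
    by (simp add: complex_eq_iff covol_def algebra_simps)
  hence "z = (of_real (- Im (cnj \<omega>2 * z)) * \<omega>1 + of_real (Im (cnj \<omega>1 * z)) * \<omega>2) / of_real covol"
    using covol_pos by (simp add: field_simps)
  also have "\<dots> = of_real (- Im (cnj \<omega>2 * z) / covol) * \<omega>1 + of_real (Im (cnj \<omega>1 * z) / covol) * \<omega>2"
    by (simp only: of_real_divide times_divide_eq_left add_divide_distrib)
  finally show ?thesis .
qed

lemma lattice_discrete:
  obtains r where "r > 0" "\<And>l. l \<in> \<Lambda> \<Longrightarrow> norm l < r \<Longrightarrow> l = 0"
proof
  \<comment> \<open>By Cramer's rule each integer coordinate times \<open>covol\<close> is at most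
    \<open>norm l\<close> times the length of the other basis vector; below this radius both
    coordinates are less than 1 in absolute value.\<close>
  define r where "r = covol / (norm \<omega>1 + norm \<omega>2)"
  have n: "norm \<omega>1 > 0" "norm \<omega>2 > 0" using \<omega>1_nz \<omega>2_nz by auto
  thus "r > 0" using covol_pos by (simp add: r_def add_pos_pos)
  fix l assume l: "l \<in> \<Lambda>" "norm l < r"
  obtain a b where ab: "l = of_int a * \<omega>1 + of_int b * \<omega>2" using latticeE[OF l(1)] .
  have lt: "norm l * (norm \<omega>1 + norm \<omega>2) < covol"
    using l(2) n by (simp add: r_def pos_less_divide_eq add_pos_pos)
  have "of_int b * covol = Im (cnj \<omega>1 * l)"
    by (simp add: ab covol_def algebra_simps)
  hence "\<bar>of_int b\<bar> * covol \<le> norm \<omega>1 * norm l"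
    using abs_Im_le_cmod[of "cnj \<omega>1 * l"] covol_pos by (simp add: norm_mult abs_mult flip: \<open>of_int b * covol = _\<close>)
  also have "\<dots> < 1 * covol" using lt n by (simp add: algebra_simps) (smt (verit) mult_nonneg_nonneg norm_ge_zero)
  finally have b: "b = 0" using covol_pos by (simp add: mult_less_cancel_right)
  have "of_int a * covol = - Im (cnj \<omega>2 * l)"
    by (simp add: ab covol_def algebra_simps)
  hence "\<bar>of_int a\<bar> * covol \<le> norm \<omega>2 * norm l"
    using abs_Im_le_cmod[of "cnj \<omega>2 * l"] covol_pos by (metis abs_minus_cancel abs_mult abs_of_pos complex_mod_cnj norm_mult of_int_abs)
  also have "\<dots> < 1 * covol" using lt n by (simp add: algebra_simps) (smt (verit) mult_nonneg_nonneg norm_ge_zero)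
  finally have a: "a = 0" using covol_pos by (simp add: mult_less_cancel_right)
  show "l = 0" by (simp add: ab a b)
qed

section \<open>The group of cosets of the lattice\<close>

lemma proj_eq: "\<pi> z = (\<lambda>l. l + z) ` \<Lambda>"
  by (auto simp: ell_pr_def r_coset_def c_add_def)

lemma mem_proj: "w \<in> \<pi> z \<longleftrightarrow> w - z \<in> \<Lambda>"
  unfolding proj_eq by (auto simp: image_iff) (metis diff_add_cancel)

lemma proj_eq_iff: "\<pi> z = \<pi> w \<longleftrightarrow> w - z \<in> \<Lambda>"
proof
  assume "\<pi> z = \<pi> w"
  thus "w - z \<in> \<Lambda>" using mem_proj[of w w] mem_proj[of w z] by simp
next
  assume "w - z \<in> \<Lambda>"
  hence "v - z \<in> \<Lambda> \<longleftrightarrow> v - w \<in> \<Lambda>" for v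
    using lattice_add[of "v - w" "w - z"] lattice_diff[of "v - z" "w - z"] by auto
  thus "\<pi> z = \<pi> w" using mem_proj by blast
qed

lemma proj_add_lattice: "l \<in> \<Lambda> \<Longrightarrow> \<pi> (z + l) = \<pi> z"
  by (simp add: proj_eq_iff lattice_uminus)


lemma comm_group_c_add: "comm_group c_add"
  by (rule comm_groupI) (auto simp: c_add_def intro: exI[of _ "- _"])

lemma c_add_inv: "inv\<^bsub>c_add\<^esub> x = - x"
  by (rule group.inv_equality) (auto simp: c_add_def comm_group.axioms comm_group_c_add[unfolded c_add_def])

lemma lattice_normal: "\<Lambda> \<lhd> c_add"
proof (rule comm_group.subgroup_imp_normal[OF comm_group_c_add])
  show "subgroup \<Lambda> c_add"
  proof
    show "inv\<^bsub>c_add\<^esub> x \<in> \<Lambda>" if "x \<in> \<Lambda>" for x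
      using lattice_uminus[OF that] by (simp add: c_add_inv)
  qed (auto simp: c_add_def lattice_add)
qed

lemma ell_carrier: "carrier (ell \<Lambda>) = range \<pi>"
  by (auto simp: ell_def FactGroup_def RCOSETS_def ell_pr_def c_add_def)

lemma ell_one: "\<one>\<^bsub>ell \<Lambda>\<^esub> = \<pi> 0"
  by (simp add: ell_def FactGroup_def proj_eq)

lemma ell_mult: "\<pi> z \<otimes>\<^bsub>ell \<Lambda>\<^esub> \<pi> w = \<pi> (z + w)"
  using normal.rcos_sum[OF lattice_normal, of z w]
  by (simp add: ell_def FactGroup_def ell_pr_def) (simp add: c_add_def)

lemma ell_group: "group (ell \<Lambda>)"
  unfolding ell_def by (rule normal.factorgroup_is_group[OF lattice_normal])

lemma ell_inv: "inv\<^bsub>ell \<Lambda>\<^esub> \<pi> z = \<pi> (- z)"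
  by (rule group.inv_equality[OF ell_group]) (auto simp: ell_mult ell_one ell_carrier)

lemma ell_pow: "\<pi> z [^]\<^bsub>ell \<Lambda>\<^esub> (n::nat) = \<pi> (of_nat n * z)"
  by (induction n) (auto simp: ell_one ell_mult algebra_simps nat_pow_def)

section \<open>The theta function and its factor of automorphy\<close>

definition hcoef :: complex where "hcoef = of_real (pi / covol)"

text \<open>Legendre's relation with \<open>hcoef * cnj l\<close> in the role of the quasi-periods;
  it fixes \<open>hcoef\<close> and reflects that theta has one zero per period
  parallelogram.\<close>

lemma legendre: "hcoef * (cnj \<omega>1 * \<omega>2 - \<omega>1 * cnj \<omega>2) = 2 * pi * \<i>"
proof -
  have "cnj \<omega>1 * \<omega>2 - \<omega>1 * cnj \<omega>2 = 2 * \<i> * of_real covol"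
    by (simp add: complex_eq_iff covol_def)
  thus ?thesis using covol_pos by (simp add: hcoef_def)
qed

text \<open>
  The exponential of the quadratic form is chosen so that the factor of automorphy is
  antilinear in the lattice vector.
\<close>

definition theta :: "complex \<Rightarrow> complex" where
  "theta z = exp (hcoef * cnj \<omega>1 / (2 * \<omega>1) * z ^ 2) * theta_prod (\<omega>2 / \<omega>1) (z / \<omega>1)"

lemma Im_tau_pos: "Im (\<omega>2 / \<omega>1) > 0"
proof -
  have "\<omega>2 / \<omega>1 = (cnj \<omega>1 * \<omega>2) / of_real ((norm \<omega>1)\<^sup>2)"
    using \<omega>1_nz by (simp add: complex_norm_square field_simps del: of_real_power)
  thus ?thesis using \<omega>1_nz oriented by (simp del: of_real_power)
qed

lemma theta_holomorphic: "theta holomorphic_on UNIV"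
  unfolding theta_def
  by (intro holomorphic_on_mult
      holomorphic_on_compose_gen[OF _ theta_prod_holomorphic[OF Im_tau_pos], unfolded o_def])
     (use \<omega>1_nz in \<open>auto intro!: holomorphic_intros\<close>)

lemma theta_eq_0_iff: "theta z = 0 \<longleftrightarrow> z \<in> \<Lambda>"
proof -
  have "theta z = 0 \<longleftrightarrow> (\<exists>m n. z / \<omega>1 = of_int m + of_int n * (\<omega>2 / \<omega>1))"
    unfolding theta_def using theta_prod_eq_0_iff[OF Im_tau_pos] by simp
  also have "\<dots> \<longleftrightarrow> (\<exists>m n. z = of_int m * \<omega>1 + of_int n * \<omega>2)"
    using \<omega>1_nz by (simp add: field_simps)
  finally show ?thesis unfolding lattice_eq by blast
qed

lemma theta_simple_zero:
  obtains g where "g holomorphic_on UNIV" "g 0 \<noteq> 0" "\<And>z. theta z = z * g z"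
proof -
  obtain g where g: "g holomorphic_on UNIV" "g 0 \<noteq> 0"
    "\<And>z. theta_prod (\<omega>2 / \<omega>1) z = z * g z"
    using theta_prod_simple_zero[OF Im_tau_pos] by blast
  define h where "h z = exp (hcoef * cnj \<omega>1 / (2 * \<omega>1) * z ^ 2) * (g (z / \<omega>1) / \<omega>1)" for z
  have "h holomorphic_on UNIV"
    unfolding h_def
    by (intro holomorphic_on_mult holomorphic_on_divide
      holomorphic_on_compose_gen[OF _ g(1), unfolded o_def])
     (use \<omega>1_nz in \<open>auto intro!: holomorphic_intros\<close>)
  moreover have "h 0 \<noteq> 0" using g(2) \<omega>1_nz by (simp add: h_def)
  moreover have "theta z = z * h z" for z by (simp add: theta_def h_def g(3))
  ultimately show thesis using that by blast
qed

text \<open>For \<omega>1 the product is periodic, and the quadratic exponent was chosen to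
  contribute \<open>hcoef * cnj \<omega>1 * z\<close>. That \<omega>2 gives the same antilinear
  shape is Legendre's relation.\<close>

lemma theta_quasi_ex:
  assumes "l \<in> \<Lambda>"
  shows "\<exists>k. k \<noteq> 0 \<and> (\<forall>z. theta (z + l) = k * exp (hcoef * cnj l * z) * theta z)"
  using assms
proof (induction rule: lattice_induct)
  case \<omega>1
  let ?Q = "hcoef * cnj \<omega>1 / (2 * \<omega>1)"
  have "theta (z + \<omega>1) = exp (?Q * \<omega>1 ^ 2) * exp (hcoef * cnj \<omega>1 * z) * theta z" for z
  proof -
    have "?Q * (z + \<omega>1) ^ 2 = ?Q * \<omega>1 ^ 2 + hcoef * cnj \<omega>1 * z + ?Q * z ^ 2"
      using \<omega>1_nz by (simp add: field_simps power2_eq_square)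
    hence "exp (?Q * (z + \<omega>1) ^ 2) = exp (?Q * \<omega>1 ^ 2) * exp (hcoef * cnj \<omega>1 * z) * exp (?Q * z ^ 2)"
      by (simp only: exp_add)
    moreover have "(z + \<omega>1) / \<omega>1 = z / \<omega>1 + 1" using \<omega>1_nz by (simp add: field_simps)
    ultimately show ?thesis by (simp only: theta_def theta_prod_plus_one mult.assoc)
  qed
  thus ?case by (intro exI[of _ "exp (?Q * \<omega>1 ^ 2)"]) auto
next
  case \<omega>2
  let ?Q = "hcoef * cnj \<omega>1 / (2 * \<omega>1)"
  have leg: "hcoef * cnj \<omega>1 * \<omega>2 = 2 * pi * \<i> + hcoef * cnj \<omega>2 * \<omega>1"
    using legendre by (simp add: algebra_simps)
  have "theta (z + \<omega>2) = - exp (?Q * \<omega>2 ^ 2) * exp (hcoef * cnj \<omega>2 * z) * theta z" for z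
  proof -
    \<comment> \<open>The cross term of the quadratic exponent and the multiplier of the product
      combine; \<open>leg\<close> turns their sum into the required coefficient of
      \<open>z\<close>.\<close>
    have "2 * ?Q * \<omega>2 - 2 * pi * \<i> / \<omega>1 = hcoef * cnj \<omega>2"
      using \<omega>1_nz leg by (simp add: field_simps)
    hence "?Q * \<omega>2 ^ 2 + hcoef * cnj \<omega>2 * z + ?Q * z ^ 2 =
        ?Q * \<omega>2 ^ 2 + (2 * ?Q * \<omega>2 - 2 * pi * \<i> / \<omega>1) * z + ?Q * z ^ 2" by (simp only:)
    also have "\<dots> = ?Q * (z + \<omega>2) ^ 2 + - 2 * pi * \<i> * (z / \<omega>1)"
      using \<omega>1_nz by (simp add: field_simps power2_eq_square)
    finally have "exp (?Q * (z + \<omega>2) ^ 2) * exp (- 2 * pi * \<i> * (z / \<omega>1)) =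
        exp (?Q * \<omega>2 ^ 2) * exp (hcoef * cnj \<omega>2 * z) * exp (?Q * z ^ 2)"
      by (simp only: exp_add[symmetric])
    moreover have "theta (z + \<omega>2) = - (exp (?Q * (z + \<omega>2) ^ 2) * exp (- 2 * pi * \<i> * (z / \<omega>1))) *
        theta_prod (\<omega>2 / \<omega>1) (z / \<omega>1)"
      by (simp add: theta_def theta_prod_plus_tau[OF Im_tau_pos] add_divide_distrib)
    ultimately show ?thesis by (simp add: theta_def)
  qed
  thus ?case by (intro exI[of _ "- exp (?Q * \<omega>2 ^ 2)"]) auto
next
  case (add k l)
  obtain a where a: "a \<noteq> 0" "\<And>z. theta (z + k) = a * exp (hcoef * cnj k * z) * theta z" using add by blast
  obtain b where b: "b \<noteq> 0" "\<And>z. theta (z + l) = b * exp (hcoef * cnj l * z) * theta z" using add by blast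
  have "theta (z + (k + l)) = (a * b * exp (hcoef * cnj l * k)) * exp (hcoef * cnj (k + l) * z) * theta z" for z
    using b(2)[of "z + k"] a(2)[of z] by (simp add: algebra_simps exp_add)
  thus ?case using a(1) b(1) by (intro exI[of _ "a * b * exp (hcoef * cnj l * k)"]) auto
next
  case (uminus k)
  obtain a where a: "a \<noteq> 0" "\<And>z. theta (z + k) = a * exp (hcoef * cnj k * z) * theta z" using uminus by blast
  have "theta (z + - k) = (exp (hcoef * cnj k * k) / a) * exp (hcoef * cnj (- k) * z) * theta z" for z
    using a(1) a(2)[of "z - k"] by (simp add: algebra_simps exp_diff exp_add exp_minus field_simps)
  thus ?case using a(1) by (intro exI[of _ "exp (hcoef * cnj k * k) / a"]) auto
qed

text \<open>The constant is never evaluated. Only its cocycle relation \<open>kap_add\<close>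
  enters: it cancels in the polarisation and leaves an explicit exponential in the Poincare
  bundle.\<close>

definition kap :: "complex \<Rightarrow> complex" where
  "kap l = (SOME k. k \<noteq> 0 \<and> (\<forall>z. theta (z + l) = k * exp (hcoef * cnj l * z) * theta z))"

definition autf :: "complex \<Rightarrow> complex \<Rightarrow> complex" where
  "autf l z = kap l * exp (hcoef * cnj l * z)"

lemma kap_nz: "l \<in> \<Lambda> \<Longrightarrow> kap l \<noteq> 0"
  and theta_quasi: "l \<in> \<Lambda> \<Longrightarrow> theta (z + l) = autf l z * theta z"
  using someI_ex[OF theta_quasi_ex, of l] unfolding kap_def[symmetric] autf_def by auto

lemma autf_nz: "l \<in> \<Lambda> \<Longrightarrow> autf l z \<noteq> 0"
  by (simp add: autf_def kap_nz)

lemma nonlattice_point: obtains z where "z \<notin> \<Lambda>"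
proof -
  obtain r where r: "r > 0" "\<And>l. l \<in> \<Lambda> \<Longrightarrow> norm l < r \<Longrightarrow> l = 0"
    using lattice_discrete by blast
  have "of_real (r / 2) \<notin> \<Lambda>" using r(1) r(2)[of "of_real (r / 2)"] by auto
  thus thesis using that by blast
qed

text \<open>Shifting by \<open>k\<close> and then by \<open>l\<close> must agree with shifting by
  \<open>k + l\<close>; at a point off the lattice theta can be cancelled from the
  comparison.\<close>

lemma kap_add:
  assumes "k \<in> \<Lambda>" "l \<in> \<Lambda>"
  shows "kap (k + l) = kap k * kap l * exp (hcoef * cnj l * k)"
proof -
  obtain z where z: "z \<notin> \<Lambda>" using nonlattice_point .
  have "autf (k + l) z * theta z = autf l (z + k) * (autf k z * theta z)"
    using theta_quasi[OF lattice_add[OF assms], of z] theta_quasi[OF assms(2), of "z + k"]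
      theta_quasi[OF assms(1), of z] by (simp add: algebra_simps)
  hence "autf (k + l) z = autf l (z + k) * autf k z"
    using z theta_eq_0_iff by simp
  thus ?thesis by (simp add: autf_def algebra_simps exp_add)
qed

lemma kap_0: "kap 0 = 1"
  using kap_add[of 0 0] kap_nz[of 0] by simp

text \<open>The left side of \<open>kap_add\<close> is symmetric in \<open>k\<close> and
  \<open>l\<close>, so the right side is too. Equivalently, \<open>Im (cnj k * l)\<close> is an
  integral multiple of the covolume.\<close>

lemma exp_symmetric:
  assumes "k \<in> \<Lambda>" "l \<in> \<Lambda>"
  shows "exp (hcoef * cnj l * k) = exp (hcoef * cnj k * l)"
  using kap_add[OF assms] kap_add[OF assms(2,1)] kap_nz[OF assms(1)] kap_nz[OF assms(2)]
  by (simp add: add.commute)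

end

section \<open>A frame of the divisor module\<close>

definition lin1 :: "(complex \<Rightarrow> complex) set" where
  "lin1 = {\<lambda>u. a * u | a. True}"

definition lin2 :: "(complex \<times> complex \<Rightarrow> complex) set" where
  "lin2 = {\<lambda>(u, v). a * u + b * v | a b. True}"

definition lin3 :: "(complex \<times> complex \<times> complex \<Rightarrow> complex) set" where
  "lin3 = {\<lambda>(u, v, w). a * u + b * v + c * w | a b c. True}"

lemma chol_lin1: "chol lin1 z h \<longleftrightarrow> h field_differentiable at z"
  by (auto simp: chol_def lin1_def field_differentiable_def has_field_derivative_def)

lemma chol_lin1_analytic: "h analytic_on {z} \<Longrightarrow> chol lin1 z h"
  unfolding chol_lin1 by (rule analytic_on_imp_differentiable_at) auto

lemma chol_lin2: "chol lin2 p h \<longleftrightarrow> (\<exists>a b. (h has_derivative (\<lambda>(u, v). a * u + b * v)) (at p))"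
  unfolding chol_def lin2_def by blast

lemma chol_lin3:
  "chol lin3 p h \<longleftrightarrow> (\<exists>a b c. (h has_derivative (\<lambda>(u, v, w). a * u + b * v + c * w)) (at p))"
  unfolding chol_def lin3_def by blast

lemma hspace1: "hspace lin1 (\<lambda>U h. h holomorphic_on U)"
proof
  show "(\<lambda>_. 0) \<in> lin1" unfolding lin1_def by (intro CollectI exI[of _ 0]) auto
  show "(\<lambda>x. a * S x + b * T x) \<in> lin1" if ST: "S \<in> lin1" "T \<in> lin1" for S T a b
  proof -
    obtain c d where "S = (\<lambda>u. c * u)" "T = (\<lambda>u. d * u)" using ST by (auto simp: lin1_def)
    hence "(\<lambda>x. a * S x + b * T x) = (\<lambda>u. (a * c + b * d) * u)" by (auto simp: algebra_simps)
    thus ?thesis by (auto simp: lin1_def)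
  qed
  show "h holomorphic_on U \<longleftrightarrow> (\<forall>z\<in>U. chol lin1 z h)" if "open U" for U h
    unfolding holomorphic_on_def chol_lin1 using at_within_open[OF _ that] by metis
qed

lemma hspace2: "hspace lin2 holo2"
proof
  show "(\<lambda>_. 0) \<in> lin2"
    unfolding lin2_def by (intro CollectI exI[of _ 0]) auto
  show "(\<lambda>x. a * S x + b * T x) \<in> lin2" if ST: "S \<in> lin2" "T \<in> lin2" for S T a b
  proof -
    obtain c d c' d' where "S = (\<lambda>(u, v). c * u + d * v)" "T = (\<lambda>(u, v). c' * u + d' * v)"
      using ST unfolding lin2_def by blast
    hence "(\<lambda>x. a * S x + b * T x) = (\<lambda>(u, v). (a * c + b * c') * u + (a * d + b * d') * v)"
      by (auto simp: algebra_simps)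
    thus ?thesis unfolding lin2_def by blast
  qed
qed (simp add: holo2_def chol_lin2)

lemma hspace3: "hspace lin3 holo3"
proof
  show "(\<lambda>_. 0) \<in> lin3"
    unfolding lin3_def by (intro CollectI exI[of _ 0]) auto
  show "(\<lambda>x. a * S x + b * T x) \<in> lin3" if ST: "S \<in> lin3" "T \<in> lin3" for S T a b
  proof -
    obtain c d e c' d' e' where "S = (\<lambda>(u, v, w). c * u + d * v + e * w)"
      "T = (\<lambda>(u, v, w). c' * u + d' * v + e' * w)"
      using ST unfolding lin3_def by blast
    hence "(\<lambda>x. a * S x + b * T x) =
        (\<lambda>(u, v, w). (a * c + b * c') * u + (a * d + b * d') * v + (a * e + b * e') * w)"
      by (auto simp: algebra_simps)
    thus ?thesis unfolding lin3_def by blast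
  qed
qed (simp add: holo3_def chol_lin3)

context oriented_lattice
begin

section \<open>The fibres of the module of the origin in terms of theta\<close>

text \<open>
  Multiplication by \<open>theta\<close> trivialises \<open>\<O>(0)\<close> on the universal cover: the class of \<open>f\<close> in
  the fibre at \<open>z\<close> is determined by the value at \<open>z\<close> of the holomorphic extension \<open>G\<close> of
  \<open>f \<theta>\<close>.
\<close>

definition mgerm :: "(complex set \<Rightarrow> complex) \<Rightarrow> complex \<Rightarrow> (complex \<Rightarrow> complex) \<Rightarrow> bool" where
  "mgerm f z G \<longleftrightarrow> G analytic_on {z} \<and> (\<forall>\<^sub>F w in at z. f (\<pi> w) * theta w = G w)"

text \<open>A limit instead of the value of a chosen germ, so that \<open>mval f\<close> is a
  function of \<open>z\<close> alone; \<open>mval_eq\<close> identifies it with the value of any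
  germ.\<close>

definition mval :: "(complex set \<Rightarrow> complex) \<Rightarrow> complex \<Rightarrow> complex" where
  "mval f z = Lim (at z) (\<lambda>w. f (\<pi> w) * theta w)"

abbreviation odiv :: "complex set \<Rightarrow> int" where
  "odiv \<equiv> (\<lambda>x. if x = \<one>\<^bsub>ell \<Lambda>\<^esub> then 1 else 0)"

lemma proj_eq_one: "\<pi> z = \<one>\<^bsub>ell \<Lambda>\<^esub> \<longleftrightarrow> z \<in> \<Lambda>"
  unfolding ell_one proj_eq_iff using lattice_uminus[of z] lattice_uminus[of "- z"] by auto

text \<open>At a lattice point the simple zero at 0 is transported by quasi-periodicity; elsewhere
  theta itself is a unit.\<close>

lemma theta_local:
  obtains T where "T analytic_on {z}" "T z \<noteq> 0" "\<And>w. theta w = T w * (w - z) powi odiv (\<pi> z)"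
proof (cases "z \<in> \<Lambda>")
  case False
  thus thesis
    using that[of theta] theta_holomorphic theta_eq_0_iff proj_eq_one
    by (simp add: analytic_on_holomorphic) blast
next
  case True
  obtain g where g: "g holomorphic_on UNIV" "g 0 \<noteq> 0" "\<And>z. theta z = z * g z"
    using theta_simple_zero by blast
  define T where "T w = autf z (w - z) * g (w - z)" for w
  have "T holomorphic_on UNIV"
    unfolding T_def autf_def
    by (intro holomorphic_on_mult holomorphic_on_compose_gen[OF _ g(1), unfolded o_def])
      (auto intro!: holomorphic_intros)
  hence "T analytic_on {z}" using analytic_on_holomorphic by blast
  moreover have "T z \<noteq> 0" using autf_nz[OF True] g(2) by (simp add: T_def)
  moreover have "theta w = T w * (w - z) powi odiv (\<pi> z)" for w
    using theta_quasi[OF True, of "w - z"] g(3)[of "w - z"] True proj_eq_one by (simp add: T_def)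
  ultimately show thesis using that by blast
qed

text \<open>The two germs differ by the unit \<open>T\<close> of \<open>theta_local\<close>, so they
  vanish at \<open>z\<close> together. The predicate \<open>P\<close> covers three uses at once:
  stalks (no condition), congruence of sections (value zero) and generators (value nonzero).\<close>

lemma od_germ_iff_mgerm:
  "(\<exists>g. od_germ \<Lambda> odiv f z g \<and> P (g z = 0)) \<longleftrightarrow> (\<exists>G. mgerm f z G \<and> P (G z = 0))"
proof -
  obtain T where T: "T analytic_on {z}" "T z \<noteq> 0" "\<And>w. theta w = T w * (w - z) powi odiv (\<pi> z)"
    using theta_local by blast
  have ev: "\<forall>\<^sub>F w in at z. w \<noteq> z \<and> T w \<noteq> 0"
  proof -
    have "continuous (at z) T" using T(1) analytic_at_imp_isCont by blast
    hence "\<forall>\<^sub>F w in at z. T w \<noteq> 0" using T(2) by (simp add: continuous_at tendsto_imp_eventually_ne)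
    thus ?thesis by (simp add: eventually_conj_iff eventually_neq_at_within)
  qed
  show ?thesis
  proof
    assume "\<exists>g. od_germ \<Lambda> odiv f z g \<and> P (g z = 0)"
    then obtain g where g: "g analytic_on {z}" "P (g z = 0)"
      "\<forall>\<^sub>F w in at z. f (\<pi> w) = g w * (w - z) powi (- odiv (\<pi> z))"
      unfolding od_germ_def by blast
    have "\<forall>\<^sub>F w in at z. f (\<pi> w) * theta w = g w * T w"
      using g(3) ev by eventually_elim (auto simp: T(3) power_int_minus field_simps)
    moreover have "(\<lambda>w. g w * T w) analytic_on {z}" using g T by (intro analytic_intros)
    ultimately show "\<exists>G. mgerm f z G \<and> P (G z = 0)"
      using g(2) T(2) by (intro exI[of _ "\<lambda>w. g w * T w"]) (auto simp: mgerm_def)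
  next
    assume "\<exists>G. mgerm f z G \<and> P (G z = 0)"
    then obtain G where G: "G analytic_on {z}" "P (G z = 0)"
      "\<forall>\<^sub>F w in at z. f (\<pi> w) * theta w = G w"
      unfolding mgerm_def by blast
    have "\<forall>\<^sub>F w in at z. f (\<pi> w) = (G w / T w) * (w - z) powi (- odiv (\<pi> z))"
      using G(3) ev by eventually_elim (auto simp: T(3) power_int_minus field_simps)
    moreover have "(\<lambda>w. G w / T w) analytic_on {z}" using G T by (intro analytic_intros) auto
    ultimately show "\<exists>g. od_germ \<Lambda> odiv f z g \<and> P (g z = 0)"
      using G(2) T(2) by (intro exI[of _ "\<lambda>w. G w / T w"]) (auto simp: od_germ_def)
  qed
qed

lemma mval_eq:
  assumes "mgerm f z G"
  shows "mval f z = G z"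
proof -
  have "(G \<longlongrightarrow> G z) (at z)"
    using assms analytic_at_imp_isCont by (auto simp: mgerm_def isCont_def)
  hence "((\<lambda>w. f (\<pi> w) * theta w) \<longlongrightarrow> G z) (at z)"
    using assms by (subst tendsto_cong[where g = G]) (auto simp: mgerm_def)
  thus ?thesis unfolding mval_def by (intro tendsto_Lim) auto
qed

text \<open>One germ serves on a whole disc, which is what makes \<open>mval f\<close> holomorphic
  and not merely defined point by point.\<close>

lemma mgerm_nearby:
  assumes "mgerm f z G"
  obtains r where "r > 0" "\<And>w. w \<in> ball z r \<Longrightarrow> mgerm f w G"
proof -
  obtain r1 where r1: "r1 > 0" "G holomorphic_on ball z r1"
    using assms by (auto simp: mgerm_def analytic_on_def)
  obtain r2 where r2: "r2 > 0" "\<And>w. w \<noteq> z \<Longrightarrow> dist w z < r2 \<Longrightarrow> f (\<pi> w) * theta w = G w"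
    using assms by (auto simp: mgerm_def eventually_at)
  have "mgerm f w G" if w: "w \<in> ball z (min r1 r2)" for w
  proof (cases "w = z")
    case False
    have op: "open (ball z (min r1 r2) - {z})" by auto
    have "\<forall>\<^sub>F v in at w. v \<in> ball z (min r1 r2) - {z}"
      by (rule eventually_at_in_open'[OF op]) (use False w in auto)
    hence "\<forall>\<^sub>F v in at w. f (\<pi> v) * theta v = G v"
      by eventually_elim (use r2(2) in \<open>auto simp: dist_commute\<close>)
    moreover have "G analytic_on {w}"
      using r1(2) w analytic_on_open[of "ball z r1" G] analytic_on_subset[of G "ball z r1" "{w}"] by auto
    ultimately show ?thesis by (simp add: mgerm_def)
  qed (use assms in simp)
  thus thesis using that[of "min r1 r2"] r1(1) r2(1) by auto
qed

lemma mgerm_scale: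
  assumes "mgerm f z G" shows "mgerm (\<lambda>y. c * f y) z (\<lambda>w. c * G w)"
proof -
  have "\<forall>\<^sub>F w in at z. c * f (\<pi> w) * theta w = c * G w"
    using assms[unfolded mgerm_def, THEN conjunct2] by eventually_elim simp
  thus ?thesis using assms by (auto simp: mgerm_def intro!: analytic_intros)
qed

lemma mgerm_diff:
  assumes "mgerm f z F" "mgerm g z G" shows "mgerm (\<lambda>y. f y - g y) z (\<lambda>w. F w - G w)"
proof -
  have "\<forall>\<^sub>F w in at z. (f (\<pi> w) - g (\<pi> w)) * theta w = F w - G w"
    using assms[unfolded mgerm_def, THEN conjunct2] by eventually_elim (simp add: left_diff_distrib)
  thus ?thesis using assms by (auto simp: mgerm_def intro!: analytic_intros)
qed

lemma mgerm_translate: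
  assumes "mgerm f z G" "l \<in> \<Lambda>"
  shows "mgerm f (z + l) (\<lambda>w. autf l (w - l) * G (w - l))"
proof -
  have "G analytic_on {z}" using assms by (simp add: mgerm_def)
  hence "(G \<circ> (\<lambda>w. w - l)) analytic_on {z + l}"
    by (intro analytic_on_compose) (auto intro!: analytic_intros)
  moreover have "(\<lambda>w. autf l (w - l)) analytic_on {z + l}"
    unfolding autf_def by (auto intro!: analytic_intros)
  ultimately have "(\<lambda>w. autf l (w - l) * G (w - l)) analytic_on {z + l}"
    by (intro analytic_intros) (auto simp: o_def)
  moreover have "\<forall>\<^sub>F w in at (z + l). f (\<pi> w) * theta w = autf l (w - l) * G (w - l)"
  proof -
    have "\<forall>\<^sub>F w in at z. f (\<pi> (w + l)) * theta (w + l) = autf l w * G w"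
      using assms(1)[unfolded mgerm_def, THEN conjunct2]
      by eventually_elim (simp add: theta_quasi[OF assms(2)] proj_add_lattice[OF assms(2)] algebra_simps)
    thus ?thesis
      by (subst at_to_0) (simp add: at_to_0[of z] eventually_filtermap algebra_simps)
  qed
  ultimately show ?thesis by (simp add: mgerm_def)
qed

text \<open>Stalks and residue classes quantify over all lifts of a point. One lift suffices, since
  translation by a lattice vector multiplies the germ by the nonvanishing
  \<open>autf\<close>.\<close>

lemma mgerm_orbit:
  "(\<forall>w\<in>\<pi> z. \<exists>G. mgerm f w G \<and> P (G w = 0)) \<longleftrightarrow> (\<exists>G. mgerm f z G \<and> P (G z = 0))"
proof
  assume "\<exists>G. mgerm f z G \<and> P (G z = 0)"
  then obtain G where G: "mgerm f z G" "P (G z = 0)" by blast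
  show "\<forall>w\<in>\<pi> z. \<exists>G. mgerm f w G \<and> P (G w = 0)"
  proof
    fix w assume "w \<in> \<pi> z"
    hence l: "w - z \<in> \<Lambda>" by (simp add: mem_proj)
    show "\<exists>G. mgerm f w G \<and> P (G w = 0)"
      using mgerm_translate[OF G(1) l] G(2) autf_nz[OF l]
      by (intro exI[of _ "\<lambda>v. autf (w - z) (v - (w - z)) * G (v - (w - z))"]) auto
  qed
qed (simp add: mem_proj)

lemma od_stalk_iff: "f \<in> od_stalk \<Lambda> odiv (\<pi> z) \<longleftrightarrow> (\<exists>G. mgerm f z G)"
  using od_germ_iff_mgerm[of f _ "\<lambda>_. True"] mgerm_orbit[of z f "\<lambda>_. True"] by (simp add: od_stalk_def)

definition mclass :: "complex \<Rightarrow> complex \<Rightarrow> mfib" where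
  "mclass z a = {f \<in> od_stalk \<Lambda> odiv (\<pi> z). mval f z = a}"

text \<open>Congruence modulo the maximal ideal means that the germ of the difference vanishes, that
  is, equality of \<open>mval\<close>; this gives each fibre one complex coordinate.\<close>

lemma od_val_eq:
  assumes "f \<in> od_stalk \<Lambda> odiv (\<pi> z)"
  shows "od_val \<Lambda> odiv (\<pi> z) f = mclass z (mval f z)"
proof -
  obtain F where F: "mgerm f z F" using assms od_stalk_iff by blast
  have "(\<forall>w \<in> \<pi> z. \<exists>g. od_germ \<Lambda> odiv (\<lambda>y. f y - f' y) w g \<and> g w = 0) \<longleftrightarrow> mval f' z = mval f z"
    if f': "f' \<in> od_stalk \<Lambda> odiv (\<pi> z)" for f'
  proof -
    obtain F' where F': "mgerm f' z F'" using f' od_stalk_iff by blast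
    have "(\<forall>w \<in> \<pi> z. \<exists>g. od_germ \<Lambda> odiv (\<lambda>y. f y - f' y) w g \<and> g w = 0) \<longleftrightarrow>
        (\<exists>G. mgerm (\<lambda>y. f y - f' y) z G \<and> G z = 0)"
      using od_germ_iff_mgerm[of "\<lambda>y. f y - f' y" _ "\<lambda>p. p"]
        mgerm_orbit[of z "\<lambda>y. f y - f' y" "\<lambda>p. p"] by simp
    also have "\<dots> \<longleftrightarrow> mval f' z = mval f z"
    proof -
      have "mval (\<lambda>y. f y - f' y) z = F z - F' z"
        by (rule mval_eq[OF mgerm_diff[OF F F']])
      thus ?thesis using mval_eq[OF F] mval_eq[OF F'] mval_eq mgerm_diff[OF F F'] by fastforce
    qed
    finally show ?thesis .
  qed
  thus ?thesis by (auto simp: od_val_def mclass_def)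
qed

lemma mval_scale:
  assumes "f \<in> od_stalk \<Lambda> odiv (\<pi> z)"
  shows "(\<lambda>y. c * f y) \<in> od_stalk \<Lambda> odiv (\<pi> z)" "mval (\<lambda>y. c * f y) z = c * mval f z"
proof -
  obtain F where F: "mgerm f z F" using assms od_stalk_iff by blast
  show "(\<lambda>y. c * f y) \<in> od_stalk \<Lambda> odiv (\<pi> z)" "mval (\<lambda>y. c * f y) z = c * mval f z"
    using mgerm_scale[OF F] mval_eq[OF mgerm_scale[OF F]] mval_eq[OF F] by (auto simp: od_stalk_iff)
qed

lemma local_section:
  obtains \<rho> \<sigma> where "\<rho> > 0" "\<And>l. l \<in> \<Lambda> \<Longrightarrow> norm l < 4 * \<rho> \<Longrightarrow> l = 0"
    "\<And>w. norm w < \<rho> \<Longrightarrow> \<sigma> (\<pi> w) = w" "opn (ell1 \<Lambda>) (\<pi> ` ball 0 \<rho>)"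
proof -
  obtain r where r: "r > 0" "\<And>l. l \<in> \<Lambda> \<Longrightarrow> norm l < r \<Longrightarrow> l = 0"
    using lattice_discrete by blast
  \<comment> \<open>Injectivity on the disc needs only \<open>2 * \<rho>\<close>; the larger bound
    leaves room for the three terms \<open>g z + g w - g (z + w)\<close> when endomorphisms are
    linearised.\<close>
  define \<rho> where "\<rho> = r / 4"
  define \<sigma> where "\<sigma> y = (SOME w. w \<in> y \<and> norm w < \<rho>)" for y :: "complex set"
  have \<sigma>: "\<sigma> (\<pi> w) = w" if "norm w < \<rho>" for w
    unfolding \<sigma>_def
  proof (rule some_equality)
    fix v assume v: "v \<in> \<pi> w \<and> norm v < \<rho>"
    hence "norm (v - w) < r" using norm_triangle_ineq4[of v w] that r(1) by (simp add: \<rho>_def)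
    thus "v = w" using r(2)[of "v - w"] v by (simp add: mem_proj)
  qed (use that in \<open>simp add: mem_proj\<close>)
  have "\<pi> -` (\<pi> ` ball 0 \<rho>) = (\<Union>l\<in>\<Lambda>. ball l \<rho>)"
  proof (intro equalityI subsetI)
    fix w assume "w \<in> \<pi> -` (\<pi> ` ball 0 \<rho>)"
    then obtain v where v: "\<pi> w = \<pi> v" "norm v < \<rho>" by auto
    hence "w - v \<in> \<Lambda>" using proj_eq_iff by metis
    moreover have "w \<in> ball (w - v) \<rho>" using v(2) by (simp add: dist_norm)
    ultimately show "w \<in> (\<Union>l\<in>\<Lambda>. ball l \<rho>)" by blast
  next
    fix w assume "w \<in> (\<Union>l\<in>\<Lambda>. ball l \<rho>)"
    then obtain l where l: "l \<in> \<Lambda>" "norm (w - l) < \<rho>" by (auto simp: dist_norm norm_minus_commute)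
    hence "\<pi> w = \<pi> (w - l)" using proj_add_lattice[of l "w - l"] by simp
    thus "w \<in> \<pi> -` (\<pi> ` ball 0 \<rho>)" using l(2) by auto
  qed
  hence "opn (ell1 \<Lambda>) (\<pi> ` ball 0 \<rho>)" by (auto simp: ell1_def quot_space_def)
  thus thesis using that[of \<rho> \<sigma>] r \<sigma> by (simp add: \<rho>_def)
qed

text \<open>Away from the origin the constant 1 generates the module; near the origin a function
  with a simple pole does, and the local inverse of the projection provides one.\<close>

lemma od_local_generator:
  obtains U f where "opn (ell1 \<Lambda>) U" "\<pi> z \<in> U" "\<And>w. \<pi> w \<in> U \<Longrightarrow> \<exists>G. mgerm f w G \<and> G w \<noteq> 0"
proof (cases "z \<in> \<Lambda>")
  case False
  let ?U = "range \<pi> - {\<pi> 0}"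
  have "\<pi> -` ?U = - (theta -` {0})"
    using proj_eq_one theta_eq_0_iff by (auto simp: ell_one)
  moreover have "closed (theta -` {0})"
    using theta_holomorphic
    by (intro continuous_closed_vimage)
      (auto simp: continuous_on_eq_continuous_at dest: holomorphic_on_imp_continuous_on)
  ultimately have "opn (ell1 \<Lambda>) ?U" by (auto simp: ell1_def quot_space_def)
  moreover have "\<exists>G. mgerm (\<lambda>_. 1) w G \<and> G w \<noteq> 0" if "\<pi> w \<in> ?U" for w
    using that theta_holomorphic theta_eq_0_iff proj_eq_one
    by (intro exI[of _ theta]) (auto simp: mgerm_def analytic_on_holomorphic ell_one)
  ultimately show thesis using that[of ?U "\<lambda>_. 1"] False proj_eq_one by (auto simp: ell_one)
next
  case True
  obtain \<rho> \<sigma> where \<rho>: "\<rho> > 0" "\<And>l. l \<in> \<Lambda> \<Longrightarrow> norm l < 4 * \<rho> \<Longrightarrow> l = 0"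
    "\<And>w. norm w < \<rho> \<Longrightarrow> \<sigma> (\<pi> w) = w" "opn (ell1 \<Lambda>) (\<pi> ` ball 0 \<rho>)"
    using local_section by blast
  obtain g where g: "g holomorphic_on UNIV" "g 0 \<noteq> 0" "\<And>z. theta z = z * g z"
    using theta_simple_zero by blast
  \<comment> \<open>In the coordinate \<sigma> this is \<open>1 / w\<close>, so multiplication by
    theta leaves the cofactor \<open>g\<close> of the simple zero.\<close>
  define f where "f y = 1 / \<sigma> y" for y
  let ?U = "\<pi> ` ball 0 \<rho>"
  have "\<exists>G. mgerm f w G \<and> G w \<noteq> 0" if w: "\<pi> w \<in> ?U" for w
  proof -
    obtain v where v: "\<pi> w = \<pi> v" "norm v < \<rho>" using w by auto
    have "\<forall>\<^sub>F u in at v. u \<in> ball 0 \<rho>"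
      by (rule eventually_at_in_open') (use v(2) in auto)
    moreover have "\<forall>\<^sub>F u in at v. u \<noteq> 0" by (rule eventually_neq_at_within)
    ultimately have "\<forall>\<^sub>F u in at v. f (\<pi> u) * theta u = g u"
      by eventually_elim (simp add: f_def \<rho>(3) g(3))
    hence "mgerm f v g" using g(1) by (auto simp: mgerm_def analytic_on_holomorphic)
    moreover have "g v \<noteq> 0"
    proof (cases "v = 0")
      case False
      hence "theta v \<noteq> 0" using \<rho>(1) \<rho>(2)[of v] v(2) theta_eq_0_iff by auto
      thus ?thesis by (simp add: g(3))
    qed (use g(2) in simp)
    ultimately show ?thesis
      using mgerm_orbit[of v f Not] v(1)[symmetric] mem_proj[of w w] by auto
  qed
  thus thesis using that[of ?U f] \<rho>(1,4) True proj_eq_iff[of z 0] lattice_uminus by auto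
qed

text \<open>The value at \<open>z\<close> of the section \<open>1 / theta\<close> of the pulled-back
  module, which explains why its multipliers are inverse to those of theta.\<close>

definition mframe :: "complex \<Rightarrow> mfib" where
  "mframe z = mclass z 1"

lemma mval_exists: obtains f where "f \<in> od_stalk \<Lambda> odiv (\<pi> z)" "mval f z = a"
proof -
  obtain U f where f: "\<pi> z \<in> U" "\<And>w. \<pi> w \<in> U \<Longrightarrow> \<exists>G. mgerm f w G \<and> G w \<noteq> 0"
    using od_local_generator by metis
  then obtain G where G: "mgerm f z G" "G z \<noteq> 0" by blast
  have st: "f \<in> od_stalk \<Lambda> odiv (\<pi> z)" using G od_stalk_iff by blast
  show thesis
    using that[of "\<lambda>y. (a / G z) * f y"] mval_scale[OF st, of "a / G z"] mval_eq[OF G(1)] G(2) by simp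
qed

lemma mclass_inj: "mclass z a = mclass z b \<longleftrightarrow> a = b"
proof
  assume eq: "mclass z a = mclass z b"
  obtain f where f: "f \<in> od_stalk \<Lambda> odiv (\<pi> z)" "mval f z = a" using mval_exists .
  hence "f \<in> mclass z b" using eq by (auto simp: mclass_def)
  thus "a = b" using f by (simp add: mclass_def)
qed simp

lemma scl_mclass: "scl (fib (M_bundle \<Lambda>) (\<pi> z)) c (mclass z a) = mclass z (c * a)"
proof -
  have "od_val \<Lambda> odiv (\<pi> z) (\<lambda>y. c * f y) = mclass z (c * a)" if "f \<in> mclass z a" for f
    using that mval_scale[of f z c] od_val_eq by (simp add: mclass_def)
  moreover obtain f where "f \<in> mclass z a" using mval_exists[of z a] by (auto simp: mclass_def)
  ultimately have "(\<Union>f\<in>mclass z a. od_val \<Lambda> odiv (\<pi> z) (\<lambda>y. c * f y)) = mclass z (c * a)"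
    by blast
  thus ?thesis by (simp add: M_bundle_def od_bundle_def od_fib_def)
qed

lemma vecs_M: "vecs (fib (M_bundle \<Lambda>) (\<pi> z)) = range (mclass z)"
proof -
  have "vecs (fib (M_bundle \<Lambda>) (\<pi> z)) = od_val \<Lambda> odiv (\<pi> z) ` od_stalk \<Lambda> odiv (\<pi> z)"
    by (simp add: M_bundle_def od_bundle_def od_fib_def)
  also have "\<dots> = (\<lambda>f. mclass z (mval f z)) ` od_stalk \<Lambda> odiv (\<pi> z)"
    by (rule image_cong[OF refl od_val_eq])
  also have "\<dots> = range (mclass z)"
  proof (intro equalityI subsetI)
    fix A assume "A \<in> range (mclass z)"
    then obtain a where "A = mclass z a" by blast
    thus "A \<in> (\<lambda>f. mclass z (mval f z)) ` od_stalk \<Lambda> odiv (\<pi> z)"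
      using mval_exists[of z a] by blast
  qed auto
  finally show ?thesis .
qed

lemma M_line: "is_line (fib (M_bundle \<Lambda>) (\<pi> z))"
  and mframe_basis: "line_basis (fib (M_bundle \<Lambda>) (\<pi> z)) (mframe z)"
proof -
  show b: "line_basis (fib (M_bundle \<Lambda>) (\<pi> z)) (mframe z)"
    unfolding line_basis_def bij_betw_def mframe_def scl_mclass vecs_M
    by (auto intro!: injI simp: mclass_inj)
  show "is_line (fib (M_bundle \<Lambda>) (\<pi> z))"
    unfolding is_line_def using b by (auto simp: vecs_M scl_mclass mult.assoc)
qed

text \<open>A local generator \<open>f\<close> has coefficient \<open>mval f\<close> with respect to
  \<open>mframe\<close>, and on a disc around any point this agrees with an analytic germ of
  \<open>f\<close> times theta.\<close>

lemma mframe_lframe: "lframe \<pi> lin1 (M_bundle \<Lambda>) mframe"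
  unfolding lframe_def
proof (intro conjI allI ballI)
  have frames: "frames (M_bundle \<Lambda>) = {(U, \<lambda>x. od_val \<Lambda> odiv x f) | U f. opn (ell1 \<Lambda>) U \<and>
      (\<forall>w. \<pi> w \<in> U \<longrightarrow> (\<exists>G. mgerm f w G \<and> G w \<noteq> 0))}"
  proof -
    have "(\<forall>x\<in>U. \<forall>z\<in>x. \<exists>g. od_germ \<Lambda> odiv f z g \<and> g z \<noteq> 0) \<longleftrightarrow>
        (\<forall>w. \<pi> w \<in> U \<longrightarrow> (\<exists>G. mgerm f w G \<and> G w \<noteq> 0))" if "opn (ell1 \<Lambda>) U" for U f
    proof -
      have U: "U \<subseteq> range \<pi>" using that by (simp add: ell1_def quot_space_def)
      have "(\<forall>x\<in>U. \<forall>z\<in>x. \<exists>g. od_germ \<Lambda> odiv f z g \<and> g z \<noteq> 0) \<longleftrightarrow>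
          (\<forall>w. \<pi> w \<in> U \<longrightarrow> (\<forall>z\<in>\<pi> w. \<exists>g. od_germ \<Lambda> odiv f z g \<and> g z \<noteq> 0))"
        using U by blast
      thus ?thesis
        using od_germ_iff_mgerm[of f _ Not] mgerm_orbit[of _ f Not] by simp
    qed
    thus ?thesis unfolding M_bundle_def od_bundle_def by auto
  qed
  show "(\<Union>(U, e) \<in> frames (M_bundle \<Lambda>). U) = range \<pi>"
  proof (intro equalityI subsetI)
    fix x assume "x \<in> range \<pi>"
    then obtain z where x: "x = \<pi> z" by blast
    obtain U f where "opn (ell1 \<Lambda>) U" "\<pi> z \<in> U" "\<And>w. \<pi> w \<in> U \<Longrightarrow> \<exists>G. mgerm f w G \<and> G w \<noteq> 0"
      using od_local_generator[of z] by blast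
    hence "(U, \<lambda>x. od_val \<Lambda> odiv x f) \<in> frames (M_bundle \<Lambda>)" "x \<in> U" unfolding frames x by blast+
    thus "x \<in> (\<Union>(U, e) \<in> frames (M_bundle \<Lambda>). U)" by blast
  qed (auto simp: frames ell1_def quot_space_def)
  fix Ue assume "Ue \<in> frames (M_bundle \<Lambda>)"
  then obtain U f where Ue: "Ue = (U, \<lambda>x. od_val \<Lambda> odiv x f)" and U: "opn (ell1 \<Lambda>) U"
    "\<And>w. \<pi> w \<in> U \<Longrightarrow> \<exists>G. mgerm f w G \<and> G w \<noteq> 0" unfolding frames by blast
  have "chol lin1 z (mval f) \<and> mval f z \<noteq> 0 \<and>
      od_val \<Lambda> odiv (\<pi> z) f = scl (fib (M_bundle \<Lambda>) (\<pi> z)) (mval f z) (mframe z)"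
    if z: "\<pi> z \<in> U" for z
  proof -
    obtain G where G: "mgerm f z G" "G z \<noteq> 0" using U(2)[OF z] by blast
    obtain r where r: "r > 0" "\<And>w. w \<in> ball z r \<Longrightarrow> mgerm f w G" using mgerm_nearby[OF G(1)] by blast
    have "chol lin1 z G" using G(1) chol_lin1_analytic by (simp add: mgerm_def)
    moreover have "G w = mval f w" if "w \<in> ball z r" for w
      using mval_eq[OF r(2)[OF that]] by simp
    ultimately have "chol lin1 z (mval f)"
      using chol_cong[of "ball z r" z G "mval f"] r(1) by auto
    moreover have "od_val \<Lambda> odiv (\<pi> z) f = mclass z (mval f z)"
      using od_val_eq od_stalk_iff G(1) by blast
    ultimately show ?thesis using mval_eq[OF G(1)] G(2) by (simp add: mframe_def scl_mclass)
  qed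
  thus "case Ue of (U, e) \<Rightarrow> open (\<pi> -` U) \<and>
      (\<exists>g. \<forall>z \<in> \<pi> -` U. chol lin1 z g \<and> g z \<noteq> 0 \<and>
        e (\<pi> z) = scl (fib (M_bundle \<Lambda>) (\<pi> z)) (g z) (mframe z))"
    unfolding Ue using U(1) by (auto simp: ell1_def quot_space_def)
qed (use M_line mframe_basis in auto)

lemma mframe_mults: "mults \<pi> (M_bundle \<Lambda>) mframe (\<lambda>z z'. 1 / autf (z' - z) z)"
  unfolding mults_def
proof (intro allI impI)
  fix z z' assume eq: "\<pi> z = \<pi> z'"
  hence l: "z' - z \<in> \<Lambda>" by (simp add: proj_eq_iff)
  have "mval f z' = autf (z' - z) z * mval f z" if "f \<in> od_stalk \<Lambda> odiv (\<pi> z)" for f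
  proof -
    obtain G where G: "mgerm f z G" using \<open>f \<in> _\<close> od_stalk_iff by blast
    show ?thesis using mval_eq[OF mgerm_translate[OF G l]] mval_eq[OF G] by simp
  qed
  hence "mclass z' 1 = mclass z (1 / autf (z' - z) z)"
    using autf_nz[OF l, of z] by (auto simp: mclass_def eq[symmetric] field_simps)
  thus "mframe z' = scl (fib (M_bundle \<Lambda>) (\<pi> z)) (1 / autf (z' - z) z) (mframe z)"
    by (simp add: mframe_def scl_mclass)
qed

end

section \<open>The Poincare bundle and its group law\<close>

lemma lframe_cong:
  assumes "lframe q K L s" "\<And>z. s z = s' z"
  shows "lframe q K L s'"
proof -
  have "s = s'" by (rule ext) (rule assms(2))
  thus ?thesis using assms(1) by simp
qed

lemma mults_cong:
  assumes "mults q L s \<mu>" "\<And>z. s z = s' z" "\<And>z z'. q z = q z' \<Longrightarrow> \<mu> z z' = \<mu>' z z'"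
  shows "mults q L s' \<mu>'"
  using assms unfolding mults_def by metis

text \<open>The case of a linear lift, which is its own derivative. The translation in the
  polarisation is only affine and uses \<open>lframe_pull\<close> directly.\<close>

lemma pull_lframe_mults:
  assumes s: "lframe q' K' L s" "mults q' L s \<mu>" and X: "pts X = range q"
    and f: "\<And>z. f (q z) = q' (F z)"
    and F: "\<And>z. (F has_derivative F) (at z)"
    and K: "\<And>T. T \<in> K' \<Longrightarrow> T \<circ> F \<in> K"
  shows "lframe q K (pull X f L) (\<lambda>z. s (F z))"
    and "mults q (pull X f L) (\<lambda>z. s (F z)) (\<lambda>z z'. \<mu> (F z) (F z'))"
  using lframe_pull[OF s(1) X f F K] mults_pull[of q' L s \<mu> f q F X, OF s(2) f] by (simp_all add: o_def)

section \<open>Liouville's theorem on the curve, its square and its cube\<close>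

context oriented_lattice
begin

lemma fundamental_domain: "\<exists>l\<in>\<Lambda>. norm (z - l) \<le> norm \<omega>1 + norm \<omega>2"
proof -
  define a where "a = - Im (cnj \<omega>2 * z) / covol"
  define b where "b = Im (cnj \<omega>1 * z) / covol"
  have z: "z = of_real a * \<omega>1 + of_real b * \<omega>2"
    unfolding a_def b_def by (rule real_coords)
  let ?l = "of_int \<lfloor>a\<rfloor> * \<omega>1 + of_int \<lfloor>b\<rfloor> * \<omega>2"
  have "z - ?l = of_real (frac a) * \<omega>1 + of_real (frac b) * \<omega>2"
    by (simp add: z frac_def algebra_simps)
  hence "norm (z - ?l) \<le> norm (of_real (frac a) * \<omega>1) + norm (of_real (frac b) * \<omega>2)"
    by (simp only: norm_triangle_ineq)
  also have "\<dots> \<le> 1 * norm \<omega>1 + 1 * norm \<omega>2"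
    unfolding norm_mult by (intro add_mono mult_right_mono) (auto simp: frac_lt_1 less_imp_le)
  finally show ?thesis using latticeI by (intro bexI[of _ ?l]) auto
qed

text \<open>Every value is already attained on a compact disc containing a fundamental
  parallelogram, so the function is entire and bounded.\<close>

lemma periodic_const1:
  assumes t: "\<And>z. chol lin1 z t" and per: "\<And>z z'. \<pi> z = \<pi> z' \<Longrightarrow> t z = t z'"
  shows "t z = t z'"
proof -
  have hol: "t holomorphic_on UNIV"
    using t by (simp add: holomorphic_on_def chol_lin1)
  have "compact (t ` cball 0 (norm \<omega>1 + norm \<omega>2))"
    by (intro compact_continuous_image holomorphic_on_imp_continuous_on)
       (use hol holomorphic_on_subset in auto)
  moreover have "range t \<subseteq> t ` cball 0 (norm \<omega>1 + norm \<omega>2)"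
  proof
    fix y assume "y \<in> range t"
    then obtain z where y: "y = t z" by blast
    obtain l where l: "l \<in> \<Lambda>" "norm (z - l) \<le> norm \<omega>1 + norm \<omega>2" using fundamental_domain by blast
    have "t z = t (z - l)" by (rule per) (simp add: proj_eq_iff lattice_uminus l(1))
    thus "y \<in> t ` cball 0 (norm \<omega>1 + norm \<omega>2)" using l(2) by (auto simp: y)
  qed
  ultimately have "bounded (range t)" using bounded_subset compact_imp_bounded by blast
  then obtain c where "\<And>z. t z = c" using Liouville_theorem[OF hol] by (auto simp: constant_on_def)
  thus ?thesis by simp
qed

abbreviation "proj2 \<equiv> map_prod \<pi> \<pi>"

abbreviation "proj3 \<equiv> map_prod \<pi> proj2"

text \<open>The restrictions to the lines parallel to the axes are periodic in one variable, hence
  constant; moving along one axis and then the other reaches the origin.\<close>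

lemma periodic_const2:
  assumes t: "\<And>p. chol lin2 p t" and per: "\<And>p p'. proj2 p = proj2 p' \<Longrightarrow> t p = t p'"
  shows "t p = t p'"
proof -
  have right: "chol lin1 w (t \<circ> (\<lambda>w. (z, w)))" for z w
    by (rule chol_comp[OF t, where F' = "\<lambda>u. (0, u)"])
       (auto simp: lin1_def lin2_def o_def intro!: derivative_eq_intros)
  have left: "chol lin1 z (t \<circ> (\<lambda>z. (z, w)))" for z w
    by (rule chol_comp[OF t, where F' = "\<lambda>u. (u, 0)"])
       (auto simp: lin1_def lin2_def o_def intro!: derivative_eq_intros)
  have "t (z, w) = t (0, 0)" for z w
    using periodic_const1[OF right, of z w 0] periodic_const1[OF left, of 0 z 0] per by simp
  thus ?thesis by (metis surj_pair)
qed

lemma periodic_const3: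
  assumes t: "\<And>p. chol lin3 p t" and per: "\<And>p p'. proj3 p = proj3 p' \<Longrightarrow> t p = t p'"
  shows "t p = t p'"
proof -
  have right: "chol lin2 p (t \<circ> (\<lambda>p. (z, p)))" for z p
  proof (rule chol_comp[OF t, where F' = "\<lambda>u. (0, u)"])
    show "((\<lambda>p. (z, p)) has_derivative (\<lambda>u. (0, u))) (at p)"
      by (auto intro!: derivative_eq_intros)
    fix T assume "T \<in> lin3"
    then obtain a b c where "T = (\<lambda>(u, v, w). a * u + b * v + c * w)" unfolding lin3_def by blast
    hence "T \<circ> (\<lambda>u. (0, u)) = (\<lambda>(v, w). b * v + c * w)" by auto
    thus "T \<circ> (\<lambda>u. (0, u)) \<in> lin2" unfolding lin2_def by blast
  qed
  have left: "chol lin1 z (t \<circ> (\<lambda>z. (z, p)))" for z p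
    by (rule chol_comp[OF t, where F' = "\<lambda>u. (u, 0)"])
       (auto simp: lin1_def lin3_def o_def zero_prod_def intro!: derivative_eq_intros)
  have "t (z, p) = t (0, 0)" for z p
    using periodic_const2[OF right, of z p 0] periodic_const1[OF left, of 0 z 0] per by simp
  thus ?thesis by (metis surj_pair)
qed

lemma liouville1: "liouville \<pi> lin1"
  unfolding liouville_def using periodic_const1 by blast

lemma liouville3: "liouville proj3 lin3"
  unfolding liouville_def using periodic_const3 by blast

lemma pts1: "pts (ell1 \<Lambda>) = range \<pi>" and pts2: "pts (ell2 \<Lambda>) = range proj2"
  and pts3: "pts (ell3 \<Lambda>) = range proj3"
  by (simp_all add: ell1_def ell2_def ell3_def quot_space_def)

section \<open>The frame of the Poincare bundle and the isomorphism of the cube\<close>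

definition pframe :: "complex \<times> complex \<Rightarrow> lfib" where
  "pframe = (\<lambda>(z, w). let M = (\<lambda>z. fib (M_bundle \<Lambda>) (\<pi> z));
      AB = tensor_line (M (z + w)) (dual_line (M z)); ABC = tensor_line AB (dual_line (M w)) in
    tens ABC (M 0) (tens AB (dual_line (M w))
      (tens (M (z + w)) (dual_line (M z)) (mframe (z + w)) (dual_vec (M z) (mframe z)))
      (dual_vec (M w) (mframe w))) (mframe 0))"

definition pmult :: "complex \<times> complex \<Rightarrow> complex \<times> complex \<Rightarrow> complex" where
  "pmult = (\<lambda>(z, w) (z', w').
     exp (- hcoef * (cnj (w' - w) * z + cnj (z' - z) * w + cnj (w' - w) * (z' - z))))"

text \<open>Each of the four tensor factors contributes a factor \<open>autf\<close> or its inverse.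
  The constants of the two lattice vectors cancel; the last summand in \<open>pmult\<close> is the
  defect of multiplicativity of \<open>kap\<close> from \<open>kap_add\<close>.\<close>

lemma
  shows pframe_lframe: "lframe proj2 lin2 (poincare_bundle \<Lambda>) pframe"
    and pframe_mults: "mults proj2 (poincare_bundle \<Lambda>) pframe pmult"
proof -
  note M = mframe_lframe mframe_mults
  note D = hspace.lframe_dual[OF hspace1 M(1)] hspace.mults_dual[OF hspace1 M]
  let ?P = "\<lambda>f N. pull (ell2 \<Lambda>) f N"
  let ?dual = "\<lambda>z. dual_vec (fib (M_bundle \<Lambda>) (\<pi> z)) (mframe z)"
  have d: "((\<lambda>p::complex \<times> complex. fst p + snd p) has_derivative (\<lambda>p. fst p + snd p)) (at p)"
    "(fst has_derivative fst) (at p)" "(snd has_derivative snd) (at p)"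
    "((\<lambda>p. 0) has_derivative (\<lambda>p. 0)) (at p)" for p :: "complex \<times> complex"
    by (auto intro!: derivative_eq_intros)
  have K: "T \<circ> (\<lambda>p. fst p + snd p) \<in> lin2" "T \<circ> fst \<in> lin2" "T \<circ> snd \<in> lin2" "T \<circ> (\<lambda>p. 0) \<in> lin2"
    if "T \<in> lin1" for T
  proof -
    obtain a where T: "T = (\<lambda>u. a * u)" using \<open>T \<in> lin1\<close> unfolding lin1_def by blast
    have "T \<circ> (\<lambda>p. fst p + snd p) = (\<lambda>(u, v). a * u + a * v)" "T \<circ> fst = (\<lambda>(u, v). a * u + 0 * v)"
      "T \<circ> snd = (\<lambda>(u, v). 0 * u + a * v)" "T \<circ> (\<lambda>p. 0) = (\<lambda>(u, v). 0 * u + 0 * v)"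
      by (auto simp: T algebra_simps)
    thus "T \<circ> (\<lambda>p. fst p + snd p) \<in> lin2" "T \<circ> fst \<in> lin2" "T \<circ> snd \<in> lin2" "T \<circ> (\<lambda>p. 0) \<in> lin2"
      unfolding lin2_def by blast+
  qed
  have e: "(case proj2 p of (x, y) \<Rightarrow> x \<otimes>\<^bsub>ell \<Lambda>\<^esub> y) = \<pi> (fst p + snd p)"
    "fst (proj2 p) = \<pi> (fst p)" "snd (proj2 p) = \<pi> (snd p)" "\<one>\<^bsub>ell \<Lambda>\<^esub> = \<pi> 0" for p
    by (cases p, simp add: ell_mult ell_one)+
  note A = pull_lframe_mults[OF M pts2 e(1) d(1) K(1)]
  note B = pull_lframe_mults[OF D pts2 e(2) d(2) K(2)]
  note C = pull_lframe_mults[OF D pts2 e(3) d(3) K(3)]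
  note O = pull_lframe_mults[OF M pts2 e(4) d(4) K(4)]
  note AB = hspace.lframe_tensor[OF hspace2 A(1) B(1)] hspace.mults_tensor[OF hspace2 A B]
  note ABC = hspace.lframe_tensor[OF hspace2 AB(1) C(1)] hspace.mults_tensor[OF hspace2 AB C]
  note L = hspace.lframe_tensor[OF hspace2 ABC(1) O(1)] hspace.mults_tensor[OF hspace2 ABC O]
  note L' = L[folded poincare_bundle_def]
  show "lframe proj2 lin2 (poincare_bundle \<Lambda>) pframe"
    by (rule lframe_cong[OF L'(1)])
      (auto simp: pframe_def tensor_bundle_def pull_def dual_bundle_def Let_def ell_mult ell_one)
  show "mults proj2 (poincare_bundle \<Lambda>) pframe pmult"
  proof (rule mults_cong[OF L'(2)])
    fix p p' :: "complex \<times> complex" assume "proj2 p = proj2 p'"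
    then obtain z w z' w' where p: "p = (z, w)" "p' = (z', w')" "z' - z \<in> \<Lambda>" "w' - w \<in> \<Lambda>"
      by (cases p; cases p') (auto simp: proj_eq_iff)
    have "autf (z' + w' - (z + w)) (z + w) = autf (z' - z) z * autf (w' - w) w *
        exp (hcoef * (cnj (w' - w) * z + cnj (z' - z) * w + cnj (w' - w) * (z' - z)))"
    proof -
      have "kap (z' + w' - (z + w)) = kap (z' - z) * kap (w' - w) * exp (hcoef * cnj (w' - w) * (z' - z))"
        using kap_add[OF p(3,4)] by (simp add: algebra_simps)
      thus ?thesis by (simp add: autf_def algebra_simps flip: exp_add)
    qed
    moreover have "autf (0 - 0) 0 = 1" by (simp add: autf_def kap_0)
    moreover have "pmult p p' =
        1 / exp (hcoef * (cnj (w' - w) * z + cnj (z' - z) * w + cnj (w' - w) * (z' - z)))"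
      by (simp only: pmult_def p(1,2) prod.case mult_minus_left exp_minus inverse_eq_divide)
    ultimately show "1 / autf (fst p' + snd p' - (fst p + snd p)) (fst p + snd p) *
        (1 / (1 / autf (fst p' - fst p) (fst p))) * (1 / (1 / autf (snd p' - snd p) (snd p))) *
        (1 / autf (0 - 0) 0) = pmult p p'"
      using autf_nz[OF p(3), of z] autf_nz[OF p(4), of w]
      by (simp only: p(1,2) fst_conv snd_conv) simp
  qed (auto simp: pframe_def tensor_bundle_def pull_def dual_bundle_def Let_def ell_mult ell_one)
qed

lemma fib_L: "is_line (fib (poincare_bundle \<Lambda>) (\<pi> z, \<pi> w))"
  and pframe_basis: "line_basis (fib (poincare_bundle \<Lambda>) (\<pi> z, \<pi> w)) (pframe (z, w))"
  using lframe_line[OF pframe_lframe, of "(z, w)"] lframe_basis[OF pframe_lframe, of "(z, w)"] by simp_all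

text \<open>Rescaling a basis rescales its dual vector inversely, so the tensor does not depend on
  the bases and \<open>THE\<close> is meaningful; the bases \<open>mframe z\<close> and
  \<open>mframe 0\<close> give the frame at \<open>w = 0\<close>.\<close>

lemma poincare_unit_eq: "poincare_unit \<Lambda> (\<pi> z) = pframe (z, 0)"
proof -
  let ?A = "fib (M_bundle \<Lambda>) (\<pi> z)" and ?B = "fib (M_bundle \<Lambda>) (\<pi> 0)"
  let ?AA = "tensor_line ?A (dual_line ?A)"
  let ?AAB = "tensor_line ?AA (dual_line ?B)"
  let ?T = "\<lambda>m n. tens ?AAB ?B (tens ?AA (dual_line ?B) (tens ?A (dual_line ?A) m (dual_vec ?A m)) (dual_vec ?B n)) n"
  note A = M_line[of z] mframe_basis[of z] and B = M_line[of 0] mframe_basis[of 0]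
  note A' = dual_line_basis[OF A] and B' = dual_line_basis[OF B]
  note AA = tensor_line_basis[OF A A']
  note AAB = tensor_line_basis[OF AA B']
  have uniq: "?T m n = pframe (z, 0)" if m: "line_basis ?A m" and n: "line_basis ?B n" for m n
  proof -
    obtain c where c: "m = scl ?A c (mframe z)" using line_basis_obtain[OF A(2) line_basis_mem[OF m]] .
    obtain d where d: "n = scl ?B d (mframe 0)" using line_basis_obtain[OF B(2) line_basis_mem[OF n]] .
    have cd: "c \<noteq> 0" "d \<noteq> 0" using m n line_basis_scl_iff[OF A] line_basis_scl_iff[OF B] c d by auto
    have 1: "tens ?A (dual_line ?A) m (dual_vec ?A m) =
        scl ?AA 1 (tens ?A (dual_line ?A) (mframe z) (dual_vec ?A (mframe z)))"
      unfolding c dual_vec_scl_basis[OF A cd(1)]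
      by (subst tens_scl_scl[OF A(1) A'(1) line_basis_mem[OF A(2)] line_basis_mem[OF A'(2)]]) (simp add: cd)
    have 2: "tens ?AA (dual_line ?B) (tens ?A (dual_line ?A) m (dual_vec ?A m)) (dual_vec ?B n) =
        scl ?AAB (1 / d) (tens ?AA (dual_line ?B)
          (tens ?A (dual_line ?A) (mframe z) (dual_vec ?A (mframe z))) (dual_vec ?B (mframe 0)))"
      unfolding 1 d dual_vec_scl_basis[OF B cd(2)]
      by (subst tens_scl_scl[OF AA(1) B'(1) line_basis_mem[OF AA(2)] line_basis_mem[OF B'(2)]]) simp
    have "?T m n = tens ?AAB ?B (scl ?AAB (1 / d) (tens ?AA (dual_line ?B)
          (tens ?A (dual_line ?A) (mframe z) (dual_vec ?A (mframe z))) (dual_vec ?B (mframe 0))))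
        (scl ?B d (mframe 0))"
      unfolding 2 by (simp only: d[symmetric])
    also have "\<dots> = scl (tensor_line ?AAB ?B) 1 (?T (mframe z) (mframe 0))"
      by (subst tens_scl_scl[OF AAB(1) B(1) line_basis_mem[OF AAB(2)] line_basis_mem[OF B(2)]]) (simp add: cd)
    also have "\<dots> = ?T (mframe z) (mframe 0)"
      by (rule line_basis_scl_one[OF tensor_line_basis[OF AAB B]])
    finally show ?thesis by (simp add: pframe_def Let_def)
  qed
  show ?thesis
    unfolding poincare_unit_def Let_def ell_one
  proof (rule the_equality)
    show "\<exists>m n. line_basis ?A m \<and> line_basis ?B n \<and> pframe (z, 0) = ?T m n"
      using uniq[OF A(2) B(2), symmetric] A(2) B(2) by blast
  next
    fix u assume "\<exists>m n. line_basis ?A m \<and> line_basis ?B n \<and> u = ?T m n"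
    thus "u = pframe (z, 0)" using uniq by blast
  qed
qed

text \<open>The canonical isomorphism is normalised only at the origin of the cube, where
  \<open>poincare_unit\<close> is the frame at \<open>(0, 0)\<close>; \<open>the_bundle_iso\<close>
  spreads the normalisation to all points.\<close>

lemma
  shows cube_iso_iso: "cube_iso \<Lambda> (\<pi> z, \<pi> w, \<pi> v) \<in> line_isos
      (tensor_line (fib (poincare_bundle \<Lambda>) (\<pi> z, \<pi> w)) (fib (poincare_bundle \<Lambda>) (\<pi> z, \<pi> v)))
      (fib (poincare_bundle \<Lambda>) (\<pi> z, \<pi> (w + v)))"
    and cube_iso_frame: "cube_iso \<Lambda> (\<pi> z, \<pi> w, \<pi> v)
      (tens (fib (poincare_bundle \<Lambda>) (\<pi> z, \<pi> w)) (fib (poincare_bundle \<Lambda>) (\<pi> z, \<pi> v))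
        (pframe (z, w)) (pframe (z, v))) = pframe (z, w + v)"
proof -
  let ?L = "poincare_bundle \<Lambda>"
  define F12 F13 F1s :: "complex \<times> complex \<times> complex \<Rightarrow> complex \<times> complex"
    where F: "F12 = (\<lambda>(z, w, v). (z, w))" "F13 = (\<lambda>(z, w, v). (z, v))" "F1s = (\<lambda>(z, w, v). (z, w + v))"
  define f12 f13 f1s :: "complex set \<times> complex set \<times> complex set \<Rightarrow> complex set \<times> complex set"
    where f: "f12 = (\<lambda>(x, y, z). (x, y))" "f13 = (\<lambda>(x, y, z). (x, z))"
      "f1s = (\<lambda>(x, y, z). (x, y \<otimes>\<^bsub>ell \<Lambda>\<^esub> z))"
  have d: "(F12 has_derivative F12) (at p)" "(F13 has_derivative F13) (at p)" "(F1s has_derivative F1s) (at p)" for p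
    unfolding F case_prod_unfold by (auto intro!: derivative_eq_intros)
  have K: "T \<circ> F12 \<in> lin3" "T \<circ> F13 \<in> lin3" "T \<circ> F1s \<in> lin3" if "T \<in> lin2" for T
  proof -
    obtain a b where T: "T = (\<lambda>(u, v). a * u + b * v)" using \<open>T \<in> lin2\<close> unfolding lin2_def by blast
    have "T \<circ> F12 = (\<lambda>(u, v, w). a * u + b * v + 0 * w)" "T \<circ> F13 = (\<lambda>(u, v, w). a * u + 0 * v + b * w)"
      "T \<circ> F1s = (\<lambda>(u, v, w). a * u + b * v + b * w)"
      by (auto simp: T F algebra_simps)
    thus "T \<circ> F12 \<in> lin3" "T \<circ> F13 \<in> lin3" "T \<circ> F1s \<in> lin3" unfolding lin3_def by blast+
  qed
  have e: "f12 (proj3 p) = proj2 (F12 p)" "f13 (proj3 p) = proj2 (F13 p)" "f1s (proj3 p) = proj2 (F1s p)" for p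
    by (auto simp: f F ell_mult split: prod.splits)
  note P = pframe_lframe pframe_mults
  note A = pull_lframe_mults[OF P pts3 e(1) d(1) K(1)]
  note B = pull_lframe_mults[OF P pts3 e(2) d(2) K(2)]
  note S = pull_lframe_mults[OF P pts3 e(3) d(3) K(3)]
  note AB = hspace.lframe_tensor[OF hspace3 A(1) B(1)] hspace.mults_tensor[OF hspace3 A B]
  let ?k = "cube_iso \<Lambda>"
  let ?AB = "tensor_bundle (pull (ell3 \<Lambda>) f12 ?L) (pull (ell3 \<Lambda>) f13 ?L)"
  let ?S = "pull (ell3 \<Lambda>) f1s ?L"
  \<comment> \<open>For fixed first coordinates the exponent of \<open>pmult\<close> is additive in
    the second ones, so the two sides have the same multipliers.\<close>
  have m: "mults proj3 ?S (\<lambda>p. pframe (F1s p)) (\<lambda>p p'. pmult (F12 p) (F12 p') * pmult (F13 p) (F13 p'))"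
    by (rule mults_cong[OF S(2) refl])
      (auto simp: pmult_def F algebra_simps simp flip: exp_add)
  have base: "base ?AB = quot_space proj3 holo3"
    by (simp add: tensor_bundle_def pull_def ell3_def)
  note T = hspace.the_bundle_iso[OF hspace3 liouville3 AB base S(1) m, where ?z0.0 = "(0, 0, 0)"]
  have k: "?k = (THE k. k \<in> bundle_isos ?AB ?S \<and> k (proj3 (0, 0, 0))
      (tens (fib (pull (ell3 \<Lambda>) f12 ?L) (proj3 (0, 0, 0))) (fib (pull (ell3 \<Lambda>) f13 ?L) (proj3 (0, 0, 0)))
        (pframe (F12 (0, 0, 0))) (pframe (F13 (0, 0, 0)))) = pframe (F1s (0, 0, 0)))"
    by (simp add: cube_iso_def Let_def f F ell_one poincare_unit_eq pull_def)
  have "?k \<in> bundle_isos ?AB ?S" unfolding k by (rule T(1))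
  hence "?k \<in> (\<Pi>\<^sub>E p \<in> range proj3. line_isos (fib ?AB p) (fib ?S p))"
    by (simp add: bundle_isos_def base quot_space_def)
  hence "?k (proj3 (z, w, v)) \<in> line_isos (fib ?AB (proj3 (z, w, v))) (fib ?S (proj3 (z, w, v)))"
    by (rule PiE_mem) (rule rangeI)
  thus "?k (\<pi> z, \<pi> w, \<pi> v) \<in> line_isos (tensor_line (fib ?L (\<pi> z, \<pi> w)) (fib ?L (\<pi> z, \<pi> v)))
      (fib ?L (\<pi> z, \<pi> (w + v)))"
    by (simp add: tensor_bundle_def pull_def f ell_mult)
  have "?k (proj3 (z, w, v)) (tens (fib (pull (ell3 \<Lambda>) f12 ?L) (proj3 (z, w, v)))
      (fib (pull (ell3 \<Lambda>) f13 ?L) (proj3 (z, w, v))) (pframe (F12 (z, w, v))) (pframe (F13 (z, w, v)))) =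
      pframe (F1s (z, w, v))"
    unfolding k by (rule T(2))
  thus "?k (\<pi> z, \<pi> w, \<pi> v) (tens (fib ?L (\<pi> z, \<pi> w)) (fib ?L (\<pi> z, \<pi> v)) (pframe (z, w)) (pframe (z, v))) =
      pframe (z, w + v)"
    by (simp add: pull_def f F)
qed

section \<open>Coordinates on the group over a point of the curve\<close>

definition pelem :: "complex \<Rightarrow> complex \<Rightarrow> complex \<Rightarrow> complex set \<times> (complex \<Rightarrow> lfib)" where
  "pelem z w s = (\<pi> w, \<lambda>c. scl (fib (poincare_bundle \<Lambda>) (\<pi> z, \<pi> w)) (c * s) (pframe (z, w)))"

lemma pelem_carrier:
  assumes "s \<noteq> 0"
  shows "pelem z w s \<in> carrier (poincare_group \<Lambda> (\<pi> z))"
proof -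
  let ?V = "fib (poincare_bundle \<Lambda>) (\<pi> z, \<pi> w)"
  note V = fib_L[of z w] pframe_basis[of z w]
  have b: "line_basis ?V (scl ?V s (pframe (z, w)))" using line_basis_scl_iff[OF V] assms by simp
  have "(\<lambda>c. scl ?V c (scl ?V s (pframe (z, w)))) \<in> line_isos c_line ?V"
    using b is_line_scl_scl[OF V(1) line_basis_mem[OF b]] line_basis_scl_mem[OF b]
    by (auto simp: line_isos_def c_line_def line_basis_def PiE_def extensional_def)
  thus ?thesis
    using is_line_scl_scl[OF V(1) line_basis_mem[OF V(2)]]
    by (simp add: poincare_group_def pelem_def poincare_torsor_def ell_carrier)
qed

text \<open>With \<open>pelem z w s\<close> standing for \<open>s\<close> times the frame over
  \<open>w\<close>, the group law becomes addition in \<open>w\<close> and multiplication in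
  \<open>s\<close>, because the cube isomorphism takes frames to frames.\<close>

lemma pelem_mult:
  "pelem z w s \<otimes>\<^bsub>poincare_group \<Lambda> (\<pi> z)\<^esub> pelem z v t = pelem z (w + v) (s * t)"
proof -
  let ?L = "\<lambda>w. fib (poincare_bundle \<Lambda>) (\<pi> z, \<pi> w)"
  have "cube_iso \<Lambda> (\<pi> z, \<pi> w, \<pi> v) (tens (?L w) (?L v)
      (scl (?L w) (c * s) (pframe (z, w))) (scl (?L v) (1 * t) (pframe (z, v)))) =
      scl (?L (w + v)) (c * (s * t)) (pframe (z, w + v))" for c
  proof -
    note W = fib_L[of z w] pframe_basis[of z w] and V = fib_L[of z v] pframe_basis[of z v]
    have "tens (?L w) (?L v) (scl (?L w) (c * s) (pframe (z, w))) (scl (?L v) (1 * t) (pframe (z, v))) =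
        scl (tensor_line (?L w) (?L v)) (c * (s * t)) (tens (?L w) (?L v) (pframe (z, w)) (pframe (z, v)))"
      using tens_scl_scl[OF W(1) V(1) line_basis_mem[OF W(2)] line_basis_mem[OF V(2)]]
      by (simp add: mult.assoc)
    thus ?thesis
      using cube_iso_iso[of z w v] cube_iso_frame[of z w v]
        line_basis_mem[OF tensor_line_basis(2)[OF W V]] by (simp add: line_isos_def)
  qed
  thus ?thesis by (simp add: poincare_group_def pelem_def ell_mult)
qed

lemma pelem_one: "\<one>\<^bsub>poincare_group \<Lambda> (\<pi> z)\<^esub> = pelem z 0 1"
  by (simp add: poincare_group_def pelem_def ell_one poincare_unit_eq)

lemma pelem_pow:
  "pelem z w s [^]\<^bsub>poincare_group \<Lambda> (\<pi> z)\<^esub> (n::nat) = pelem z (of_nat n * w) (s ^ n)"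
proof (induction n)
  case 0
  show ?case by (simp add: nat_pow_def pelem_one)
next
  case (Suc n)
  have "pelem z w s [^]\<^bsub>poincare_group \<Lambda> (\<pi> z)\<^esub> Suc n =
      pelem z (of_nat n * w) (s ^ n) \<otimes>\<^bsub>poincare_group \<Lambda> (\<pi> z)\<^esub> pelem z w s"
    using Suc by (simp add: nat_pow_def)
  also have "\<dots> = pelem z (of_nat (Suc n) * w) (s ^ Suc n)"
    unfolding pelem_mult by (simp add: algebra_simps)
  finally show ?case .
qed

text \<open>The relations that present the group as a quotient of these coordinates: moving
  \<open>w\<close> by a lattice vector costs the multiplier of the frame in its second
  variable.\<close>

lemma pelem_lattice:
  assumes "w \<in> \<Lambda>"
  shows "pelem z w s = pelem z 0 (s * exp (- hcoef * cnj w * z))"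
proof -
  have \<pi>: "\<pi> 0 = \<pi> w" using assms by (simp add: proj_eq_iff)
  have "pframe (z, w) = scl (fib (poincare_bundle \<Lambda>) (\<pi> z, \<pi> 0)) (exp (- hcoef * cnj w * z)) (pframe (z, 0))"
    using multsD[OF pframe_mults, of "(z, 0)" "(z, w)"] \<pi> by (simp add: pmult_def algebra_simps)
  thus ?thesis
    using is_line_scl_scl[OF fib_L[of z 0] line_basis_mem[OF pframe_basis[of z 0]]]
    by (simp add: pelem_def \<pi>[symmetric] mult.assoc)
qed

end

section \<open>Polarisation, Rosati involution and the Ribet section\<close>

context oriented_lattice
begin

text \<open>Near 0 the map has a holomorphic lift \<open>g\<close>, which is additive up to a small
  lattice vector, hence additive. Its derivative is then constant, so \<open>g\<close> is linear;
  divisibility of points carries the formula to the whole plane.\<close>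

lemma ell_End_linear:
  assumes "\<phi> \<in> ell_End \<Lambda>"
  obtains c where "\<And>z. \<phi> (\<pi> z) = \<pi> (c * z)"
proof -
  have hom: "\<phi> \<in> hom (ell \<Lambda>) (ell \<Lambda>)" and map: "holo_map (ell1 \<Lambda>) (ell1 \<Lambda>) \<phi>"
    using assms by (auto simp: ell_End_def)
  have rng: "\<phi> (\<pi> z) \<in> range \<pi>" for z
    using hom by (auto simp: hom_def ell_carrier)
  have add: "\<phi> (\<pi> (z + w)) = \<phi> (\<pi> z) \<otimes>\<^bsub>ell \<Lambda>\<^esub> \<phi> (\<pi> w)" for z w
    using hom by (auto simp: hom_def ell_carrier ell_mult[symmetric])
  have zero: "\<phi> (\<pi> 0) = \<pi> 0"
    using group_hom.hom_one[of "ell \<Lambda>" "ell \<Lambda>" \<phi>] hom ell_group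
    by (simp add: group_hom_def group_hom_axioms_def ell_one)
  obtain \<rho> \<sigma> where \<rho>: "\<rho> > 0" "\<And>l. l \<in> \<Lambda> \<Longrightarrow> norm l < 4 * \<rho> \<Longrightarrow> l = 0"
    "\<And>w. norm w < \<rho> \<Longrightarrow> \<sigma> (\<pi> w) = w" "opn (ell1 \<Lambda>) (\<pi> ` ball 0 \<rho>)"
    using local_section by blast
  let ?U = "\<pi> ` ball 0 \<rho>"
  define W where "W = \<pi> -` (\<phi> -` ?U \<inter> range \<pi>)"
  define g where "g z = \<sigma> (\<phi> (\<pi> z))" for z
  have opU: "open (\<pi> -` ?U)" using \<rho>(4) by (simp add: ell1_def quot_space_def)
  \<comment> \<open>\<open>holo_map\<close> acts on holomorphic functions of the quotient. Applied
    to the chart \<sigma> it shows that the lift \<open>g\<close> is holomorphic.\<close>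
  have "hol (ell1 \<Lambda>) ?U \<sigma>"
    unfolding ell1_def
  proof (rule hspace.hol_quot[OF hspace1 opU, of "\<sigma> \<circ> \<pi>"])
    fix z assume "\<pi> z \<in> ?U"
    then obtain v where v: "\<pi> z = \<pi> v" "norm v < \<rho>" by auto
    have l: "z - v \<in> \<Lambda>" using v(1) proj_eq_iff by metis
    have "((\<lambda>w. w - (z - v)) has_field_derivative 1) (at z)" by (auto intro!: derivative_eq_intros)
    hence "((\<sigma> \<circ> \<pi>) has_field_derivative 1) (at z)"
    proof (rule has_field_derivative_transform_within_open)
      show "open (ball (z - v) \<rho>)" "z \<in> ball (z - v) \<rho>" using v(2) by (auto simp: dist_norm)
      fix w assume "w \<in> ball (z - v) \<rho>"
      hence "norm (w - (z - v)) < \<rho>" by (simp add: dist_norm norm_minus_commute)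
      thus "w - (z - v) = (\<sigma> \<circ> \<pi>) w"
        using \<rho>(3) proj_add_lattice[OF l, of "w - (z - v)"] by simp
    qed
    thus "chol lin1 z (\<sigma> \<circ> \<pi>)" by (auto simp: chol_lin1 field_differentiable_def)
  qed simp
  hence "opn (ell1 \<Lambda>) (\<phi> -` ?U \<inter> range \<pi>) \<and> hol (ell1 \<Lambda>) (\<phi> -` ?U \<inter> range \<pi>) (\<sigma> \<circ> \<phi>)"
    using map \<rho>(4) by (simp add: holo_map_def pts1)
  hence W: "open W" and gW: "g holomorphic_on W"
    by (simp_all add: ell1_def quot_space_def W_def g_def[abs_def] o_def)
  have g: "\<pi> (g z) = \<phi> (\<pi> z)" "norm (g z) < \<rho>" if z: "z \<in> W" for z
  proof -
    obtain v where "\<phi> (\<pi> z) = \<pi> v" "norm v < \<rho>" using z by (auto simp: W_def)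
    thus "\<pi> (g z) = \<phi> (\<pi> z)" "norm (g z) < \<rho>" using \<rho>(3) by (auto simp: g_def)
  qed
  have "0 \<in> W" using \<rho>(1) by (auto simp: W_def zero)
  then obtain e where e: "e > 0" "ball 0 e \<subseteq> W" using W openE by blast
  \<comment> \<open>Half the radius keeps \<open>z + w\<close> in the domain of \<open>g\<close>
    when both summands are shorter than \<open>d\<close>.\<close>
  define d where "d = e / 2"
  have d: "d > 0" using e by (simp add: d_def)
  have dW: "z \<in> W" if "norm z < d" for z
    using that e by (auto simp: d_def)
  have gadd: "g (z + w) = g z + g w" if zw: "norm z < d" "norm w < d" for z w
  proof -
    have W3: "z \<in> W" "w \<in> W" "z + w \<in> W"
      using dW zw e norm_triangle_ineq[of z w] by (auto simp: d_def)
    have "\<pi> (g (z + w)) = \<pi> (g z + g w)"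
      using g(1)[OF W3(1)] g(1)[OF W3(2)] g(1)[OF W3(3)] add[of z w] by (simp add: ell_mult[symmetric])
    hence "g z + g w - g (z + w) \<in> \<Lambda>" by (simp add: proj_eq_iff)
    moreover have "norm (g z + g w - g (z + w)) < 4 * \<rho>"
      using g(2)[OF W3(1)] g(2)[OF W3(2)] g(2)[OF W3(3)] \<rho>(1)
        norm_triangle_ineq[of "g z" "g w"] norm_triangle_ineq4[of "g z + g w" "g (z + w)"] by linarith
    ultimately show ?thesis using \<rho>(2) by fastforce
  qed
  define c where "c = deriv g 0"
  have gder: "(g has_field_derivative c) (at z)" if z: "norm z < d" for z
  proof -
    have der: "(g has_field_derivative deriv g w) (at w)" if "w \<in> W" for w
      using holomorphic_derivI[OF gW W that] by blast
    have "((\<lambda>w. g (z + w)) has_field_derivative deriv g z) (at 0)"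
      using der[OF dW[OF z]] DERIV_shift[of g "deriv g z" 0 z] by (simp add: add.commute)
    moreover have "((\<lambda>w. g (z + w)) has_field_derivative c) (at 0)"
    proof (rule has_field_derivative_transform_within_open)
      show "((\<lambda>w. g z + g w) has_field_derivative c) (at 0)"
        using der[OF \<open>0 \<in> W\<close>] by (auto simp: c_def intro!: derivative_eq_intros)
      show "g z + g w = g (z + w)" if "w \<in> ball 0 d" for w
        using gadd[OF z, of w] that by simp
    qed (use d in auto)
    ultimately have "deriv g z = c" using DERIV_unique by blast
    thus ?thesis using der[OF dW[OF z]] by simp
  qed
  have g0: "g 0 = 0" using gadd[of 0 0] d by simp
  have glin: "g z = c * z" if "norm z < d" for z
  proof -
    have "((\<lambda>w. g w - c * w) has_field_derivative 0) (at w within ball 0 d)" if "w \<in> ball 0 d" for w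
    proof -
      have "((\<lambda>w. g w - c * w) has_field_derivative (c - c * 1)) (at w)"
        using that by (intro DERIV_diff DERIV_cmult DERIV_ident gder) auto
      thus ?thesis by (simp add: has_field_derivative_at_within)
    qed
    hence "\<exists>k. \<forall>w\<in>ball 0 d. g w - c * w = k"
      by (intro has_field_derivative_zero_constant) auto
    then obtain k where "\<And>w. w \<in> ball 0 d \<Longrightarrow> g w - c * w = k" by blast
    from this[of 0] this[of z] show ?thesis using d that g0 by simp
  qed
  have mult: "\<phi> (\<pi> (of_nat n * w)) = \<pi> (of_nat n * (c * w))" if "\<phi> (\<pi> w) = \<pi> (c * w)" for n w
    by (induction n) (use that in \<open>auto simp: zero add ell_mult algebra_simps\<close>)
  have "\<phi> (\<pi> z) = \<pi> (c * z)" for z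
  proof -
    \<comment> \<open>Any point is an integral multiple of one close to 0, and \<open>mult\<close>
      transfers the formula from there.\<close>
    obtain n :: nat where n: "norm z / d < real n" using reals_Archimedean2 by blast
    have n0: "n > 0"
    proof (rule ccontr)
      assume "\<not> n > 0"
      thus False using n d divide_nonneg_pos[OF norm_ge_zero d, of z] by simp
    qed
    have "norm (z / of_nat n) < d" using n n0 d by (simp add: norm_divide field_simps)
    hence "\<phi> (\<pi> (z / of_nat n)) = \<pi> (c * (z / of_nat n))"
      using g(1)[OF dW] glin by metis
    from mult[OF this, of n] show ?thesis using n0 by simp
  qed
  thus thesis using that by blast
qed

text \<open>Stated for an arbitrary map so that it also applies to the Rosati conjugate, where it
  gives stability under \<open>cnj c\<close>.\<close>

lemma lattice_stable:
  assumes "\<And>z. f (\<pi> z) = \<pi> (c * z)" "l \<in> \<Lambda>"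
  shows "c * l \<in> \<Lambda>"
proof -
  have "\<pi> 0 = \<pi> l" using assms(2) by (simp add: proj_eq_iff)
  hence "\<pi> (c * 0) = \<pi> (c * l)" using assms(1) by metis
  thus ?thesis by (simp add: proj_eq_iff)
qed

section \<open>The polarisation and the Rosati involution in terms of multipliers\<close>

definition polmult :: "complex \<Rightarrow> complex \<Rightarrow> complex \<Rightarrow> complex" where
  "polmult p z z' = exp (- hcoef * cnj (z' - z) * p)"

abbreviation polbundle :: "complex \<Rightarrow> (complex set, pfib) lbundle" where
  "polbundle p \<equiv> tensor_bundle (pull (ell1 \<Lambda>) (\<lambda>x. x \<otimes>\<^bsub>ell \<Lambda>\<^esub> \<pi> p) (M_bundle \<Lambda>)) (dual_bundle (M_bundle \<Lambda>))"

text \<open>The constant \<open>kap\<close> occurs in both tensor factors and cancels; translation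
  by \<open>p\<close> survives only through the exponential of \<open>autf\<close>.\<close>

lemma polbundle_frame:
  obtains s where "lframe \<pi> lin1 (polbundle p) s" "mults \<pi> (polbundle p) s (polmult p)"
    "base (polbundle p) = quot_space \<pi> (\<lambda>U h. h holomorphic_on U)"
proof -
  note M = mframe_lframe mframe_mults
  note D = hspace.lframe_dual[OF hspace1 M(1)] hspace.mults_dual[OF hspace1 M]
  have e: "\<pi> z \<otimes>\<^bsub>ell \<Lambda>\<^esub> \<pi> p = \<pi> (z + p)" for z by (rule ell_mult)
  have d: "((\<lambda>z. z + p) has_derivative (\<lambda>z. z)) (at z)" for z by (auto intro!: derivative_eq_intros)
  note A = lframe_pull[where f = "\<lambda>x. x \<otimes>\<^bsub>ell \<Lambda>\<^esub> \<pi> p" and F = "\<lambda>z. z + p" and K = lin1,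
      OF M(1) pts1 e d]
    mults_pull[where f = "\<lambda>x. x \<otimes>\<^bsub>ell \<Lambda>\<^esub> \<pi> p" and F = "\<lambda>z. z + p" and X = "ell1 \<Lambda>", OF M(2) e]
  have A1: "lframe \<pi> lin1 (pull (ell1 \<Lambda>) (\<lambda>x. x \<otimes>\<^bsub>ell \<Lambda>\<^esub> \<pi> p) (M_bundle \<Lambda>)) (mframe \<circ> (\<lambda>z. z + p))"
    by (rule A(1)) (simp add: o_def)
  note T = hspace.lframe_tensor[OF hspace1 A1 D(1)] hspace.mults_tensor[OF hspace1 A1 A(2) D]
  note T' = mults_cong[OF T(2) refl, of "polmult p"]
  show thesis
  proof (rule that[OF T(1) T'])
    fix z z' assume "\<pi> z = \<pi> z'"
    hence l: "z' - z \<in> \<Lambda>" by (simp add: proj_eq_iff)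
    have "autf (z' + p - (z + p)) (z + p) = autf (z' - z) z * exp (hcoef * cnj (z' - z) * p)"
      by (simp add: autf_def ring_distribs exp_add)
    thus "1 / autf (z' + p - (z + p)) (z + p) * (1 / (1 / autf (z' - z) z)) = polmult p z z'"
      using autf_nz[OF l, of z]
      by (simp only: polmult_def mult_minus_left exp_minus inverse_eq_divide) simp
  next
    show "base (polbundle p) = quot_space \<pi> (\<lambda>U h. h holomorphic_on U)"
      by (simp add: tensor_bundle_def pull_def ell1_def)
  qed
qed

lemma polarisation_eq:
  "polarisation \<Lambda> (\<pi> p) = {L. base L = ell1 \<Lambda> \<and> (\<exists>s. lframe \<pi> lin1 L s \<and> mults \<pi> L s (polmult p))}"
proof -
  obtain s where s: "lframe \<pi> lin1 (polbundle p) s" "mults \<pi> (polbundle p) s (polmult p)"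
    "base (polbundle p) = quot_space \<pi> (\<lambda>U h. h holomorphic_on U)" using polbundle_frame .
  show ?thesis
    unfolding polarisation_def hspace.pic_class_lframe[OF hspace1 s] by (simp add: ell1_def)
qed

lemma polbundle_mem: "polbundle p \<in> polarisation \<Lambda> (\<pi> p)"
proof -
  obtain s where "lframe \<pi> lin1 (polbundle p) s" "mults \<pi> (polbundle p) s (polmult p)"
    "base (polbundle p) = quot_space \<pi> (\<lambda>U h. h holomorphic_on U)" using polbundle_frame .
  thus ?thesis unfolding polarisation_eq by (auto simp: ell1_def)
qed

text \<open>The logarithmic derivative of \<open>t\<close> is entire and periodic, hence constant,
  so \<open>t\<close> is a constant times the exponential of a linear function.\<close>

lemma semiperiodic_exp:
  assumes t: "\<And>z. chol lin1 z t" "\<And>z. t z \<noteq> 0"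
    and per: "\<And>l z. l \<in> \<Lambda> \<Longrightarrow> t (z + l) = C l * t z"
  obtains k where "\<And>l. l \<in> \<Lambda> \<Longrightarrow> C l = exp (k * l)"
proof -
  have hol: "t holomorphic_on UNIV"
    using t by (simp add: holomorphic_on_def chol_lin1)
  hence der: "(t has_field_derivative deriv t z) (at z)" for z
    using holomorphic_derivI by blast
  have C: "C l \<noteq> 0" if "l \<in> \<Lambda>" for l using per[OF that, of 0] t(2)[of l] by auto
  define h where "h z = deriv t z / t z" for z
  have "chol lin1 z h" for z
  proof -
    have "h holomorphic_on UNIV"
      unfolding h_def using hol t(2) by (intro holomorphic_intros) auto
    thus ?thesis by (simp add: chol_lin1 holomorphic_on_def)
  qed
  moreover have "h z = h z'" if "\<pi> z = \<pi> z'" for z z'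
  proof -
    define l where "l = z' - z"
    have l: "l \<in> \<Lambda>" using that by (simp add: l_def proj_eq_iff)
    have "((\<lambda>w. t (w + l)) has_field_derivative deriv t z') (at z)"
      using der[of z'] DERIV_shift[of t "deriv t z'" z l] by (simp add: l_def)
    moreover have "((\<lambda>w. t (w + l)) has_field_derivative C l * deriv t z) (at z)"
      unfolding per[OF l] using der[of z] by (auto intro!: derivative_eq_intros)
    ultimately have "deriv t z' = C l * deriv t z" by (rule DERIV_unique)
    thus ?thesis using per[OF l, of z] C[OF l] by (simp add: h_def l_def)
  qed
  ultimately have h: "h z = h 0" for z by (rule periodic_const1)
  have "((\<lambda>z. t z * exp (- h 0 * z)) has_field_derivative 0) (at z)" for z
  proof -
    have "deriv t z = h 0 * t z" using h[of z] t(2)[of z] by (simp add: h_def[of z] field_simps)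
    thus ?thesis by (auto intro!: derivative_eq_intros der)
  qed
  hence "\<exists>c. \<forall>z\<in>UNIV. t z * exp (- h 0 * z) = c"
    by (intro has_field_derivative_zero_constant) auto
  then obtain c where "\<And>z. t z * exp (- h 0 * z) = c" by blast
  hence E: "t l * exp (- h 0 * l) = t 0" for l by (metis mult_zero_right exp_zero mult_1_right)
  have "t l = t 0 * exp (h 0 * l)" for l
    using E[of l] by (simp add: exp_minus field_simps)
  from this per have "C l = exp (h 0 * l)" if "l \<in> \<Lambda>" for l
    using that t(2)[of 0] by (metis add_0 mult.commute mult_cancel_left)
  thus thesis using that by blast
qed

text \<open>An isomorphism of the two bundles is a semiperiodic function \<open>t\<close>, so an
  exponential antilinear in the lattice vector must agree with a linear one on the lattice. The two
  basis vectors then force \<open>q - p\<close> into the lattice.\<close>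

lemma polarisation_inj:
  assumes "polarisation \<Lambda> (\<pi> p) = polarisation \<Lambda> (\<pi> q)"
  shows "\<pi> p = \<pi> q"
proof -
  obtain s where s: "lframe \<pi> lin1 (polbundle p) s" "mults \<pi> (polbundle p) s (polmult p)"
    "base (polbundle p) = quot_space \<pi> (\<lambda>U h. h holomorphic_on U)" using polbundle_frame .
  obtain s' where s': "lframe \<pi> lin1 (polbundle q) s'" "mults \<pi> (polbundle q) s' (polmult q)"
    using polbundle_frame by metis
  have "polbundle p \<in> polarisation \<Lambda> (\<pi> q)" using polbundle_mem[of p] assms by simp
  then obtain k where k: "k \<in> bundle_isos (polbundle p) (polbundle q)"
    by (auto simp: polarisation_def pic_class_def)
  obtain t where t: "\<And>z. chol lin1 z t" "\<And>z. t z \<noteq> 0"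
    "\<And>z. k (\<pi> z) (s z) = scl (fib (polbundle q) (\<pi> z)) (t z) (s' z)"
    using hspace.bundle_iso_coeff[OF hspace1 s(1,3) s'(1) k] by blast
  have "t (z + l) = exp (hcoef * cnj l * (q - p)) * t z" if l: "l \<in> \<Lambda>" for l z
  proof -
    have \<pi>: "\<pi> z = \<pi> (z + l)" using proj_add_lattice[OF l] by simp
    note b = lframe_basis[OF s(1), of z] and b' = lframe_basis[OF s'(1), of z]
    note ss = is_line_scl_scl[OF lframe_line[OF s'(1)] line_basis_mem[OF b']]
    have "k (\<pi> z) \<in> line_isos (fib (polbundle p) (\<pi> z)) (fib (polbundle q) (\<pi> z))"
      using k s(3) by (auto simp: bundle_isos_def quot_space_def PiE_iff)
    hence "k (\<pi> z) (s (z + l)) = scl (fib (polbundle q) (\<pi> z)) (polmult p z (z + l) * t z) (s' z)"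
      using line_basis_mem[OF b] multsD[OF s(2) \<pi>] ss by (simp add: line_isos_def t(3))
    moreover have "k (\<pi> z) (s (z + l)) = scl (fib (polbundle q) (\<pi> z)) (t (z + l) * polmult q z (z + l)) (s' z)"
      using t(3)[of "z + l"] multsD[OF s'(2) \<pi>] ss by (simp add: \<pi>[symmetric])
    ultimately have "polmult p z (z + l) * t z = t (z + l) * polmult q z (z + l)"
      using line_basis_inj[OF b'] by metis
    thus ?thesis by (simp add: polmult_def exp_minus exp_diff right_diff_distrib field_simps)
  qed
  then obtain c where c: "\<And>l. l \<in> \<Lambda> \<Longrightarrow> exp (hcoef * cnj l * (q - p)) = exp (c * l)"
    using semiperiodic_exp[OF t(1,2), of "\<lambda>l. exp (hcoef * cnj l * (q - p))"] by blast
  obtain m n :: int where mn: "hcoef * cnj \<omega>1 * (q - p) = c * \<omega>1 + of_int (2 * m) * pi * \<i>"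
     "hcoef * cnj \<omega>2 * (q - p) = c * \<omega>2 + of_int (2 * n) * pi * \<i>"
    using c[OF lattice_\<omega>1] c[OF lattice_\<omega>2] unfolding exp_eq by auto
  \<comment> \<open>This combination of the two equations eliminates the unknown \<open>c\<close>
    and leaves the factor given by Legendre's relation.\<close>
  have "(hcoef * (cnj \<omega>1 * \<omega>2 - \<omega>1 * cnj \<omega>2)) * (q - p) =
      \<omega>2 * (hcoef * cnj \<omega>1 * (q - p)) - \<omega>1 * (hcoef * cnj \<omega>2 * (q - p))"
    by (simp add: algebra_simps)
  also have "\<dots> = (2 * pi * \<i>) * (of_int (- n) * \<omega>1 + of_int m * \<omega>2)"
    unfolding mn by (simp add: algebra_simps)
  finally have "q - p = of_int (- n) * \<omega>1 + of_int m * \<omega>2"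
    unfolding legendre by simp
  thus ?thesis unfolding proj_eq_iff using latticeI by metis
qed

text \<open>\<open>dual_endo\<close> is a union over the representatives of a class. All of them
  pull back to bundles with the same multipliers, so the union is a single class, nonempty by
  \<open>polbundle_mem\<close>; injectivity then inverts the polarisation.\<close>

lemma rosati_eq:
  assumes \<phi>: "\<And>z. \<phi> (\<pi> z) = \<pi> (c * z)"
  shows "rosati \<Lambda> \<phi> (\<pi> p) = \<pi> (cnj c * p)"
proof -
  have pc: "pic_class (pull (ell1 \<Lambda>) \<phi> N) = polarisation \<Lambda> (\<pi> (cnj c * p))"
    if N: "N \<in> polarisation \<Lambda> (\<pi> p)" for N
  proof -
    obtain s where s: "lframe \<pi> lin1 N s" "mults \<pi> N s (polmult p)"
      using N unfolding polarisation_eq by blast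
    have d: "((\<lambda>z. c * z) has_derivative (\<lambda>z. c * z)) (at z)" for z :: complex
      by (auto intro!: derivative_eq_intros)
    have K: "T \<circ> (\<lambda>z. c * z) \<in> lin1" if T: "T \<in> lin1" for T
    proof -
      obtain a where "T = (\<lambda>u. a * u)" using T unfolding lin1_def by blast
      hence "T \<circ> (\<lambda>z. c * z) = (\<lambda>u. (a * c) * u)" by (auto simp: algebra_simps)
      thus ?thesis unfolding lin1_def by blast
    qed
    note P = pull_lframe_mults[OF s pts1 \<phi> d]
    have P1: "lframe \<pi> lin1 (pull (ell1 \<Lambda>) \<phi> N) (\<lambda>z. s (c * z))"
      by (rule P(1)) (rule K)
    have m: "mults \<pi> (pull (ell1 \<Lambda>) \<phi> N) (\<lambda>z. s (c * z)) (polmult (cnj c * p))"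
      by (rule mults_cong[OF P(2)[OF K] refl]) (simp_all add: polmult_def algebra_simps)
    have b: "base (pull (ell1 \<Lambda>) \<phi> N) = quot_space \<pi> (\<lambda>U h. h holomorphic_on U)"
      by (simp add: pull_def ell1_def)
    show ?thesis
      unfolding hspace.pic_class_lframe[OF hspace1 P1 m b] polarisation_eq by (simp add: ell1_def)
  qed
  have "dual_endo \<Lambda> \<phi> (polarisation \<Lambda> (\<pi> p)) = polarisation \<Lambda> (\<pi> (cnj c * p))"
    unfolding dual_endo_def using pc polbundle_mem[of p] by blast
  moreover have "inj_on (polarisation \<Lambda>) (carrier (ell \<Lambda>))"
    unfolding ell_carrier using polarisation_inj by (auto intro!: inj_onI)
  ultimately show ?thesis
    by (simp add: rosati_def inv_into_f_f ell_carrier)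
qed

section \<open>The Ribet section on the plane and its values at torsion points\<close>

lemma ribet_section_eq:
  assumes \<phi>: "\<And>z. \<phi> (\<pi> z) = \<pi> (c * z)"
  shows "ribet_section \<Lambda> \<phi> (\<pi> z) = pelem z ((c - cnj c) * z) 1"
proof -
  let ?d = "c - cnj c" and ?L = "poincare_bundle \<Lambda>"
  define \<gamma> where "\<gamma> = (\<lambda>x. (x, ribet_alpha \<Lambda> \<phi> x))"
  define F where "F = (\<lambda>z. (z, ?d * z))"
  have alpha: "ribet_alpha \<Lambda> \<phi> (\<pi> z) = \<pi> (?d * z)" for z
    by (simp add: ribet_alpha_def rosati_eq[OF \<phi>] \<phi> ell_inv ell_mult left_diff_distrib)
  have e: "\<gamma> (\<pi> z) = proj2 (F z)" for z by (simp add: \<gamma>_def F_def alpha)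
  have d: "(F has_derivative F) (at z)" for z
    unfolding F_def by (auto intro!: derivative_eq_intros)
  have K: "T \<circ> F \<in> lin1" if T: "T \<in> lin2" for T
  proof -
    obtain a b where "T = (\<lambda>(u, v). a * u + b * v)" using T unfolding lin2_def by blast
    hence "T \<circ> F = (\<lambda>u. (a + b * ?d) * u)" by (auto simp: F_def algebra_simps)
    thus ?thesis unfolding lin1_def by blast
  qed
  note P = pull_lframe_mults[OF pframe_lframe pframe_mults pts1 e d]
  have P1: "lframe \<pi> lin1 (pull (ell1 \<Lambda>) \<gamma> ?L) (\<lambda>z. pframe (F z))"
    by (rule P(1)) (rule K)
  have m: "mults \<pi> (pull (ell1 \<Lambda>) \<gamma> ?L) (\<lambda>z. pframe (F z)) (\<lambda>z z'. 1)"
  proof (rule mults_cong[OF P(2)[OF K] refl])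
    fix z z' assume "\<pi> z = \<pi> z'"
    hence l: "z' - z \<in> \<Lambda>" by (simp add: proj_eq_iff)
    \<comment> \<open>As \<open>cnj ?d = - ?d\<close>, the two terms containing \<open>z\<close>
      cancel. What remains compares the lattice vectors \<open>c * (z' - z)\<close> and
      \<open>z' - z\<close>, the situation of \<open>exp_symmetric\<close>.\<close>
    have "pmult (F z) (F z') =
        exp (hcoef * cnj (z' - z) * (c * (z' - z)) - hcoef * cnj (c * (z' - z)) * (z' - z))"
      unfolding pmult_def F_def prod.case by (rule arg_cong[of _ _ exp]) (simp add: algebra_simps)
    also have "\<dots> = 1"
      unfolding exp_diff exp_symmetric[OF lattice_stable[OF \<phi> l] l] by simp
    finally show "pmult (F z) (F z') = 1" .
  qed
  have b: "base (triv_bundle (ell1 \<Lambda>)) = quot_space \<pi> (\<lambda>U h. h holomorphic_on U)"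
    by (simp add: triv_bundle_def ell1_def)
  have zero: "(\<lambda>_. 0) \<in> lin1" using hspace1 by (simp add: hspace_def)
  note T = hspace.the_bundle_iso[where q = \<pi> and K = lin1 and s = "\<lambda>z. 1" and s' = "\<lambda>z. pframe (F z)" and \<mu> = "\<lambda>z z'. 1" and ?z0.0 = 0,
      OF hspace1 liouville1 lframe_triv[OF zero pts1] b P1 m]
  have t: "ribet_triv \<Lambda> \<phi> = (THE t. t \<in> bundle_isos (triv_bundle (ell1 \<Lambda>)) (pull (ell1 \<Lambda>) \<gamma> ?L) \<and>
      t (\<pi> 0) 1 = pframe (F 0))"
    by (simp add: ribet_triv_def \<gamma>_def ell_one poincare_unit_eq F_def)
  have "ribet_triv \<Lambda> \<phi> \<in> bundle_isos (triv_bundle (ell1 \<Lambda>)) (pull (ell1 \<Lambda>) \<gamma> ?L)"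
    unfolding t by (rule T(1))
  hence "ribet_triv \<Lambda> \<phi> \<in> (\<Pi>\<^sub>E p \<in> range \<pi>. line_isos c_line (fib ?L (\<gamma> p)))"
    by (simp add: bundle_isos_def triv_bundle_def pts1 pull_def)
  hence "ribet_triv \<Lambda> \<phi> (\<pi> z) \<in> line_isos c_line (fib ?L (\<gamma> (\<pi> z)))"
    by (rule PiE_mem) (rule rangeI)
  hence lin: "\<forall>a. \<forall>v\<in>vecs c_line. ribet_triv \<Lambda> \<phi> (\<pi> z) (scl c_line a v) =
      scl (fib ?L (\<gamma> (\<pi> z))) a (ribet_triv \<Lambda> \<phi> (\<pi> z) v)"
    unfolding line_isos_def by blast
  have "ribet_triv \<Lambda> \<phi> (\<pi> z) a = scl (fib ?L (\<gamma> (\<pi> z))) a (ribet_triv \<Lambda> \<phi> (\<pi> z) 1)" for a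
    using bspec[OF spec[OF lin, of a] line_basis_mem[OF line_basis_c_line]] by (simp add: c_line_def)
  moreover have "ribet_triv \<Lambda> \<phi> (\<pi> z) 1 = pframe (F z)"
    unfolding t by (rule T(2))
  ultimately have "ribet_triv \<Lambda> \<phi> (\<pi> z) a = scl (fib ?L (\<pi> z, \<pi> (?d * z))) a (pframe (z, ?d * z))" for a
    by (simp add: e F_def)
  thus ?thesis by (auto simp: ribet_section_def pelem_def alpha)
qed

lemma ribet_section_torsion:
  assumes "\<phi> \<in> ell_End \<Lambda>" "torsion_point (ell \<Lambda>) x"
  shows "torsion_point (poincare_group \<Lambda> x) (ribet_section \<Lambda> \<phi> x)"
proof -
  obtain c where \<phi>: "\<And>z. \<phi> (\<pi> z) = \<pi> (c * z)" using ell_End_linear[OF assms(1)] by blast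
  obtain z where x: "x = \<pi> z" using assms(2) by (auto simp: torsion_point_def ell_carrier)
  obtain n :: nat where n: "n > 0" "x [^]\<^bsub>ell \<Lambda>\<^esub> n = \<one>\<^bsub>ell \<Lambda>\<^esub>"
    using assms(2) by (auto simp: torsion_point_def)
  define l where "l = of_nat n * z"
  have l: "l \<in> \<Lambda>" using n(2) by (simp add: x ell_pow proj_eq_one l_def)
  have cl: "c * l \<in> \<Lambda>" by (rule lattice_stable[OF \<phi> l])
  have ccl: "cnj c * l \<in> \<Lambda>" by (rule lattice_stable[OF rosati_eq[OF \<phi>] l])
  \<comment> \<open>One factor \<open>n\<close> moves the second coordinate into the lattice, which
    leaves only a scalar; the other turns the remaining \<open>z\<close> in the exponent of that
    scalar into the lattice vector \<open>l\<close>.\<close>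
  let ?w = "of_nat (n * n) * ((c - cnj c) * z)"
  have w: "?w = of_nat n * (c * l - cnj c * l)" by (simp add: l_def algebra_simps)
  have "exp (- hcoef * cnj ?w * z) = exp (hcoef * cnj l * (c * l) - hcoef * cnj (c * l) * l)"
    unfolding w by (rule arg_cong[of _ _ exp]) (simp add: l_def algebra_simps)
  also have "\<dots> = 1" unfolding exp_diff exp_symmetric[OF cl l] by simp
  finally have E: "exp (- hcoef * cnj ?w * z) = 1" .
  have "?w \<in> \<Lambda>" unfolding w by (rule lattice_of_nat_mult[OF lattice_diff[OF cl ccl]])
  from pelem_lattice[OF this, of z 1] have "pelem z ?w 1 = pelem z 0 1" by (simp only: E mult_1)
  hence "ribet_section \<Lambda> \<phi> x [^]\<^bsub>poincare_group \<Lambda> x\<^esub> (n * n) = \<one>\<^bsub>poincare_group \<Lambda> x\<^esub>"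
    by (simp only: x ribet_section_eq[OF \<phi>] pelem_pow pelem_one power_one)
  moreover have "ribet_section \<Lambda> \<phi> x \<in> carrier (poincare_group \<Lambda> x)"
    unfolding x ribet_section_eq[OF \<phi>] by (rule pelem_carrier) simp
  ultimately show ?thesis using n(1) unfolding torsion_point_def by (metis nat_0_less_mult_iff)
qed

end

text \<open>Real linear independence says that \<open>Im (cnj a * b)\<close> is nonzero, since
  otherwise \<open>b\<close> would be a real multiple of \<open>a\<close>; exchanging the two
  vectors changes its sign.\<close>

lemma is_lattice_oriented:
  assumes "is_lattice \<Lambda>"
  obtains \<omega>1 \<omega>2 where "oriented_lattice \<Lambda> \<omega>1 \<omega>2"
proof -
  obtain a b where ab: "a \<noteq> b" "independent {a, b}"
    "\<Lambda> = {of_int m * a + of_int n * b | m n. True}"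
    using assms by (auto simp: is_lattice_def)
  have "a \<noteq> 0" using ab(2) dependent_zero by blast
  have "Im (cnj a * b) \<noteq> 0"
  proof
    assume "Im (cnj a * b) = 0"
    hence "cnj a * b = of_real (Re (cnj a * b))" by (simp add: complex_eq_iff)
    hence "a * (cnj a * b) = of_real (Re (cnj a * b)) * a" by simp
    hence "of_real ((norm a)\<^sup>2) * b = of_real (Re (cnj a * b)) * a"
      by (simp only: complex_norm_square mult.assoc)
    hence "b = (Re (cnj a * b) / (norm a)\<^sup>2) *\<^sub>R a"
      using \<open>a \<noteq> 0\<close> by (simp add: scaleR_conv_of_real field_simps)
    hence "b \<in> span {a}" using span_base[of a "{a}"] span_scale by (metis insertI1)
    thus False using ab(1,2) by (simp add: independent_insert insert_commute[of a b])
  qed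
  then consider "Im (cnj a * b) > 0" | "Im (cnj b * a) > 0" by (auto simp: algebra_simps) linarith
  thus thesis
  proof cases
    case 1
    thus thesis using that[of a b] ab(3) by (simp add: oriented_lattice_def)
  next
    case 2
    have "\<Lambda> = {of_int m * b + of_int n * a | m n. True}"
      unfolding ab(3) by (intro Collect_cong) (metis add.commute)
    thus thesis using that[of b a] 2 by (simp add: oriented_lattice_def)
  qed
qed

theorem theorem2p4:
  fixes \<Lambda> :: "complex set" and \<phi> :: "complex set \<Rightarrow> complex set" and x :: "complex set"
  assumes "is_lattice \<Lambda>"
    and "\<phi> \<in> ell_End \<Lambda>"
    and "torsion_point (ell \<Lambda>) x"
  shows "torsion_point (poincare_group \<Lambda> x) (ribet_section \<Lambda> \<phi> x)"
proof -
  obtain \<omega>1 \<omega>2 where "oriented_lattice \<Lambda> \<omega>1 \<omega>2" using is_lattice_oriented[OF assms(1)] .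
  thus ?thesis using oriented_lattice.ribet_section_torsion assms(2,3) by blast
qed

end
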